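(* Let $(\Omega,\mathfrak F,\mathbb P,(\theta_t)_{t\in\mathbb R})$ be a metric dynamical system, let $K>0$, and let $(\mu_\omega)_{\omega\in\Omega}$ be a family in $\mathfrak m$. Assume that, for every $T>0$, the coefficient path $(\mu_{\theta_t\omega})_{t\in[0,T]}$ belongs to $\mathfrak m_T$ for every $\omega\in\Omega$, and that the mapping $\Omega\ni\omega\mapsto(\mu_{\theta_t\omega})_{t\in[0,T]}\in\mathfrak m_T$ is $(\mathfrak F,\Sigma_T)$-measurable. Then the solution operators $(U_\omega(t))_{\omega\in\Omega,t\ge0}$ define a measurable linear skew-product semiflow on $AC([-1,0])$ covering $(\theta_t)_{t\in\mathbb R}$.
   Context: A metric dynamical system consists of a probability space $(\Omega,\mathfrak F,\mathbb P)$ with $\mathbb P$ complete and a $(\mathfrak B(\mathbb R)\otimes\mathfrak F,\mathfrak F)$-measurable map $\theta:\mathbb R\times\Omega\to\Omega$, $\theta_t\omega=\theta(t,\omega)$, with $\theta_0=\mathrm{id}$, $\theta_{t+s}=\theta_t\circ\theta_s$, and each $\theta_t$ preserving $\mathbb P$. $\mathfrak m$ is the set of finite signed Borel measures on $[-1,0]$ with total variation norm at most $K$. $\mathfrak m_T$ is the set of all maps $\mu:[0,T]\to\mathfrak m$, $t\mapsto\mu_t$, such that for every $f\in C([-1,0])$ the function $t\mapsto\int_{[-1,0]}f\,d\mu_t$ is Lebesgue measurable on $[0,T]$. $\Sigma_T$ is the smallest $\sigma$-algebra on $\mathfrak m_T$ making all maps $\mu\mapsto\int_0^t\int_{[-1,0]}y(\tau+s)\,d\mu_\tau(s)\,d\tau$,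 $y\in AC([-1,T])$, $t\in[0,T]$, Borel measurable. $AC([a,b])$ is the Banach space of real absolutely continuous functions with norm $|u(a)|+\int_a^b|u'|$. For $\omega\in\Omega$ and $u_0\in AC([-1,0])$, let $z$ be the unique continuous function on $[-1,\infty)$ with $z=u_0$ on $[-1,0]$ and $z(t)=u_0(0)+\int_0^t\int_{[-1,0]}z(\tau+r)\,d\mu_{\theta_\tau\omega}(r)\,d\tau$ for $t\ge0$; then $(U_\omega(t)u_0)(s)=z(t+s)$, $s\in[-1,0]$. A measurable linear skew-product semiflow on a Banach space $X$ covering $(\theta_t)$ is a $(\mathfrak B([0,\infty))\otimes\mathfrak F\otimes\mathfrak B(X),\mathfrak B(X))$-measurable mapping $[0,\infty)\times\Omega\times X\ni(t,\omega,u)\mapsto U_\omega(t)u\in X$ such that $U_\omega(0)=\mathrm{Id}_X$ for all $\omega$; $U_{\theta_s\omega}(t)\circ U_\omega(s)=U_\omega(t+s)$ for all $\omega$ and $t,s\ge0$; and $U_\omega(t)$ is a bounded linear operator on $X$ for all $\omega$ and $t\ge0$. *)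

theory Defs
  imports "HOL-Probability.Probability"
begin

section \<open>Metric dynamical systems\<close>

locale metric_dynamical_system = prob_space M + complete_measure M
  for M :: "'w measure" +
  fixes \<theta> :: "real \<Rightarrow> 'w \<Rightarrow> 'w"
  assumes flow_measurable: "(\<lambda>(t, \<omega>). \<theta> t \<omega>) \<in> borel \<Otimes>\<^sub>M M \<rightarrow>\<^sub>M M"
    and flow_zero: "\<And>\<omega>. \<omega> \<in> space M \<Longrightarrow> \<theta> 0 \<omega> = \<omega>"
    and flow_add: "\<And>t s \<omega>. \<omega> \<in> space M \<Longrightarrow> \<theta> (t + s) \<omega> = \<theta> t (\<theta> s \<omega>)"
    and flow_preserves: "\<And>t. distr M M (\<theta> t) = M"


section \<open>Finite signed measures\<close>

text \<open>Signed measures are set functions on \<^term>\<open>sets M\<close>, normalised to be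
  \<^const>\<open>undefined\<close> off \<^term>\<open>sets M\<close>, so that equality is equality of signed measures.\<close>

definition signed_measures :: "'a measure \<Rightarrow> ('a set \<Rightarrow> real) set" where
  "signed_measures M = {\<nu> \<in> extensional (sets M). \<nu> {} = 0 \<and>
     (\<forall>A :: nat \<Rightarrow> 'a set. range A \<subseteq> sets M \<longrightarrow> disjoint_family A \<longrightarrow>
        (\<lambda>i. \<nu> (A i)) sums \<nu> (\<Union>i. A i))}"

definition variation_norm :: "'a measure \<Rightarrow> ('a set \<Rightarrow> real) \<Rightarrow> ennreal" where
  "variation_norm M \<nu> =
     (SUP P \<in> {P. finite P \<and> P \<subseteq> sets M \<and> partition_on (space M) P}. ennreal (\<Sum>A\<in>P. \<bar>\<nu> A\<bar>))"

text \<open>The positive part in the Jordan decomposition; the negative part is the positive part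
  of the negated set function. Since \<^const>\<open>ennreal\<close> sends negative reals to 0 and the empty
  set competes in the supremum, nothing is lost by the truncation.\<close>

definition positive_part :: "'a measure \<Rightarrow> ('a set \<Rightarrow> real) \<Rightarrow> 'a measure" where
  "positive_part M \<nu> = measure_of (space M) (sets M) (\<lambda>A. SUP B \<in> {B \<in> sets M. B \<subseteq> A}. ennreal (\<nu> B))"

definition signed_integral :: "'a measure \<Rightarrow> ('a set \<Rightarrow> real) \<Rightarrow> ('a \<Rightarrow> real) \<Rightarrow> real" where
  "signed_integral M \<nu> f =
     integral\<^sup>L (positive_part M \<nu>) f - integral\<^sup>L (positive_part M (\<lambda>A. - \<nu> A)) f"

abbreviation delay_space :: "real measure" where
  "delay_space \<equiv> restrict_space borel {-1..0}"

definition delay_measures :: "real \<Rightarrow> (real set \<Rightarrow> real) set" where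
  "delay_measures K = {\<nu> \<in> signed_measures delay_space. variation_norm delay_space \<nu> \<le> ennreal K}"


section \<open>Absolutely continuous functions\<close>

definition abs_cont_on :: "real \<Rightarrow> real \<Rightarrow> (real \<Rightarrow> real) \<Rightarrow> bool" where
  "abs_cont_on a b u \<longleftrightarrow> (\<forall>\<epsilon>>0. \<exists>\<delta>>0. \<forall>D :: (real \<times> real) set.
     finite D \<longrightarrow> (\<forall>(c, d)\<in>D. a \<le> c \<and> c \<le> d \<and> d \<le> b) \<longrightarrow>
     disjoint_family_on (\<lambda>(c, d). {c<..<d}) D \<longrightarrow>
     (\<Sum>(c, d)\<in>D. d - c) < \<delta> \<longrightarrow> (\<Sum>(c, d)\<in>D. \<bar>u d - u c\<bar>) < \<epsilon>)"

lemma abs_cont_on_lincomb: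
  assumes u: "abs_cont_on a b u" and v: "abs_cont_on a b v"
  shows "abs_cont_on a b (\<lambda>s. p * u s + q * v s)"
  unfolding abs_cont_on_def
proof (intro allI impI)
  fix \<epsilon> :: real assume "\<epsilon> > 0"
  define \<eta> where "\<eta> = \<epsilon> / (\<bar>p\<bar> + \<bar>q\<bar> + 1)"
  have \<eta>: "\<eta> > 0" using \<open>\<epsilon> > 0\<close> by (simp add: \<eta>_def add_nonneg_pos)
  obtain \<delta>1 where \<delta>1: "\<delta>1 > 0" "\<forall>D :: (real \<times> real) set.
     finite D \<longrightarrow> (\<forall>(c, d)\<in>D. a \<le> c \<and> c \<le> d \<and> d \<le> b) \<longrightarrow>
     disjoint_family_on (\<lambda>(c, d). {c<..<d}) D \<longrightarrow>
     (\<Sum>(c, d)\<in>D. d - c) < \<delta>1 \<longrightarrow> (\<Sum>(c, d)\<in>D. \<bar>u d - u c\<bar>) < \<eta>"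
    using u \<eta> unfolding abs_cont_on_def by blast
  obtain \<delta>2 where \<delta>2: "\<delta>2 > 0" "\<forall>D :: (real \<times> real) set.
     finite D \<longrightarrow> (\<forall>(c, d)\<in>D. a \<le> c \<and> c \<le> d \<and> d \<le> b) \<longrightarrow>
     disjoint_family_on (\<lambda>(c, d). {c<..<d}) D \<longrightarrow>
     (\<Sum>(c, d)\<in>D. d - c) < \<delta>2 \<longrightarrow> (\<Sum>(c, d)\<in>D. \<bar>v d - v c\<bar>) < \<eta>"
    using v \<eta> unfolding abs_cont_on_def by blast
  show "\<exists>\<delta>>0. \<forall>D :: (real \<times> real) set.
     finite D \<longrightarrow> (\<forall>(c, d)\<in>D. a \<le> c \<and> c \<le> d \<and> d \<le> b) \<longrightarrow>
     disjoint_family_on (\<lambda>(c, d). {c<..<d}) D \<longrightarrow>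
     (\<Sum>(c, d)\<in>D. d - c) < \<delta> \<longrightarrow>
     (\<Sum>(c, d)\<in>D. \<bar>(p * u d + q * v d) - (p * u c + q * v c)\<bar>) < \<epsilon>"
  proof (intro exI[of _ "min \<delta>1 \<delta>2"] conjI allI impI)
    show "min \<delta>1 \<delta>2 > 0" using \<delta>1 \<delta>2 by simp
    fix D :: "(real \<times> real) set"
    assume D: "finite D" "\<forall>(c, d)\<in>D. a \<le> c \<and> c \<le> d \<and> d \<le> b"
      "disjoint_family_on (\<lambda>(c, d). {c<..<d}) D" "(\<Sum>(c, d)\<in>D. d - c) < min \<delta>1 \<delta>2"
    let ?U = "\<Sum>(c, d)\<in>D. \<bar>u d - u c\<bar>" and ?V = "\<Sum>(c, d)\<in>D. \<bar>v d - v c\<bar>"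
    have U: "?U < \<eta>" using D \<delta>1(2) by simp
    have V: "?V < \<eta>" using D \<delta>2(2) by simp
    have "(\<Sum>(c, d)\<in>D. \<bar>(p * u d + q * v d) - (p * u c + q * v c)\<bar>)
        \<le> (\<Sum>(c, d)\<in>D. \<bar>p\<bar> * \<bar>u d - u c\<bar> + \<bar>q\<bar> * \<bar>v d - v c\<bar>)"
    proof (rule sum_mono, clarify)
      fix c d
      have "(p * u d + q * v d) - (p * u c + q * v c) = p * (u d - u c) + q * (v d - v c)"
        by (simp add: algebra_simps)
      then show "\<bar>(p * u d + q * v d) - (p * u c + q * v c)\<bar>
          \<le> \<bar>p\<bar> * \<bar>u d - u c\<bar> + \<bar>q\<bar> * \<bar>v d - v c\<bar>"
        by (metis abs_mult abs_triangle_ineq)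
    qed
    also have "\<dots> = \<bar>p\<bar> * ?U + \<bar>q\<bar> * ?V"
      by (simp add: case_prod_unfold sum.distrib sum_distrib_left)
    also have "\<dots> \<le> \<bar>p\<bar> * \<eta> + \<bar>q\<bar> * \<eta>"
      using U V by (intro add_mono mult_left_mono) auto
    also have "\<dots> < (\<bar>p\<bar> + \<bar>q\<bar> + 1) * \<eta>" using \<eta> by (simp add: algebra_simps)
    also have "\<dots> = \<epsilon>"
      unfolding \<eta>_def by (simp add: add_nonneg_pos less_imp_neq[THEN not_sym])
    finally show "(\<Sum>(c, d)\<in>D. \<bar>(p * u d + q * v d) - (p * u c + q * v c)\<bar>) < \<epsilon>" .
  qed
qed

lemma abs_cont_on_zero: "abs_cont_on a b (\<lambda>s. 0)"
  unfolding abs_cont_on_def by (auto intro: exI[of _ 1])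

text \<open>The space \<open>AC([-1,0])\<close>. Functions on \<open>[-1,0]\<close> are represented by their extension
  by 0 to the real line.\<close>

typedef ac = "{u :: real \<Rightarrow> real. abs_cont_on (-1) 0 u \<and> (\<forall>s. s \<notin> {-1..0} \<longrightarrow> u s = 0)}"
  morphisms ac_apply Abs_ac
  by (rule exI[of _ "\<lambda>s. 0"]) (simp add: abs_cont_on_zero)

setup_lifting type_definition_ac

instantiation ac :: real_vector
begin

lift_definition zero_ac :: ac is "\<lambda>s. 0"
  by (simp add: abs_cont_on_zero)

lift_definition plus_ac :: "ac \<Rightarrow> ac \<Rightarrow> ac" is "\<lambda>u v s. u s + v s"
  using abs_cont_on_lincomb[where p = 1 and q = 1] by simp

lift_definition minus_ac :: "ac \<Rightarrow> ac \<Rightarrow> ac" is "\<lambda>u v s. u s - v s"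
  using abs_cont_on_lincomb[where p = 1 and q = "-1"] by simp

lift_definition uminus_ac :: "ac \<Rightarrow> ac" is "\<lambda>u s. - u s"
  using abs_cont_on_lincomb[OF _ abs_cont_on_zero, where p = "-1"] by simp

lift_definition scaleR_ac :: "real \<Rightarrow> ac \<Rightarrow> ac" is "\<lambda>r u s. r * u s"
  using abs_cont_on_lincomb[OF _ abs_cont_on_zero] by simp

instance
  by standard (transfer; simp add: algebra_simps)+

end

text \<open>\<^const>\<open>deriv\<close> is the two-sided derivative; it is unspecified, but harmless, at the
  null set of points where \<open>u\<close> has none (in particular possibly at the endpoints).\<close>

definition ac_norm :: "ac \<Rightarrow> real" where
  "ac_norm u = \<bar>ac_apply u (-1)\<bar> + (LINT s:{-1..0}|lebesgue. \<bar>deriv (ac_apply u) s\<bar>)"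


section \<open>Coefficient paths\<close>

definition coefficient_paths :: "real \<Rightarrow> real \<Rightarrow> (real \<Rightarrow> real set \<Rightarrow> real) set" where
  "coefficient_paths K T = {\<nu> \<in> {0..T} \<rightarrow>\<^sub>E delay_measures K.
     \<forall>f. continuous_on {-1..0} f \<longrightarrow>
       (\<lambda>t. signed_integral delay_space (\<nu> t) f) \<in> borel_measurable (lebesgue_on {0..T})}"

definition path_functional :: "(real \<Rightarrow> real) \<Rightarrow> real \<Rightarrow> (real \<Rightarrow> real set \<Rightarrow> real) \<Rightarrow> real" where
  "path_functional y t \<nu> =
     (LINT \<tau>:{0..t}|lebesgue. signed_integral delay_space (\<nu> \<tau>) (\<lambda>s. y (\<tau> + s)))"

text \<open>\<^term>\<open>path_algebra K T\<close> is used only as a measurable space: \<open>\<Sigma>\<^sub>T\<close> is its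
  family of measurable sets.\<close>

definition path_algebra :: "real \<Rightarrow> real \<Rightarrow> (real \<Rightarrow> real set \<Rightarrow> real) measure" where
  "path_algebra K T = sigma (coefficient_paths K T)
     {path_functional y t -` B \<inter> coefficient_paths K T | y t B.
        abs_cont_on (-1) T y \<and> t \<in> {0..T} \<and> B \<in> sets borel}"


section \<open>Solution operators\<close>

definition delay_solution :: "(real \<Rightarrow> real set \<Rightarrow> real) \<Rightarrow> (real \<Rightarrow> real) \<Rightarrow> (real \<Rightarrow> real) \<Rightarrow> bool" where
  "delay_solution \<nu> u\<^sub>0 z \<longleftrightarrow> continuous_on {-1..} z \<and> (\<forall>s\<in>{-1..0}. z s = u\<^sub>0 s) \<and>
     (\<forall>t\<ge>0. z t = u\<^sub>0 0 + (LINT \<tau>:{0..t}|lebesgue. signed_integral delay_space (\<nu> \<tau>) (\<lambda>r. z (\<tau> + r))))"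

text \<open>Extensionality makes the solution, a function on \<open>[-1,\<infinity>)\<close>, unique as a total function.\<close>

definition the_delay_solution :: "(real \<Rightarrow> real set \<Rightarrow> real) \<Rightarrow> (real \<Rightarrow> real) \<Rightarrow> real \<Rightarrow> real" where
  "the_delay_solution \<nu> u\<^sub>0 = (THE z. z \<in> extensional {-1..} \<and> delay_solution \<nu> u\<^sub>0 z)"

definition solution_operator ::
    "(real \<Rightarrow> 'w \<Rightarrow> 'w) \<Rightarrow> ('w \<Rightarrow> real set \<Rightarrow> real) \<Rightarrow> 'w \<Rightarrow> real \<Rightarrow> ac \<Rightarrow> ac" where
  "solution_operator \<theta> \<mu> \<omega> t u\<^sub>0 = Abs_ac (\<lambda>s. if s \<in> {-1..0}
     then the_delay_solution (\<lambda>\<tau>. \<mu> (\<theta> \<tau> \<omega>)) (ac_apply u\<^sub>0) (t + s) else 0)"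


section \<open>Measurable linear skew-product semiflows\<close>

text \<open>The Banach norm is an explicit parameter rather than a type class operation: that
  \<^const>\<open>ac_norm\<close> is a complete norm rests on Lebesgue's theorems on absolutely continuous
  functions, which are not used to set up the type \<^typ>\<open>ac\<close>.\<close>

definition banach_norm :: "('v::real_vector \<Rightarrow> real) \<Rightarrow> bool" where
  "banach_norm N \<longleftrightarrow> (\<forall>u. 0 \<le> N u) \<and> (\<forall>u. N u = 0 \<longleftrightarrow> u = 0) \<and>
     (\<forall>r u. N (r *\<^sub>R u) = \<bar>r\<bar> * N u) \<and> (\<forall>u v. N (u + v) \<le> N u + N v) \<and>
     Metric_space.mcomplete UNIV (\<lambda>u v. N (u - v))"

definition norm_borel :: "('v::real_vector \<Rightarrow> real) \<Rightarrow> 'v measure" where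
  "norm_borel N = sigma UNIV {V. openin (Metric_space.mtopology UNIV (\<lambda>u v. N (u - v))) V}"

locale measurable_linear_skew_product_semiflow = metric_dynamical_system M \<theta>
  for M :: "'w measure" and \<theta> +
  fixes N :: "'v::real_vector \<Rightarrow> real" and U :: "'w \<Rightarrow> real \<Rightarrow> 'v \<Rightarrow> 'v"
  assumes banach: "banach_norm N"
    and semiflow_measurable:
      "(\<lambda>(t, \<omega>, u). U \<omega> t u) \<in> restrict_space borel {0..} \<Otimes>\<^sub>M M \<Otimes>\<^sub>M norm_borel N \<rightarrow>\<^sub>M norm_borel N"
    and semiflow_zero: "\<And>\<omega>. \<omega> \<in> space M \<Longrightarrow> U \<omega> 0 = id"
    and cocycle: "\<And>\<omega> t s. \<omega> \<in> space M \<Longrightarrow> 0 \<le> t \<Longrightarrow> 0 \<le> s \<Longrightarrow>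
      U (\<theta> s \<omega>) t \<circ> U \<omega> s = U \<omega> (t + s)"
    and linear: "\<And>\<omega> t. \<omega> \<in> space M \<Longrightarrow> 0 \<le> t \<Longrightarrow> Real_Vector_Spaces.linear (U \<omega> t)"
    and bounded: "\<And>\<omega> t. \<omega> \<in> space M \<Longrightarrow> 0 \<le> t \<Longrightarrow> \<exists>C. \<forall>u. N (U \<omega> t u) \<le> C * N u"

end

theory Submission
  imports Defs
begin

text \<open>Along one orbit the coefficient is a path of signed measures of variation at most \<open>K\<close>. The
  integral operator \<open>y \<mapsto> (t \<mapsto> \<integral>\<^sub>0\<^sup>t \<integral> y(\<tau> + s) d\<nu>\<^sub>\<tau>(s) d\<tau>)\<close> then multiplies sup norms on \<open>[-1,t]\<close> by at most
  \<open>2Kt\<close>, and its \<open>n\<close>-th iterate by at most \<open>(2Kt)\<^sup>n/n!\<close>. Hence the Picard series converges, its sum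
  solves the delay equation (\<open>delay_solution_solution\<close>), and no other function does
  (\<open>delay_solution_unique\<close>). Linearity and the cocycle property follow from uniqueness, since
  combinations and time shifts of solutions are solutions. On \<open>[0,t]\<close> a solution is Lipschitz, with a
  constant proportional to the norm of the initial function, which gives boundedness.

  The difficulty is joint measurability into the Borel sets of the norm
  \<open>|u(-1)| + \<integral>|u'|\<close>. It is reduced to the measurability of point values. For this the norm, defined
  through the derivative, is recovered as the limit of \<open>|u(-1)|\<close> plus the variation of \<open>u\<close> over finer
  and finer grids (\<open>grid_variation_tendsto\<close>), and piecewise linear interpolants are shown to converge in
  norm (\<open>interpolant_ac_tendsto\<close>), so that the space is separable. A map into the space is therefore
  measurable as soon as all its point values are (\<open>measurable_norm_borelI\<close>). The same description of the
  norm by finite sums yields the norm axioms and completeness.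

  The point values of the solution depend continuously on time, so it is enough to treat a fixed time. The
  hypothesis says that the integral operator applied to a fixed absolutely continuous function is
  measurable in \<open>\<omega>\<close>. Interpolation by hat functions extends this to functions that themselves depend on
  the parameters (\<open>path_functional_measurable_parametric\<close>), and then to all terms of the Picard series.

  The description of the norm rests on Lebesgue's theorems for absolutely continuous functions.
  Differentiability almost everywhere is proved by Austin's argument: points with both steep ascents and
  steep descents nearby would make the variation larger than it is, by Vitali's covering theorem
  (\<open>negligible_oscillating_slopes\<close>). The fundamental theorem of calculus is obtained for the gauge integral,
  where absolute continuity directly controls the Riemann sums over the exceptional null set. Fatou's and
  Scheffe's lemmas give integrability of the derivative and the convergence of the slopes in the mean.\<close>

section \<open>Packings and bounded variation\<close>

text \<open>Degenerate intervals are excluded and disjointness of the interiors is expressed by the order of the end points, so that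
  the members of a packing are linearly ordered.\<close>

definition packing :: "real \<Rightarrow> real \<Rightarrow> (real \<times> real) set \<Rightarrow> bool" where
  "packing a b D \<longleftrightarrow> finite D \<and> (\<forall>(c, d)\<in>D. a \<le> c \<and> c < d \<and> d \<le> b) \<and>
     (\<forall>(c, d)\<in>D. \<forall>(c', d')\<in>D. (c, d) \<noteq> (c', d') \<longrightarrow> d \<le> c' \<or> d' \<le> c)"

abbreviation total_length :: "(real \<times> real) set \<Rightarrow> real" where
  "total_length D \<equiv> \<Sum>(c, d)\<in>D. d - c"

abbreviation variation_over :: "(real \<Rightarrow> real) \<Rightarrow> (real \<times> real) set \<Rightarrow> real" where
  "variation_over u D \<equiv> \<Sum>(c, d)\<in>D. \<bar>u d - u c\<bar>"

lemma packing_empty [simp]: "packing a b {}"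
  by (simp add: packing_def)

lemma packing_trivial: "b \<le> a \<Longrightarrow> packing a b D \<longleftrightarrow> D = {}"
  by (force simp: packing_def)

lemma packing_finite: "packing a b D \<Longrightarrow> finite D"
  by (simp add: packing_def)

lemma packing_bounds:
  "packing a b D \<Longrightarrow> (c, d) \<in> D \<Longrightarrow> a \<le> c \<and> c < d \<and> d \<le> b"
  by (fastforce simp: packing_def)

lemma packing_separated:
  "packing a b D \<Longrightarrow> (c, d) \<in> D \<Longrightarrow> (c', d') \<in> D \<Longrightarrow> (c, d) \<noteq> (c', d') \<Longrightarrow> d \<le> c' \<or> d' \<le> c"
  by (fastforce simp: packing_def)

lemma packingI:
  assumes "finite D" "\<And>c d. (c, d) \<in> D \<Longrightarrow> a \<le> c \<and> c < d \<and> d \<le> b"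
    "\<And>c d c' d'. (c, d) \<in> D \<Longrightarrow> (c', d') \<in> D \<Longrightarrow> (c, d) \<noteq> (c', d') \<Longrightarrow> d \<le> c' \<or> d' \<le> c"
  shows "packing a b D"
  unfolding packing_def using assms by blast

lemma packing_subset:
  assumes "packing a b D" "D' \<subseteq> D" "\<And>c d. (c, d) \<in> D' \<Longrightarrow> a' \<le> c \<and> d \<le> b'"
  shows "packing a' b' D'"
proof (rule packingI)
  show "finite D'" using assms(1,2) finite_subset packing_finite by blast
  show "a' \<le> c \<and> c < d \<and> d \<le> b'" if "(c, d) \<in> D'" for c d
    using assms(2) assms(3)[OF that] packing_bounds[OF assms(1), of c d] that by auto
  show "d \<le> c' \<or> d' \<le> c" if "(c, d) \<in> D'" "(c', d') \<in> D'" "(c, d) \<noteq> (c', d')" for c d c' d'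
    using packing_separated[OF assms(1), of c d c' d'] assms(2) that by blast
qed

lemma packing_mono:
  "packing a b D \<Longrightarrow> a' \<le> a \<Longrightarrow> b \<le> b' \<Longrightarrow> packing a' b' D"
  by (rule packing_subset[of a b D D]) (auto dest: packing_bounds)

text \<open>Degenerate intervals contribute nothing to either sum in the definition of absolute
  continuity, so it suffices to test packings.\<close>

lemma abs_cont_on_iff_packing:
  "abs_cont_on a b u \<longleftrightarrow> (\<forall>\<epsilon>>0. \<exists>\<delta>>0. \<forall>D. packing a b D \<longrightarrow>
     total_length D < \<delta> \<longrightarrow> variation_over u D < \<epsilon>)"
proof -
  have 1: "disjoint_family_on (\<lambda>(c, d). {c<..<d}) D" if "packing a b D" for D
    using packing_separated[OF that] unfolding disjoint_family_on_def by fastforce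
  have 2: "\<exists>D'. packing a b D' \<and> total_length D' = total_length D \<and>
      variation_over u D' = variation_over u D"
    if D: "finite D" "\<forall>(c, d)\<in>D. a \<le> c \<and> c \<le> d \<and> d \<le> b"
      "disjoint_family_on (\<lambda>(c, d). {c<..<d}) D" for D :: "(real \<times> real) set"
  proof (intro exI[of _ "{(c, d)\<in>D. c < d}"] conjI)
    show "packing a b {(c, d)\<in>D. c < d}"
    proof (rule packingI)
      fix c d c' d' :: real
      assume A: "(c, d) \<in> {(c, d)\<in>D. c < d}" "(c', d') \<in> {(c, d)\<in>D. c < d}" "(c, d) \<noteq> (c', d')"
      then have "{c<..<d} \<inter> {c'<..<d'} = {}"
        using D(3) unfolding disjoint_family_on_def by fastforce
      show "d \<le> c' \<or> d' \<le> c"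
      proof (rule ccontr)
        assume "\<not> ?thesis"
        then have "max c c' < min d d'" using A by auto
        then obtain x where "max c c' < x" "x < min d d'" using dense by blast
        then have "x \<in> {c<..<d} \<inter> {c'<..<d'}" by auto
        then show False using \<open>{c<..<d} \<inter> {c'<..<d'} = {}\<close> by blast
      qed
    qed (use D in \<open>auto intro: finite_subset[OF _ D(1)]\<close>)
    show "(\<Sum>(c, d)\<in>{(c, d)\<in>D. c < d}. d - c) = total_length D"
      by (rule sum.mono_neutral_left) (use D in \<open>auto simp: less_le\<close>)
    show "(\<Sum>(c, d)\<in>{(c, d)\<in>D. c < d}. \<bar>u d - u c\<bar>) = variation_over u D"
      by (rule sum.mono_neutral_left) (use D in \<open>auto simp: less_le\<close>)
  qed
  have 3: "finite D \<and> (\<forall>(c, d)\<in>D. a \<le> c \<and> c \<le> d \<and> d \<le> b)" if "packing a b D" for D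
    using that by (auto dest: packing_bounds packing_finite)
  show ?thesis
  proof
    assume "abs_cont_on a b u"
    then show "\<forall>\<epsilon>>0. \<exists>\<delta>>0. \<forall>D. packing a b D \<longrightarrow>
       total_length D < \<delta> \<longrightarrow> variation_over u D < \<epsilon>"
      unfolding abs_cont_on_def using 1 3 by meson
  next
    assume R: "\<forall>\<epsilon>>0. \<exists>\<delta>>0. \<forall>D. packing a b D \<longrightarrow>
       total_length D < \<delta> \<longrightarrow> variation_over u D < \<epsilon>"
    show "abs_cont_on a b u"
      unfolding abs_cont_on_def
    proof (intro allI impI)
      fix \<epsilon> :: real assume "\<epsilon> > 0"
      then obtain \<delta> where \<delta>: "\<delta> > 0" "\<And>D. packing a b D \<Longrightarrow>
        total_length D < \<delta> \<Longrightarrow> variation_over u D < \<epsilon>" using R by blast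
      show "\<exists>\<delta>>0. \<forall>D :: (real \<times> real) set. finite D \<longrightarrow> (\<forall>(c, d)\<in>D. a \<le> c \<and> c \<le> d \<and> d \<le> b) \<longrightarrow>
         disjoint_family_on (\<lambda>(c, d). {c<..<d}) D \<longrightarrow>
         total_length D < \<delta> \<longrightarrow> variation_over u D < \<epsilon>"
      proof (intro exI[of _ \<delta>] conjI allI impI)
        fix D :: "(real \<times> real) set"
        assume "finite D" "\<forall>(c, d)\<in>D. a \<le> c \<and> c \<le> d \<and> d \<le> b"
          "disjoint_family_on (\<lambda>(c, d). {c<..<d}) D" and L: "total_length D < \<delta>"
        with 2[of D] obtain D' where "packing a b D'" "total_length D' = total_length D"
            "variation_over u D' = variation_over u D" by blast
        with \<delta>(2)[of D'] L show "variation_over u D < \<epsilon>" by simp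
      qed (rule \<delta>(1))
    qed
  qed
qed

lemma abs_cont_onD:
  assumes "abs_cont_on a b u" "\<epsilon> > 0"
  obtains \<delta> where "\<delta> > 0"
    "\<And>D. packing a b D \<Longrightarrow> total_length D < \<delta> \<Longrightarrow> variation_over u D < \<epsilon>"
  using assms unfolding abs_cont_on_iff_packing by blast

lemma abs_cont_on_cong:
  assumes u: "abs_cont_on a b u" and eq: "\<And>x. a \<le> x \<Longrightarrow> x \<le> b \<Longrightarrow> u x = v x"
  shows "abs_cont_on a b v"
  unfolding abs_cont_on_iff_packing
proof (intro allI impI)
  fix \<epsilon> :: real assume "\<epsilon> > 0"
  then obtain \<delta> where \<delta>: "\<delta> > 0"
    "\<And>D. packing a b D \<Longrightarrow> total_length D < \<delta> \<Longrightarrow> variation_over u D < \<epsilon>"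
    using abs_cont_onD[OF u] by blast
  show "\<exists>\<delta>>0. \<forall>D. packing a b D \<longrightarrow> total_length D < \<delta> \<longrightarrow> variation_over v D < \<epsilon>"
  proof (intro exI[of _ \<delta>] conjI allI impI \<delta>(1))
    fix D assume D: "packing a b D" "total_length D < \<delta>"
    have "variation_over v D = variation_over u D"
      by (rule sum.cong) (auto dest!: packing_bounds[OF D(1)] simp: eq)
    then show "variation_over v D < \<epsilon>" using \<delta>(2)[OF D] by simp
  qed
qed

lemma abs_cont_on_lipschitz:
  assumes "\<And>x y. a \<le> x \<Longrightarrow> x \<le> y \<Longrightarrow> y \<le> b \<Longrightarrow> \<bar>u y - u x\<bar> \<le> L * (y - x)"
  shows "abs_cont_on a b u"
  unfolding abs_cont_on_iff_packing
proof (intro allI impI)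
  fix \<epsilon> :: real assume \<epsilon>: "\<epsilon> > 0"
  show "\<exists>\<delta>>0. \<forall>D. packing a b D \<longrightarrow> total_length D < \<delta> \<longrightarrow> variation_over u D < \<epsilon>"
  proof (intro exI[of _ "\<epsilon> / (\<bar>L\<bar> + 1)"] conjI allI impI)
    fix D assume D: "packing a b D" "total_length D < \<epsilon> / (\<bar>L\<bar> + 1)"
    have "variation_over u D \<le> (\<Sum>(c, d)\<in>D. (\<bar>L\<bar> + 1) * (d - c))"
    proof (rule sum_mono, clarify)
      fix c d assume "(c, d) \<in> D"
      then have cd: "a \<le> c" "c < d" "d \<le> b" using packing_bounds[OF D(1)] by auto
      then have "L * (d - c) \<le> (\<bar>L\<bar> + 1) * (d - c)" by (intro mult_right_mono) auto
      then show "\<bar>u d - u c\<bar> \<le> (\<bar>L\<bar> + 1) * (d - c)" using assms[of c d] cd by linarith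
    qed
    also have "\<dots> = (\<bar>L\<bar> + 1) * total_length D"
      by (simp add: sum_distrib_left split_beta)
    also have "\<dots> < \<epsilon>" using D(2) by (simp add: field_simps add_nonneg_pos)
    finally show "variation_over u D < \<epsilon>" .
  qed (use \<epsilon> in \<open>simp add: add_nonneg_pos\<close>)
qed

text \<open>A nondecreasing function that does not increase distances maps packings to packings of no larger
  length, once the intervals that it collapses are dropped.\<close>

lemma abs_cont_on_compose:
  assumes u: "abs_cont_on a b u"
    and mono: "\<And>x y. c \<le> x \<Longrightarrow> x \<le> y \<Longrightarrow> y \<le> d \<Longrightarrow> \<phi> x \<le> \<phi> y \<and> \<phi> y - \<phi> x \<le> y - x"
    and range: "\<And>x. c \<le> x \<Longrightarrow> x \<le> d \<Longrightarrow> a \<le> \<phi> x \<and> \<phi> x \<le> b"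
  shows "abs_cont_on c d (\<lambda>x. u (\<phi> x))"
  unfolding abs_cont_on_iff_packing
proof (intro allI impI)
  fix \<epsilon> :: real assume "\<epsilon> > 0"
  then obtain \<delta> where \<delta>: "\<delta> > 0"
    "\<And>D. packing a b D \<Longrightarrow> total_length D < \<delta> \<Longrightarrow> variation_over u D < \<epsilon>"
    using abs_cont_onD[OF u] by blast
  show "\<exists>\<delta>>0. \<forall>D. packing c d D \<longrightarrow> total_length D < \<delta> \<longrightarrow> variation_over (\<lambda>x. u (\<phi> x)) D < \<epsilon>"
  proof (intro exI[of _ \<delta>] conjI allI impI \<delta>(1))
    fix D assume D: "packing c d D" "total_length D < \<delta>"
    define D0 where "D0 = {(x, y) \<in> D. \<phi> x < \<phi> y}"
    define D' where "D' = (\<lambda>(x, y). (\<phi> x, \<phi> y)) ` D0"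
    have fin: "finite D" using packing_finite[OF D(1)] .
    have m: "\<phi> x \<le> \<phi> y" "\<phi> y - \<phi> x \<le> y - x" if "(x, y) \<in> D" for x y
      using mono[of x y] packing_bounds[OF D(1) that] by auto
    have sep: "\<phi> y \<le> \<phi> x' \<or> \<phi> y' \<le> \<phi> x"
      if "(x, y) \<in> D0" "(x', y') \<in> D0" "(x, y) \<noteq> (x', y')" for x y x' y'
    proof -
      have in_D: "(x, y) \<in> D" "(x', y') \<in> D" using that by (auto simp: D0_def)
      note packing_bounds[OF D(1) in_D(1)] packing_bounds[OF D(1) in_D(2)]
      then show ?thesis
        using packing_separated[OF D(1) in_D that(3)] mono[of y x'] mono[of y' x] by auto
    qed
    have inj: "inj_on (\<lambda>(x, y). (\<phi> x, \<phi> y)) D0"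
      by (rule inj_onI) (use sep in \<open>fastforce simp: D0_def\<close>)
    have pack: "packing a b D'"
    proof (rule packingI)
      show "finite D'" using fin by (auto simp: D'_def D0_def intro: finite_subset[OF _ fin])
      show "a \<le> x \<and> x < y \<and> y \<le> b" if xy: "(x, y) \<in> D'" for x y
      proof -
        obtain x' y' where "(x', y') \<in> D" "\<phi> x' < \<phi> y'" "x = \<phi> x'" "y = \<phi> y'"
          using xy by (auto simp: D'_def D0_def)
        then show ?thesis using packing_bounds[OF D(1), of x' y'] range[of x'] range[of y'] by auto
      qed
      show "y \<le> x' \<or> y' \<le> x" if "(x, y) \<in> D'" "(x', y') \<in> D'" "(x, y) \<noteq> (x', y')" for x y x' y'
        using that sep by (auto simp: D'_def)
    qed
    have "total_length D' = (\<Sum>(x, y)\<in>D0. \<phi> y - \<phi> x)"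
      unfolding D'_def by (subst sum.reindex[OF inj]) (simp add: split_beta)
    also have "\<dots> = (\<Sum>(x, y)\<in>D. \<phi> y - \<phi> x)"
      by (rule sum.mono_neutral_left[OF fin]) (use m in \<open>fastforce simp: D0_def\<close>)+
    also have "\<dots> \<le> total_length D" by (rule sum_mono) (use m in auto)
    finally have "variation_over u D' < \<epsilon>" using \<delta>(2)[OF pack] D(2) by linarith
    moreover have "variation_over u D' = (\<Sum>(x, y)\<in>D0. \<bar>u (\<phi> y) - u (\<phi> x)\<bar>)"
      unfolding D'_def by (subst sum.reindex[OF inj]) (simp add: split_beta)
    moreover have "\<dots> = variation_over (\<lambda>x. u (\<phi> x)) D"
      by (rule sum.mono_neutral_left[OF fin]) (use m in \<open>fastforce simp: D0_def\<close>)+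
    ultimately show "variation_over (\<lambda>x. u (\<phi> x)) D < \<epsilon>" by simp
  qed
qed

lemma packing_single: "a \<le> c \<Longrightarrow> c < d \<Longrightarrow> d \<le> b \<Longrightarrow> packing a b {(c, d)}"
  by (rule packingI) auto

lemma packing_insert:
  assumes "packing a c D" "a \<le> c" "c < d" "d \<le> b"
  shows "packing a b (insert (c, d) D)"
proof (rule packingI)
  show "finite (insert (c, d) D)" using assms(1) packing_finite by simp
  show "a \<le> c' \<and> c' < d' \<and> d' \<le> b" if "(c', d') \<in> insert (c, d) D" for c' d'
    using assms(2-4) packing_bounds[OF assms(1), of c' d'] that by auto
  show "d1 \<le> c2 \<or> d2 \<le> c1"
    if "(c1, d1) \<in> insert (c, d) D" "(c2, d2) \<in> insert (c, d) D" "(c1, d1) \<noteq> (c2, d2)"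
    for c1 d1 c2 d2
    using assms(2-4) packing_bounds[OF assms(1), of c1 d1] packing_bounds[OF assms(1), of c2 d2]
      packing_separated[OF assms(1), of c1 d1 c2 d2] that by auto
qed

text \<open>Telescoping, organised by removing the rightmost interval.\<close>

lemma packing_sum_increments_le:
  assumes "packing a b D" "a \<le> b" "\<And>x y. a \<le> x \<Longrightarrow> x \<le> y \<Longrightarrow> y \<le> b \<Longrightarrow> v x \<le> (v y :: real)"
  shows "(\<Sum>(c, d)\<in>D. v d - v c) \<le> v b - v a"
  using assms
proof (induction "card D" arbitrary: D b)
  case 0
  then have "D = {}" using packing_finite[OF 0(2)] by simp
  then show ?case using 0 by simp
next
  case (Suc n)
  have fin: "finite D" using Suc.prems packing_finite by blast
  then have "D \<noteq> {}" using Suc by auto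
  then have "Max (snd ` D) \<in> snd ` D" using fin by (intro Max_in) auto
  then obtain c d where cd: "(c, d) \<in> D" "d = Max (snd ` D)" by force
  have max: "d' \<le> d" if "(c', d') \<in> D" for c' d'
    using that fin cd(2) by (metis Max_ge finite_imageI image_eqI snd_conv)
  have B: "a \<le> c" "c < d" "d \<le> b" using packing_bounds[OF Suc.prems(1) cd(1)] by auto
  have "packing a c (D - {(c, d)})"
  proof (rule packing_subset[OF Suc.prems(1)])
    fix c' d' assume A: "(c', d') \<in> D - {(c, d)}"
    then have "d \<le> c' \<or> d' \<le> c" "c' < d'" "a \<le> c'"
      using packing_separated[OF Suc.prems(1) cd(1), of c' d'] packing_bounds[OF Suc.prems(1), of c' d']
      by auto
    then show "a \<le> c' \<and> d' \<le> c" using max[of c' d'] A by auto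
  qed auto
  then have "(\<Sum>(c, d)\<in>D - {(c, d)}. v d - v c) \<le> v c - v a"
    by (intro Suc.hyps(1)) (use Suc.hyps(2) Suc.prems(3) cd fin B in auto)
  moreover have "(\<Sum>(c, d)\<in>D. v d - v c) = (v d - v c) + (\<Sum>(c, d)\<in>D - {(c, d)}. v d - v c)"
    using fin cd by (subst sum.remove[of _ "(c, d)"]) auto
  moreover have "v d \<le> v b" using B Suc.prems(3)[of d b] by simp
  ultimately show ?case by simp
qed

lemma packing_sum_lengths_le: "packing a b D \<Longrightarrow> a \<le> b \<Longrightarrow> total_length D \<le> b - a"
  using packing_sum_increments_le[of a b D "\<lambda>x. x"] by simp


definition bounded_variation_on :: "real \<Rightarrow> real \<Rightarrow> (real \<Rightarrow> real) \<Rightarrow> bool" where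
  "bounded_variation_on a b u \<longleftrightarrow> (\<exists>B. \<forall>D. packing a b D \<longrightarrow> variation_over u D \<le> B)"

lemma bounded_variation_on_trivial: "b \<le> a \<Longrightarrow> bounded_variation_on a b u"
  by (auto simp: bounded_variation_on_def packing_trivial)

text \<open>At most one interval of a packing has \<open>c\<close> in its interior; its increment is split at \<open>c\<close>.\<close>

lemma bounded_variation_on_join:
  assumes "bounded_variation_on a c u" "bounded_variation_on c b u" "a \<le> c" "c \<le> b"
  shows "bounded_variation_on a b u"
proof -
  obtain B1 where B1: "\<And>D. packing a c D \<Longrightarrow> variation_over u D \<le> B1"
    using assms unfolding bounded_variation_on_def by blast
  obtain B2 where B2: "\<And>D. packing c b D \<Longrightarrow> variation_over u D \<le> B2"
    using assms unfolding bounded_variation_on_def by blast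
  show ?thesis
    unfolding bounded_variation_on_def
  proof (intro exI[of _ "B1 + B2 + (B1 + B2)"] allI impI)
    fix D assume D: "packing a b D"
    define L where "L = {(c', d')\<in>D. d' \<le> c}"
    define R where "R = {(c', d')\<in>D. c \<le> c'}"
    define S where "S = {(c', d')\<in>D. c' < c \<and> c < d'}"
    let ?v = "variation_over u"
    have fin: "finite L" "finite R" "finite S"
      unfolding L_def R_def S_def by (auto intro: finite_subset[OF _ packing_finite[OF D]])
    have "D = (L \<union> R) \<union> S" unfolding L_def R_def S_def by auto
    moreover have "?v (A \<union> A') \<le> ?v A + ?v A'" if "finite A" "finite A'" for A A'
      using that by (simp add: sum_Un sum_nonneg split_beta)
    ultimately have "?v D \<le> ?v L + ?v R + ?v S"
    proof -
      assume D: "D = L \<union> R \<union> S"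
        and U: "\<And>A A'. finite A \<Longrightarrow> finite A' \<Longrightarrow> ?v (A \<union> A') \<le> ?v A + ?v A'"
      show ?thesis
        unfolding D using U[of "L \<union> R" S] U[of L R] fin by simp
    qed
    moreover have "?v L \<le> B1"
      by (intro B1 packing_subset[OF D]) (auto simp: L_def dest: packing_bounds[OF D])
    moreover have "?v R \<le> B2"
      by (intro B2 packing_subset[OF D]) (auto simp: R_def dest: packing_bounds[OF D])
    moreover have "?v S \<le> B1 + B2"
    proof (cases "S = {}")
      case True
      then show ?thesis using B1[of "{}"] B2[of "{}"] by simp
    next
      case False
      then obtain c' d' where S1: "(c', d') \<in> S" by auto
      have "S = {(c', d')}"
        using S1 packing_separated[OF D, of c' d'] by (force simp: S_def)
      moreover have "a \<le> c'" "c' < c" "c < d'" "d' \<le> b"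
        using S1 packing_bounds[OF D, of c' d'] by (auto simp: S_def)
      then have "\<bar>u c - u c'\<bar> \<le> B1" "\<bar>u d' - u c\<bar> \<le> B2"
        using B1[OF packing_single[of a c' c c]] B2[OF packing_single[of c c d' b]] by auto
      ultimately show ?thesis by simp
    qed
    ultimately show "?v D \<le> B1 + B2 + (B1 + B2)" by linarith
  qed
qed

lemma abs_cont_on_subinterval:
  "abs_cont_on a b u \<Longrightarrow> a \<le> a' \<Longrightarrow> b' \<le> b \<Longrightarrow> abs_cont_on a' b' u"
  unfolding abs_cont_on_iff_packing using packing_mono by meson

text \<open>Intervals of length \<open>\<delta>/2\<close> have variation at most 1, and finitely many of them cover \<open>[a,b]\<close>.\<close>

lemma abs_cont_on_imp_bounded_variation:
  assumes u: "abs_cont_on a b u"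
  shows "bounded_variation_on a b u"
proof (cases "a \<le> b")
  case False
  then show ?thesis by (simp add: bounded_variation_on_trivial)
next
  case True
  obtain \<delta> where \<delta>: "\<delta> > 0"
    "\<And>D. packing a b D \<Longrightarrow> total_length D < \<delta> \<Longrightarrow> variation_over u D < 1"
    using abs_cont_onD[OF u, of 1] by auto
  have "bounded_variation_on a (min b (a + real n * (\<delta> / 2))) u" for n
  proof (induction n)
    case 0
    show ?case by (simp add: bounded_variation_on_trivial)
  next
    case (Suc n)
    define c where "c = min b (a + real n * (\<delta> / 2))"
    define e where "e = min b (a + real (Suc n) * (\<delta> / 2))"
    have *: "a \<le> c" "c \<le> e" "e \<le> b" "e - c \<le> \<delta> / 2"
      using True \<delta>(1) by (auto simp: c_def e_def field_simps min_def)
    have "variation_over u D \<le> 1" if "packing c e D" for D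
    proof -
      have "packing a b D" using packing_mono[OF that] * by auto
      moreover have "total_length D < \<delta>"
        using packing_sum_lengths_le[OF that] * \<delta>(1) by linarith
      ultimately show ?thesis using \<delta>(2)[of D] by simp
    qed
    then have "bounded_variation_on c e u"
      unfolding bounded_variation_on_def by blast
    then show ?case
      using bounded_variation_on_join[OF Suc.IH[folded c_def], of e] * unfolding e_def by blast
  qed
  moreover obtain n where n: "b - a < real n * (\<delta> / 2)"
    using reals_Archimedean3[of "\<delta> / 2"] \<delta>(1) half_gt_zero by blast
  then have "min b (a + real n * (\<delta> / 2)) = b" by auto
  ultimately show ?thesis by metis
qed

text \<open>The variation function: a nondecreasing function whose increments dominate those of \<open>u\<close>, and
  whose total increment is approximated by packings.\<close>

lemma variation_function:
  assumes "bounded_variation_on a b u" "a \<le> b"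
  obtains v where "\<And>c d. a \<le> c \<Longrightarrow> c \<le> d \<Longrightarrow> d \<le> b \<Longrightarrow> \<bar>u d - u c\<bar> \<le> v d - v c"
    "\<And>\<epsilon>. \<epsilon> > 0 \<Longrightarrow> \<exists>D. packing a b D \<and> v b - v a - \<epsilon> < variation_over u D"
proof -
  let ?s = "variation_over u"
  obtain B where B: "\<And>D. packing a b D \<Longrightarrow> ?s D \<le> B"
    using assms unfolding bounded_variation_on_def by blast
  define v where "v x = (SUP D\<in>{D. packing a x D}. ?s D)" for x
  have bdd: "bdd_above (?s ` {D. packing a x D})" if "x \<le> b" for x
    by (rule bdd_aboveI2[where M=B]) (use B packing_mono[of a x] that in auto)
  have ne: "{D. packing a x D} \<noteq> {}" for x by (auto intro: exI[of _ "{}"])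
  have *: "\<bar>u d - u c\<bar> \<le> v d - v c" if "a \<le> c" "c \<le> d" "d \<le> b" for c d
  proof (cases "c = d")
    case False
    have "v c \<le> v d - \<bar>u d - u c\<bar>"
      unfolding v_def[of c]
    proof (rule cSUP_least[OF ne], clarify)
      fix D assume D: "packing a c D"
      have "(c, d) \<notin> D" using packing_bounds[OF D, of c d] by auto
      then have "?s (insert (c, d) D) = \<bar>u d - u c\<bar> + ?s D"
        using packing_finite[OF D] by simp
      moreover have "?s (insert (c, d) D) \<le> v d"
        unfolding v_def by (rule cSUP_upper) (use packing_insert[OF D] that False bdd in auto)
      ultimately show "?s D \<le> v d - \<bar>u d - u c\<bar>" by simp
    qed
    then show ?thesis by simp
  qed simp
  have "{D. packing a a D} = {{}}" by (simp add: packing_trivial)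
  then have va: "v a = 0" unfolding v_def by simp
  show ?thesis
  proof (rule that[OF *], assumption+)
    fix \<epsilon> :: real assume "\<epsilon> > 0"
    then have "v b - v a - \<epsilon> < v b" using va by simp
    then show "\<exists>D. packing a b D \<and> v b - v a - \<epsilon> < ?s D"
      unfolding v_def[of b] less_cSUP_iff[OF ne bdd[OF order_refl]] by auto
  qed
qed

section \<open>Differentiability almost everywhere\<close>

abbreviation short_interval :: "real \<Rightarrow> real \<Rightarrow> real \<Rightarrow> real \<Rightarrow> real \<Rightarrow> real \<Rightarrow> bool" where
  "short_interval a b x \<eta> c d \<equiv> a \<le> c \<and> c < d \<and> d \<le> b \<and> x \<in> {c..d} \<and> d - c < \<eta>"

text \<open>Vitali's covering theorem picks disjoint intervals out of the given ones; their total length is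
  at most \<open>1/\<alpha>\<close> times the total increment of \<open>w\<close>.\<close>

lemma vitali_increment_bound:
  fixes w :: "real \<Rightarrow> real"
  assumes "a \<le> b" and \<alpha>: "\<alpha> > 0"
    and mono: "\<And>x y. a \<le> x \<Longrightarrow> x \<le> y \<Longrightarrow> y \<le> b \<Longrightarrow> w x \<le> w y"
    and cover: "\<And>x \<eta>. x \<in> E \<Longrightarrow> \<eta> > 0 \<Longrightarrow>
      \<exists>c d. short_interval a b x \<eta> c d \<and> \<alpha> * (d - c) \<le> w d - w c"
  obtains T where "T \<in> lmeasurable" "E \<subseteq> T" "measure lebesgue T \<le> (w b - w a) / \<alpha>"
proof -
  define K where "K = {(c, d). a \<le> c \<and> c < d \<and> d \<le> b \<and> \<alpha> * (d - c) \<le> w d - w c}"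
  define m where "m I = (fst I + snd I) / 2" for I :: "real \<times> real"
  define r where "r I = (snd I - fst I) / 2" for I :: "real \<times> real"
  have cb: "cball (m I) (r I) = {fst I..snd I}" for I
    by (auto simp: m_def r_def dist_real_def abs_le_iff field_simps)
  obtain C where C: "countable C" "C \<subseteq> K"
    "pairwise (\<lambda>i j. disjnt (cball (m i) (r i)) (cball (m j) (r j))) C"
    "negligible (E - (\<Union>i\<in>C. cball (m i) (r i)))"
  proof (rule Vitali_covering_theorem_cballs[of K r E m])
    show "0 < r i" if "i \<in> K" for i using that by (auto simp: K_def r_def)
    show "\<exists>i. i \<in> K \<and> x \<in> cball (m i) (r i) \<and> r i < \<eta>" if x: "x \<in> E" "0 < \<eta>" for x \<eta>
    proof -
      obtain c d where "short_interval a b x \<eta> c d \<and> \<alpha> * (d - c) \<le> w d - w c"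
        using cover[OF x] by blast
      moreover from this have "x \<in> cball (m (c, d)) (r (c, d))" unfolding cb by simp
      moreover have "r (c, d) = (d - c) / 2" by (simp add: r_def)
      ultimately show ?thesis
        by (intro exI[of _ "(c, d)"]) (simp add: K_def)
    qed
  qed (rule that)
  have bound: "measure lebesgue (\<Union>i\<in>F. cball (m i) (r i)) \<le> (w b - w a) / \<alpha>" if F: "F \<subseteq> C" "finite F" for F
  proof -
    have pack: "packing a b F"
    proof (rule packingI)
      show "a \<le> c \<and> c < d \<and> d \<le> b" if "(c, d) \<in> F" for c d
        using that F(1) C(2) by (auto simp: K_def)
      show "d \<le> c' \<or> d' \<le> c" if A: "(c, d) \<in> F" "(c', d') \<in> F" "(c, d) \<noteq> (c', d')" for c d c' d'
      proof -
        have "disjnt {c..d} {c'..d'}"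
          using pairwiseD[OF C(3), of "(c, d)" "(c', d')"] A F(1) by (auto simp: cb)
        moreover have "c < d" "c' < d'" using A F(1) C(2) by (auto simp: K_def)
        ultimately have "\<not> (c \<le> c' \<and> c' \<le> d)" "\<not> (c' \<le> c \<and> c \<le> d')"
          by (auto simp: disjnt_def)
        then show ?thesis by linarith
      qed
    qed (use F in auto)
    have "measure lebesgue (\<Union>i\<in>F. cball (m i) (r i)) \<le> (\<Sum>i\<in>F. measure lebesgue (cball (m i) (r i)))"
      by (rule measure_UNION_le) (use F in auto)
    also have "\<dots> = total_length F"
      by (intro sum.cong) (auto simp: cb dest!: packing_bounds[OF pack])
    also have "\<dots> \<le> (\<Sum>(c, d)\<in>F. (w d - w c) / \<alpha>)"
      using F(1) C(2) \<alpha> by (intro sum_mono) (auto simp: K_def field_simps)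
    also have "\<dots> = (\<Sum>(c, d)\<in>F. w d - w c) / \<alpha>"
      by (simp add: sum_divide_distrib split_beta)
    also have "\<dots> \<le> (w b - w a) / \<alpha>"
      using packing_sum_increments_le[OF pack \<open>a \<le> b\<close> mono] \<alpha> by (intro divide_right_mono) auto
    finally show ?thesis .
  qed
  let ?U = "\<Union>i\<in>C. cball (m i) (r i)"
  have U: "?U \<in> lmeasurable" "measure lebesgue ?U \<le> (w b - w a) / \<alpha>"
    using fmeasurable_UN_bound[OF C(1) _ bound] measure_UN_bound[OF C(1) _ bound] by auto
  have N: "E - ?U \<in> lmeasurable" "measure lebesgue (E - ?U) = 0"
    using C(4) negligible_iff_measure by blast+
  show ?thesis
  proof (rule that[of "?U \<union> (E - ?U)"])
    show "?U \<union> (E - ?U) \<in> lmeasurable" using U N by blast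
    show "measure lebesgue (?U \<union> (E - ?U)) \<le> (w b - w a) / \<alpha>"
      using measure_Un_le[of ?U lebesgue "E - ?U"] U N by (auto simp: fmeasurableD)
  qed auto
qed

lemma finite_real_avoid:
  fixes x :: real
  assumes "finite F" "x \<notin> F"
  obtains \<eta> where "\<eta> > 0" "\<And>y. y \<in> F \<Longrightarrow> \<eta> \<le> \<bar>x - y\<bar>"
proof -
  obtain \<eta> where "\<eta> > 0" "\<forall>y\<in>F. y \<noteq> x \<longrightarrow> \<eta> \<le> dist x y"
    using finite_set_avoid[OF assms(1), of x] by blast
  then show ?thesis using assms(2) by (intro that[of \<eta>]) (auto simp: dist_real_def)
qed

text \<open>Austin's argument. Pick a packing \<open>D\<close> that nearly exhausts the total variation, and subtract
  from the variation function the increments of \<open>u\<close> over the intervals of \<open>D\<close>, each with its sign. The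
  remainder \<open>w\<close> is still nondecreasing and has a small total increment. Inside an interval of \<open>D\<close> on
  which \<open>u\<close> increases, \<open>w\<close> grows fast wherever \<open>u\<close> decreases fast, and vice versa, so that
  points with both kinds of short intervals around them are few.\<close>

lemma negligible_oscillating_slopes:
  assumes u: "bounded_variation_on a b u" and ab: "a \<le> b" and \<alpha>: "\<alpha> > 0"
    and down: "\<And>x \<eta>. x \<in> E \<Longrightarrow> \<eta> > 0 \<Longrightarrow>
      \<exists>c d. short_interval a b x \<eta> c d \<and> u d - u c \<le> - \<alpha> * (d - c)"
    and up: "\<And>x \<eta>. x \<in> E \<Longrightarrow> \<eta> > 0 \<Longrightarrow>
      \<exists>c d. short_interval a b x \<eta> c d \<and> \<alpha> * (d - c) \<le> u d - u c"
  shows "negligible E"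
  unfolding negligible_outer_le
proof (intro allI impI)
  fix e :: real assume "e > 0"
  obtain v where v: "\<And>c d. a \<le> c \<Longrightarrow> c \<le> d \<Longrightarrow> d \<le> b \<Longrightarrow> \<bar>u d - u c\<bar> \<le> v d - v c"
    and D: "\<And>\<epsilon>. \<epsilon> > 0 \<Longrightarrow> \<exists>D. packing a b D \<and> v b - v a - \<epsilon> < variation_over u D"
    using variation_function[OF u ab] by blast
  obtain D where D: "packing a b D" "v b - v a - \<alpha> * e < variation_over u D"
    using D[of "\<alpha> * e"] \<alpha> \<open>e > 0\<close> by auto
  note Db = packing_bounds[OF D(1)]
  have vm: "v x \<le> v y" if "a \<le> x" "x \<le> y" "y \<le> b" for x y
    using v[of x y] that by linarith
  define cl :: "real \<Rightarrow> real \<Rightarrow> real \<Rightarrow> real" where "cl c d x = max c (min d x)" for c d x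
  \<comment> \<open>\<open>cl c d\<close> is the projection onto \<open>[c,d]\<close>, so \<open>h\<close> changes only on the intervals of \<open>D\<close>, where it
    follows \<open>u\<close>, multiplied by the sign of its increment over the interval; its total increment is the variation of \<open>u\<close> over \<open>D\<close>.\<close>
  define h where "h x = (\<Sum>(c, d)\<in>D. sgn (u d - u c) * (u (cl c d x) - u c))" for x
  define w where "w x = v x - h x" for x
  have w_mono: "w x \<le> w y" if xy: "a \<le> x" "x \<le> y" "y \<le> b" for x y
  proof -
    have "h y - h x = (\<Sum>(c, d)\<in>D. sgn (u d - u c) * (u (cl c d y) - u (cl c d x)))"
      by (simp add: h_def split_beta flip: sum_subtractf) (simp add: algebra_simps)
    also have "\<dots> \<le> (\<Sum>(c, d)\<in>D. v (cl x y d) - v (cl x y c))"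
    proof (rule sum_mono, clarify)
      fix c d assume "(c, d) \<in> D"
      then have cd: "a \<le> c" "c < d" "d \<le> b" using Db by auto
      have "sgn (u d - u c) * (u (cl c d y) - u (cl c d x)) \<le> \<bar>u (cl c d y) - u (cl c d x)\<bar>"
        by (auto simp: sgn_if)
      also have "\<dots> \<le> v (cl c d y) - v (cl c d x)"
        by (rule v) (use cd xy in \<open>auto simp: cl_def\<close>)
      \<comment> \<open>Both sides are the increment of \<open>v\<close> over the intersection of \<open>[c,d]\<close> and \<open>[x,y]\<close>.\<close>
      also have "\<dots> = v (cl x y d) - v (cl x y c)"
      proof -
        consider "x = y" | "x < y" "d \<le> x" | "x < y" "y \<le> c" | "x < y" "x < d" "c < y"
          using xy by linarith
        then show ?thesis
          by cases (use cd xy in \<open>auto simp: cl_def min_def max_def\<close>)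
      qed
      finally show "sgn (u d - u c) * (u (cl c d y) - u (cl c d x)) \<le> v (cl x y d) - v (cl x y c)" .
    qed
    also have "\<dots> \<le> v (cl x y b) - v (cl x y a)"
      by (rule packing_sum_increments_le[OF D(1) ab])
        (use xy in \<open>auto intro!: vm simp: cl_def\<close>)
    also have "\<dots> = v y - v x"
      using xy by (simp add: cl_def)
    finally show ?thesis by (simp add: w_def)
  qed
  have "h b - h a = variation_over u D"
    unfolding h_def sum_subtractf[symmetric]
    by (rule sum.cong) (use ab Db in \<open>auto simp: cl_def sgn_if min_def max_def dest!: Db\<close>)
  then have w_total: "(w b - w a) / \<alpha> \<le> e"
    using D(2) \<alpha> by (simp add: w_def field_simps)
  define F where "F = fst ` D \<union> snd ` D"
  have F: "finite F" using packing_finite[OF D(1)] by (simp add: F_def)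
  have h_inside: "h q - h p = sgn (u d - u c) * (u q - u p)"
    if I: "(c, d) \<in> D" "c \<le> p" "p \<le> q" "q \<le> d" for c d p q
  proof -
    have "h q - h p = (\<Sum>(c, d)\<in>D. sgn (u d - u c) * (u (cl c d q) - u (cl c d p)))"
      by (simp add: h_def split_beta flip: sum_subtractf) (simp add: algebra_simps)
    also have "\<dots> = (\<Sum>(c', d')\<in>D. if (c', d') = (c, d) then sgn (u d - u c) * (u q - u p) else 0)"
    proof (rule sum.cong, rule refl, clarify)
      fix c' d' assume I': "(c', d') \<in> D"
      have "cl c' d' q = cl c' d' p" if "(c', d') \<noteq> (c, d)"
        using packing_separated[OF D(1) I(1) I'] that I Db[OF I'] by (auto simp: cl_def)
      moreover have "cl c d q = q" "cl c d p = p" using I by (auto simp: cl_def)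
      ultimately show "sgn (u d' - u c') * (u (cl c' d' q) - u (cl c' d' p)) =
          (if (c', d') = (c, d) then sgn (u d - u c) * (u q - u p) else 0)"
        by (auto split: if_splits)
    qed
    also have "\<dots> = sgn (u d - u c) * (u q - u p)"
      using I(1) packing_finite[OF D(1)] unfolding split_beta prod.collapse by (simp add: sum.delta)
    finally show ?thesis .
  qed
  have h_outside: "h q - h p = 0"
    if "p \<le> q" "\<And>c d. (c, d) \<in> D \<Longrightarrow> q \<le> c \<or> d \<le> p" for p q
    unfolding h_def sum_subtractf[symmetric]
    by (rule sum.neutral) (use that Db in \<open>fastforce simp: cl_def\<close>)
  obtain T where T: "T \<in> lmeasurable" "E - F \<subseteq> T" "measure lebesgue T \<le> (w b - w a) / \<alpha>"
  proof (rule vitali_increment_bound[OF ab \<alpha> w_mono])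
    fix x \<eta> :: real assume x: "x \<in> E - F" and \<eta>: "\<eta> > 0"
    obtain \<eta>0 where \<eta>0: "\<eta>0 > 0" "\<And>y. y \<in> F \<Longrightarrow> \<eta>0 \<le> \<bar>x - y\<bar>"
      using finite_real_avoid[OF F, of x] x by auto
    \<comment> \<open>Intervals around \<open>x\<close> shorter than \<open>\<eta>0\<close> lie inside one interval of \<open>D\<close> or miss all of them.\<close>
    define \<rho> where "\<rho> = min \<eta> \<eta>0"
    have \<rho>: "\<rho> > 0" "\<rho> \<le> \<eta>" "\<rho> \<le> \<eta>0" using \<eta> \<eta>0(1) by (auto simp: \<rho>_def)
    have ends: "\<eta>0 \<le> \<bar>x - c\<bar> \<and> \<eta>0 \<le> \<bar>x - d\<bar>" if "(c, d) \<in> D" for c d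
      using \<eta>0(2)[of c] \<eta>0(2)[of d] that by (force simp: F_def)
    have good: "\<alpha> * (q - p) \<le> w q - w p"
      if pq: "a \<le> p" "p < q" "q \<le> b" "\<alpha> * (q - p) \<le> \<bar>u q - u p\<bar>" "h q - h p \<le> 0" for p q
      using v[of p q] pq by (simp add: w_def)
    show "\<exists>p q. short_interval a b x \<eta> p q \<and> \<alpha> * (q - p) \<le> w q - w p"
    proof (cases "\<exists>c d. (c, d) \<in> D \<and> c \<le> x \<and> x \<le> d \<and> u c \<le> u d")
      case True
      then obtain c d where I: "(c, d) \<in> D" "c \<le> x" "x \<le> d" "u c \<le> u d" by blast
      obtain p q where pq: "a \<le> p" "p < q" "q \<le> b" "x \<in> {p..q}" "q - p < \<rho>" "u q - u p \<le> - \<alpha> * (q - p)"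
        using down[of x \<rho>] x \<rho>(1) by auto
      have "h q - h p = sgn (u d - u c) * (u q - u p)"
        using ends[OF I(1)] I pq \<rho> by (intro h_inside) auto
      moreover have "0 \<le> \<alpha> * (q - p)" using pq \<alpha> by simp
      ultimately have "h q - h p \<le> 0" using pq(6) I(4) by (auto simp: sgn_if)
      moreover have "\<alpha> * (q - p) \<le> \<bar>u q - u p\<bar>" using pq(6) by linarith
      ultimately have "\<alpha> * (q - p) \<le> w q - w p" using good[of p q] pq by blast
      then show ?thesis using pq \<rho> by (intro exI[of _ p] exI[of _ q]) auto
    next
      case False
      obtain p q where pq: "a \<le> p" "p < q" "q \<le> b" "x \<in> {p..q}" "q - p < \<rho>" "\<alpha> * (q - p) \<le> u q - u p"
        using up[of x \<rho>] x \<rho>(1) by auto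
      have "0 \<le> \<alpha> * (q - p)" using pq \<alpha> by simp
      have "h q - h p \<le> 0"
      proof (cases "\<exists>c d. (c, d) \<in> D \<and> c \<le> x \<and> x \<le> d")
        case True
        then obtain c d where I: "(c, d) \<in> D" "c \<le> x" "x \<le> d" by blast
        then have "u d < u c" using False by force
        moreover have "h q - h p = sgn (u d - u c) * (u q - u p)"
          using ends[OF I(1)] I pq \<rho> by (intro h_inside) auto
        ultimately show ?thesis using pq(6) \<open>0 \<le> \<alpha> * (q - p)\<close> by simp
      next
        case False
        have "h q - h p = 0"
        proof (rule h_outside)
          show "q \<le> c \<or> d \<le> p" if "(c, d) \<in> D" for c d
            using False that ends[OF that] pq \<rho> by fastforce
        qed (use pq in simp)
        then show ?thesis by simp
      qed
      moreover have "\<alpha> * (q - p) \<le> \<bar>u q - u p\<bar>" using pq(6) by linarith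
      ultimately have "\<alpha> * (q - p) \<le> w q - w p" using good[of p q] pq by blast
      then show ?thesis using pq \<rho> by (intro exI[of _ p] exI[of _ q]) auto
    qed
  qed (blast intro: that)+
  have FN: "F \<in> lmeasurable" "measure lebesgue F = 0"
    using negligible_finite[OF F] negligible_iff_measure by blast+
  show "\<exists>T. E \<subseteq> T \<and> T \<in> lmeasurable \<and> measure lebesgue T \<le> e"
  proof (intro exI[of _ "T \<union> F"] conjI)
    show "T \<union> F \<in> lmeasurable" using T FN by blast
    show "measure lebesgue (T \<union> F) \<le> e"
      using measure_Un_le[of T lebesgue F] T FN w_total by (auto simp: fmeasurableD)
  qed (use T in auto)
qed

text \<open>Intervals with slope at least \<open>m\<close> have total length at most \<open>1/m\<close> times the total variation.\<close>

lemma negligible_unbounded_slopes: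
  assumes u: "bounded_variation_on a b u" and ab: "a \<le> b"
    and steep: "\<And>x \<eta> m. x \<in> E \<Longrightarrow> \<eta> > 0 \<Longrightarrow>
      \<exists>c d. short_interval a b x \<eta> c d \<and> m * (d - c) \<le> \<bar>u d - u c\<bar>"
  shows "negligible E"
  unfolding negligible_outer_le
proof (intro allI impI)
  fix e :: real assume "e > 0"
  obtain v where v: "\<And>c d. a \<le> c \<Longrightarrow> c \<le> d \<Longrightarrow> d \<le> b \<Longrightarrow> \<bar>u d - u c\<bar> \<le> v d - v c"
    and "\<And>\<epsilon>. \<epsilon> > 0 \<Longrightarrow> \<exists>D. packing a b D \<and> v b - v a - \<epsilon> < variation_over u D"
    using variation_function[OF u ab] by blast
  have vm: "v x \<le> v y" if "a \<le> x" "x \<le> y" "y \<le> b" for x y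
    using v[of x y] that by linarith
  define m where "m = (v b - v a) / e + 1"
  have m: "m > 0" using vm[of a b] ab \<open>e > 0\<close> by (simp add: m_def add_nonneg_pos)
  have me: "(v b - v a) / m \<le> e"
    using m \<open>e > 0\<close> by (simp add: m_def field_simps)
  obtain T where "T \<in> lmeasurable" "E \<subseteq> T" "measure lebesgue T \<le> (v b - v a) / m"
  proof (rule vitali_increment_bound[OF ab m vm])
    fix x \<eta> :: real assume "x \<in> E" "\<eta> > 0"
    from steep[OF this, of m] obtain c d where *: "a \<le> c" "c < d" "d \<le> b" "x \<in> {c..d}" "d - c < \<eta>"
      "m * (d - c) \<le> \<bar>u d - u c\<bar>" by blast
    then have "m * (d - c) \<le> v d - v c" using v[of c d] by linarith
    then show "\<exists>c d. short_interval a b x \<eta> c d \<and> m * (d - c) \<le> v d - v c"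
      using * by blast
  qed (blast intro: that)+
  then show "\<exists>T. E \<subseteq> T \<and> T \<in> lmeasurable \<and> measure lebesgue T \<le> e"
    using me order_trans by blast
qed

text \<open>If the difference quotients at \<open>x\<close> have no finite limit, then they are unbounded or their lower
  and upper limits are separated by two rational numbers.\<close>

lemma not_differentiable_slopes:
  fixes u :: "real \<Rightarrow> real"
  assumes "\<not> u differentiable at x"
  shows "(\<forall>m. \<exists>\<^sub>F h in at 0. m \<le> \<bar>(u (x + h) - u x) / h\<bar>) \<or>
    (\<exists>p q. p \<in> \<rat> \<and> q \<in> \<rat> \<and> p < q \<and> (\<exists>\<^sub>F h in at 0. (u (x + h) - u x) / h \<le> p) \<and>
       (\<exists>\<^sub>F h in at 0. q \<le> (u (x + h) - u x) / h))"
proof (rule ccontr)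
  assume neg: "\<not> ?thesis"
  define s where "s h = (u (x + h) - u x) / h" for h
  define f where "f h = ereal (s h)" for h
  from neg obtain m where m: "\<forall>\<^sub>F h in at 0. \<bar>s h\<bar> < m"
    by (auto simp: s_def not_frequently not_le)
  have sep: "\<not> ((\<exists>\<^sub>F h in at 0. s h \<le> p) \<and> (\<exists>\<^sub>F h in at 0. q \<le> s h))"
    if "p \<in> \<rat>" "q \<in> \<rat>" "p < q" for p q
    using neg that by (auto simp: s_def)
  have fr_le: "\<exists>\<^sub>F h in at 0. s h \<le> p" if "Liminf (at 0) f < ereal p" for p
  proof -
    have "\<not> ereal p \<le> Liminf (at 0) f" using that by simp
    then obtain y where y: "y < ereal p" "\<not> (\<forall>\<^sub>F h in at 0. y < f h)"
      unfolding le_Liminf_iff by blast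
    have "\<exists>\<^sub>F h in at 0. \<not> y < f h" using y(2) by (simp add: frequently_def)
    then show ?thesis
    proof (rule frequently_mono[rotated], intro allI impI)
      fix h assume "\<not> y < f h"
      then have "f h < ereal p" using y(1) by simp
      then show "s h \<le> p" by (simp add: f_def)
    qed
  qed
  have fr_ge: "\<exists>\<^sub>F h in at 0. p \<le> s h" if "ereal p < Limsup (at 0) f" for p
  proof -
    have "\<not> Limsup (at 0) f \<le> ereal p" using that by simp
    then obtain y where y: "ereal p < y" "\<not> (\<forall>\<^sub>F h in at 0. f h < y)"
      unfolding Limsup_le_iff by blast
    have "\<exists>\<^sub>F h in at 0. \<not> f h < y" using y(2) by (simp add: frequently_def)
    then show ?thesis
    proof (rule frequently_mono[rotated], intro allI impI)
      fix h assume "\<not> f h < y"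
      then have "ereal p < f h" using y(1) by simp
      then show "p \<le> s h" by (simp add: f_def)
    qed
  qed
  have eq: "Liminf (at 0) f = Limsup (at 0) f"
  proof (rule antisym)
    show "Liminf (at 0) f \<le> Limsup (at 0) f" by (rule Liminf_le_Limsup) simp
    show "Limsup (at 0) f \<le> Liminf (at 0) f"
    proof (rule ccontr)
      assume "\<not> ?thesis"
      then have "Liminf (at 0) f < Limsup (at 0) f" by simp
      then obtain p' where p': "Liminf (at 0) f < ereal p'" "ereal p' < Limsup (at 0) f"
        using ereal_dense2 by blast
      then obtain q' where q': "ereal p' < ereal q'" "ereal q' < Limsup (at 0) f"
        using ereal_dense2 by blast
      obtain p where p: "p \<in> \<rat>" "p' < p" "p < q'" using Rats_dense_in_real[of p' q'] q' by auto
      obtain q where q: "q \<in> \<rat>" "p < q" "q < q'" using Rats_dense_in_real[of p q'] p by auto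
      have "Liminf (at 0) f < ereal p" "ereal q < Limsup (at 0) f"
        using p' q' p q by (auto intro: less_trans[of _ "ereal p'"] less_trans[of _ "ereal q'"])
      then show False using sep[of p q] fr_le fr_ge p q by blast
    qed
  qed
  define l where "l = Limsup (at 0) f"
  have lim: "(f \<longlongrightarrow> l) (at 0)"
    using eq by (intro Liminf_eq_Limsup) (auto simp: l_def)
  have "\<forall>\<^sub>F h in at 0. f h \<le> ereal m" "\<forall>\<^sub>F h in at 0. ereal (- m) \<le> f h"
    using m by (auto elim!: eventually_mono simp: f_def)
  then have "l \<le> ereal m" "ereal (- m) \<le> l"
    using tendsto_upperbound[OF lim, of "ereal m"] tendsto_lowerbound[OF lim, of "ereal (-m)"] by auto
  then obtain r where "l = ereal r" by (cases l) auto
  moreover have "f = (\<lambda>h. ereal (s h))" by (simp add: f_def fun_eq_iff)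
  ultimately have "(s \<longlongrightarrow> r) (at 0)" using lim by simp
  then have "DERIV u x :> r" by (simp add: DERIV_def s_def[abs_def])
  then show False using assms by (auto simp: real_differentiable_def)
qed

text \<open>Functions of bounded variation have neither unbounded nor, after subtraction of a linear function,
  oscillating slopes outside a null set; rational bounds leave only countably many exceptional sets.\<close>

theorem abs_cont_on_differentiable_ae:
  assumes u: "abs_cont_on a b u"
  shows "negligible {x \<in> {a<..<b}. \<not> u differentiable at x}"
proof (cases "a \<le> b")
  case False then show ?thesis by simp
next
  case ab: True
  define s where "s x h = (u (x + h) - u x) / h" for x h
  define Esteep where "Esteep = {x \<in> {a<..<b}. \<forall>m. \<exists>\<^sub>F h in at 0. m \<le> \<bar>s x h\<bar>}"
  define E where "E p q = {x \<in> {a<..<b}. (\<exists>\<^sub>F h in at 0. s x h \<le> p) \<and> (\<exists>\<^sub>F h in at 0. q \<le> s x h)}" for p q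
  have interval: "\<exists>c d. short_interval a b x \<eta> c d \<and> P ((u d - u c) / (d - c))"
    if x: "x \<in> {a<..<b}" "\<eta> > 0" and fr: "\<exists>\<^sub>F h in at 0. P (s x h)" for x \<eta> P
  proof -
    define \<rho> where "\<rho> = Min {\<eta>, x - a, b - x}"
    have \<rho>: "\<rho> > 0" "\<rho> \<le> \<eta>" "\<rho> \<le> x - a" "\<rho> \<le> b - x" using x by (auto simp: \<rho>_def)
    have "\<forall>\<^sub>F h in at 0. \<bar>h\<bar> < \<rho> \<and> h \<noteq> (0::real)"
      using \<rho>(1) by (auto simp: eventually_at dist_real_def intro!: exI[of _ \<rho>])
    from frequently_eventually_frequently[OF fr this]
    obtain h where h: "P (s x h)" "\<bar>h\<bar> < \<rho>" "h \<noteq> 0"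
      by (auto dest: frequently_ex)
    show ?thesis
    proof (cases "h > 0")
      case True
      then show ?thesis using h \<rho> by (intro exI[of _ x] exI[of _ "x + h"]) (auto simp: s_def)
    next
      case False
      have "s x h = (u x - u (x + h)) / (x - (x + h))"
        using h(3) by (simp add: s_def field_simps)
      then show ?thesis using False h \<rho> by (intro exI[of _ "x + h"] exI[of _ x]) auto
    qed
  qed
  have "negligible Esteep"
  proof (rule negligible_unbounded_slopes[OF abs_cont_on_imp_bounded_variation[OF u] ab])
    fix x \<eta> m :: real assume "x \<in> Esteep" "\<eta> > 0"
    then show "\<exists>c d. short_interval a b x \<eta> c d \<and> m * (d - c) \<le> \<bar>u d - u c\<bar>"
      using interval[of x \<eta> "\<lambda>y. m \<le> \<bar>y\<bar>"] by (fastforce simp: Esteep_def field_simps)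
  qed
  have "negligible (E p q)" if "p < q" for p q
  proof -
    \<comment> \<open>Subtracting the linear function of mean slope makes the two slopes opposite.\<close>
    define m where "m = (p + q) / 2"
    define \<alpha> where "\<alpha> = (q - p) / 2"
    have m: "p = m - \<alpha>" "q = m + \<alpha>" "\<alpha> > 0" using that by (auto simp: m_def \<alpha>_def field_simps)
    have "abs_cont_on a b (\<lambda>x. x)" by (rule abs_cont_on_lipschitz[where L = 1]) auto
    then have "abs_cont_on a b (\<lambda>x. 1 * u x + (- m) * x)"
      by (rule abs_cont_on_lincomb[OF u])
    then have "bounded_variation_on a b (\<lambda>x. u x - m * x)"
      using abs_cont_on_imp_bounded_variation by simp
    then show ?thesis
    proof (rule negligible_oscillating_slopes[OF _ ab m(3)])
      fix x \<eta> :: real assume x: "x \<in> E p q" "\<eta> > 0"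
      obtain c d where "a \<le> c" "c < d" "d \<le> b" "x \<in> {c..d}" "d - c < \<eta>" "(u d - u c) / (d - c) \<le> p"
        using interval[of x \<eta> "\<lambda>y. y \<le> p"] x by (auto simp: E_def)
      then show "\<exists>c d. short_interval a b x \<eta> c d \<and>
          u d - m * d - (u c - m * c) \<le> - \<alpha> * (d - c)"
        by (intro exI[of _ c] exI[of _ d]) (auto simp: m field_simps)
      obtain c d where "a \<le> c" "c < d" "d \<le> b" "x \<in> {c..d}" "d - c < \<eta>" "q \<le> (u d - u c) / (d - c)"
        using interval[of x \<eta> "\<lambda>y. q \<le> y"] x by (auto simp: E_def)
      then show "\<exists>c d. short_interval a b x \<eta> c d \<and>
          \<alpha> * (d - c) \<le> u d - m * d - (u c - m * c)"
        by (intro exI[of _ c] exI[of _ d]) (auto simp: m field_simps)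
    qed
  qed
  moreover have "countable {(p, q) \<in> \<rat> \<times> \<rat>. p < (q::real)}"
    by (rule countable_subset[of _ "\<rat> \<times> \<rat>"]) (auto intro: countable_SIGMA countable_rat)
  ultimately have "negligible (\<Union>(p, q)\<in>{(p, q) \<in> \<rat> \<times> \<rat>. p < q}. E p q)"
    by (intro negligible_countable_Union countable_image) auto
  with \<open>negligible Esteep\<close> have "negligible (Esteep \<union> (\<Union>(p, q)\<in>{(p, q) \<in> \<rat> \<times> \<rat>. p < q}. E p q))"
    by (rule negligible_Un)
  then show ?thesis
    by (rule negligible_subset)
      (use not_differentiable_slopes[of u] in \<open>fastforce simp: Esteep_def E_def s_def\<close>)
qed

section \<open>The fundamental theorem of calculus\<close>

lemma abs_cont_on_continuous:
  assumes u: "abs_cont_on a b u"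
  shows "continuous_on {a..b} u"
  unfolding continuous_on_iff
proof (intro ballI allI impI)
  fix x \<epsilon> :: real assume x: "x \<in> {a..b}" and "\<epsilon> > 0"
  obtain \<delta> where \<delta>: "\<delta> > 0"
    "\<And>D. packing a b D \<Longrightarrow> total_length D < \<delta> \<Longrightarrow> variation_over u D < \<epsilon>"
    using abs_cont_onD[OF u \<open>\<epsilon> > 0\<close>] by blast
  have *: "\<bar>u d - u c\<bar> < \<epsilon>" if "a \<le> c" "c < d" "d \<le> b" "d - c < \<delta>" for c d
    using \<delta>(2)[OF packing_single[of a c d b]] that by simp
  show "\<exists>\<delta>>0. \<forall>y\<in>{a..b}. dist y x < \<delta> \<longrightarrow> dist (u y) (u x) < \<epsilon>"
  proof (intro exI[of _ \<delta>] conjI ballI impI)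
    fix y assume "y \<in> {a..b}" "dist y x < \<delta>"
    then show "dist (u y) (u x) < \<epsilon>"
      using *[of x y] *[of y x] x \<open>\<epsilon> > 0\<close>
      by (cases x y rule: linorder_cases) (auto simp: dist_real_def abs_minus_commute)
  qed (rule \<delta>(1))
qed

text \<open>The slope over an interval around \<open>x\<close> is a weighted mean of the slopes over its two parts.\<close>

lemma DERIV_straddle:
  fixes u :: "real \<Rightarrow> real"
  assumes "DERIV u x :> D" "\<epsilon> > 0"
  obtains \<delta> where "\<delta> > 0"
    "\<And>c d. c \<le> x \<Longrightarrow> x \<le> d \<Longrightarrow> x - c < \<delta> \<Longrightarrow> d - x < \<delta> \<Longrightarrow> \<bar>u d - u c - D * (d - c)\<bar> \<le> \<epsilon> * (d - c)"
proof -
  have "(u has_derivative (\<lambda>h. D * h)) (at x within UNIV)"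
    using assms(1) by (simp add: has_field_derivative_def)
  then obtain \<delta> where \<delta>: "\<delta> > 0"
    "\<And>y. \<bar>y - x\<bar> < \<delta> \<Longrightarrow> \<bar>u y - u x - D * (y - x)\<bar> \<le> \<epsilon> * \<bar>y - x\<bar>"
    using assms(2) unfolding has_derivative_within_alt by auto
  show ?thesis
  proof (rule that[OF \<delta>(1)])
    fix c d assume cd: "c \<le> x" "x \<le> d" "x - c < \<delta>" "d - x < \<delta>"
    have "\<bar>u d - u x - D * (d - x)\<bar> \<le> \<epsilon> * (d - x)" "\<bar>u c - u x - D * (c - x)\<bar> \<le> \<epsilon> * (x - c)"
      using \<delta>(2)[of d] \<delta>(2)[of c] cd by auto
    moreover have "u d - u c - D * (d - c) = (u d - u x - D * (d - x)) - (u c - u x - D * (c - x))"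
      by (simp add: algebra_simps)
    ultimately have "\<bar>u d - u c - D * (d - c)\<bar> \<le> \<epsilon> * (d - x) + \<epsilon> * (x - c)" by linarith
    also have "\<dots> = \<epsilon> * (d - c)" by (simp add: algebra_simps)
    finally show "\<bar>u d - u c - D * (d - c)\<bar> \<le> \<epsilon> * (d - c)" .
  qed
qed

lemma packing_sum_lengths_le_measure:
  assumes D: "packing a b D" and G: "G \<in> lmeasurable" "\<And>c d. (c, d) \<in> D \<Longrightarrow> {c<..<d} \<subseteq> G"
  shows "total_length D \<le> measure lebesgue G"
proof -
  let ?I = "\<lambda>(c, d). {c<..<d::real}"
  have m: "?I i \<in> lmeasurable" for i
    by (cases i) (simp flip: box_real)
  have "total_length D = (\<Sum>i\<in>D. measure lebesgue (?I i))"
    by (rule sum.cong) (auto dest!: packing_bounds[OF D])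
  also have "\<dots> = measure lebesgue (\<Union>i\<in>D. ?I i)"
  proof (rule measure_UNION'[symmetric])
    show "pairwise (\<lambda>i j. disjnt (?I i) (?I j)) D"
      unfolding pairwise_def disjnt_def using packing_separated[OF D] by fastforce
  qed (use packing_finite[OF D] m in auto)
  also have "\<dots> \<le> measure lebesgue G"
    by (rule measure_mono_fmeasurable) (use G m packing_finite[OF D] in \<open>auto intro!: sets.finite_UN fmeasurableD\<close>)
  finally show ?thesis .
qed

text \<open>The fundamental theorem of calculus, as a statement about the gauge integral. At tags where \<open>u\<close>
  is differentiable the Riemann sums are controlled by the straddle lemma; the other tags lie in an
  open set of small measure, and absolute continuity bounds the increments over their intervals.\<close>

theorem abs_cont_on_has_integral_deriv:
  assumes u: "abs_cont_on a b u" and ab: "a \<le> b"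
  shows "(deriv u has_integral (u b - u a)) {a..b}"
proof -
  define N where "N = {x \<in> {a<..<b}. \<not> u differentiable at x} \<union> {a, b}"
  have N: "negligible N"
    unfolding N_def using abs_cont_on_differentiable_ae[OF u] by (intro negligible_Un) auto
  define f where "f x = (if x \<in> N then 0 else deriv u x)" for x
  have der: "DERIV u x :> f x" if "x \<in> {a..b} - N" for x
    using that by (auto simp: f_def N_def DERIV_deriv_iff_real_differentiable)
  have "(f has_integral (u b - u a)) {a..b}"
    unfolding has_integral_real
  proof (intro allI impI)
    fix e :: real assume e: "e > 0"
    obtain \<delta> where \<delta>: "\<delta> > 0"
      "\<And>D. packing a b D \<Longrightarrow> total_length D < \<delta> \<Longrightarrow> variation_over u D < e / 2"
      using abs_cont_onD[OF u, of "e / 2"] e by auto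
    obtain G where G: "open G" "N \<subseteq> G" "G - N \<in> lmeasurable" "emeasure lebesgue (G - N) < ennreal \<delta>"
      using sets_lebesgue_outer_open[OF negligible_imp_sets[OF N] \<delta>(1)] by blast
    have NL: "N \<in> lmeasurable" "measure lebesgue N = 0"
      using N negligible_iff_measure by blast+
    have GL: "G \<in> lmeasurable"
      using fmeasurable.Un[OF G(3) NL(1)] G(2) by (simp add: Un_absorb2)
    have "measure lebesgue (G - N) < \<delta>"
      using G(4) \<delta>(1) emeasure_eq_measure2[OF G(3)] by (simp add: ennreal_less_iff)
    then have Gd: "measure lebesgue G < \<delta>"
      using measure_Un_le[of "G - N" lebesgue N] G(2,3) NL by (simp add: Un_absorb2 fmeasurableD)
    define e1 where "e1 = e / (2 * (b - a + 1))"
    have e1: "e1 > 0" "e1 * (b - a) < e / 2"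
      using e ab by (auto simp: e1_def field_simps)
    have "\<exists>\<rho>>0. \<forall>c d. c \<le> x \<longrightarrow> x \<le> d \<longrightarrow> x - c < \<rho> \<longrightarrow> d - x < \<rho> \<longrightarrow>
        \<bar>u d - u c - f x * (d - c)\<bar> \<le> e1 * (d - c)" if x: "x \<in> {a..b} - N" for x
      using DERIV_straddle[OF der[OF x] e1(1)] by metis
    then obtain \<rho> where \<rho>: "\<And>x. x \<in> {a..b} - N \<Longrightarrow> \<rho> x > 0"
      "\<And>x c d. x \<in> {a..b} - N \<Longrightarrow> c \<le> x \<Longrightarrow> x \<le> d \<Longrightarrow> x - c < \<rho> x \<Longrightarrow> d - x < \<rho> x \<Longrightarrow>
        \<bar>u d - u c - f x * (d - c)\<bar> \<le> e1 * (d - c)" by metis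
    define \<gamma> where "\<gamma> x = (if x \<in> N then G else if x \<in> {a..b} then ball x (\<rho> x) else ball x 1)" for x
    show "\<exists>\<gamma>. gauge \<gamma> \<and> (\<forall>\<D>. \<D> tagged_division_of {a..b} \<and> \<gamma> fine \<D> \<longrightarrow>
        norm ((\<Sum>(x, k)\<in>\<D>. measure lborel k *\<^sub>R f x) - (u b - u a)) < e)"
    proof (intro exI[of _ \<gamma>] conjI allI impI; (elim conjE)?)
      show "gauge \<gamma>"
        unfolding gauge_def
      proof (intro allI conjI)
        show "x \<in> \<gamma> x" for x using G(2) \<rho>(1)[of x] by (auto simp: \<gamma>_def)
        show "open (\<gamma> x)" for x using G(1) by (simp add: \<gamma>_def)
      qed
    next
      fix \<D> assume td: "\<D> tagged_division_of {a..b}" and fine: "\<gamma> fine \<D>"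
      have fin: "finite \<D>" using td by blast
      have k: "\<exists>c d. K = {c..d} \<and> c \<le> x \<and> x \<le> d \<and> a \<le> c \<and> d \<le> b \<and> {c..d} \<subseteq> \<gamma> x \<and>
          Inf K = c \<and> Sup K = d \<and> measure lborel K = d - c" if xK: "(x, K) \<in> \<D>" for x K
      proof -
        obtain c d where "K = cbox c d" using tagged_division_ofD(4)[OF td xK] by blast
        moreover have "x \<in> K" "K \<subseteq> {a..b}" "K \<subseteq> \<gamma> x"
          using td xK fine by (auto simp: fine_def)
        ultimately show ?thesis by (intro exI[of _ c] exI[of _ d]) auto
      qed
      define r where "r K = u (Sup K) - u (Inf K)" for K
      \<comment> \<open>\<open>\<D>1\<close> collects the tags at which the derivative exists, \<open>\<D>2\<close> the exceptional ones.\<close>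
      define \<D>1 where "\<D>1 = {(x, K) \<in> \<D>. x \<notin> N}"
      define \<D>2 where "\<D>2 = {(x, K) \<in> \<D>. x \<in> N}"
      have fin12: "finite \<D>1" "finite \<D>2"
        by (auto simp: \<D>1_def \<D>2_def intro: finite_subset[OF _ fin])
      have "(\<Sum>(x, K)\<in>\<D>. measure lborel K *\<^sub>R f x) - (u b - u a) = (\<Sum>(x, K)\<in>\<D>. measure lborel K *\<^sub>R f x - r K)"
        unfolding r_def additive_tagged_division_1[OF ab td, of u, symmetric]
        by (simp add: split_beta sum_subtractf)
      also have "\<dots> = (\<Sum>(x, K)\<in>\<D>1. measure lborel K *\<^sub>R f x - r K) + (\<Sum>(x, K)\<in>\<D>2. measure lborel K *\<^sub>R f x - r K)"
        using fin12 by (subst sum.union_disjoint[symmetric])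
          (auto simp: \<D>1_def \<D>2_def intro!: sum.cong)
      finally have eq: "(\<Sum>(x, K)\<in>\<D>. measure lborel K *\<^sub>R f x) - (u b - u a) = \<dots>" .
      have "\<bar>\<Sum>(x, K)\<in>\<D>1. measure lborel K *\<^sub>R f x - r K\<bar> \<le> (\<Sum>(x, K)\<in>\<D>1. e1 * measure lborel K)"
      proof (rule order_trans[OF sum_abs sum_mono], clarify)
        fix x K assume "(x, K) \<in> \<D>1"
        then have xK: "(x, K) \<in> \<D>" "x \<notin> N" by (auto simp: \<D>1_def)
        obtain c d where cd: "K = {c..d}" "c \<le> x" "x \<le> d" "a \<le> c" "d \<le> b" "{c..d} \<subseteq> \<gamma> x"
          "Inf K = c" "Sup K = d" "measure lborel K = d - c" using k[OF xK(1)] by blast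
        have x: "x \<in> {a..b} - N" using cd xK by auto
        have "{c..d} \<subseteq> ball x (\<rho> x)" using cd(6) x by (simp add: \<gamma>_def)
        moreover have "c \<in> {c..d}" "d \<in> {c..d}" using cd(2,3) by auto
        ultimately have "c \<in> ball x (\<rho> x)" "d \<in> ball x (\<rho> x)" by blast+
        then have "x - c < \<rho> x" "d - x < \<rho> x" by (auto simp: dist_real_def)
        from \<rho>(2)[OF x cd(2,3) this] show "\<bar>measure lborel K *\<^sub>R f x - r K\<bar> \<le> e1 * measure lborel K"
          by (simp add: r_def cd(7-9) abs_minus_commute mult.commute)
      qed
      also have "\<dots> \<le> (\<Sum>(x, K)\<in>\<D>. e1 * measure lborel K)"
        using e1 by (intro sum_mono2 fin) (auto simp: \<D>1_def split: prod.splits)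
      also have "\<dots> = e1 * (b - a)"
        using additive_content_tagged_division[of \<D> a b] td ab
        by (simp add: split_beta flip: sum_distrib_left)
      finally have part1: "\<bar>\<Sum>(x, K)\<in>\<D>1. measure lborel K *\<^sub>R f x - r K\<bar> < e / 2" using e1(2) by simp
      define \<D>3 where "\<D>3 = {(x, K) \<in> \<D>2. Inf K < Sup K}"
      define P where "P = (\<lambda>(x, K). (Inf K, Sup K)) ` \<D>3"
      have sep: "Sup K \<le> Inf K' \<or> Sup K' \<le> Inf K"
        if xK: "(x, K) \<in> \<D>3" "(x', K') \<in> \<D>3" "(x, K) \<noteq> (x', K')" for x K x' K'
      proof -
        have in\<D>: "(x, K) \<in> \<D>" "(x', K') \<in> \<D>" and lt: "Inf K < Sup K" "Inf K' < Sup K'"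
          using xK by (auto simp: \<D>3_def \<D>2_def)
        obtain c d where cd: "K = {c..d}" "Inf K = c" "Sup K = d" using k[OF in\<D>(1)] by blast
        obtain c' d' where cd': "K' = {c'..d'}" "Inf K' = c'" "Sup K' = d'" using k[OF in\<D>(2)] by blast
        have "interior K \<inter> interior K' = {}"
          using tagged_division_ofD(5)[OF td in\<D> xK(3)] .
        then have "{c<..<d} \<inter> {c'<..<d'} = {}" by (simp add: cd cd' interior_atLeastAtMost_real)
        then have "{max c c'<..<min d d'} = {}" by auto
        then have "min d d' \<le> max c c'" by simp
        moreover have "c < d" "c' < d'" using lt unfolding cd(2,3) cd'(2,3) .
        ultimately show ?thesis unfolding cd(2,3) cd'(2,3) by linarith
      qed
      have inj: "inj_on (\<lambda>(x, K). (Inf K, Sup K)) \<D>3"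
        by (rule inj_onI) (use sep in \<open>fastforce simp: \<D>3_def\<close>)
      have pack: "packing a b P"
      proof (rule packingI)
        show "finite P" using fin12 by (auto simp: P_def \<D>3_def intro: finite_subset[of _ \<D>2])
        show "a \<le> c \<and> c < d \<and> d \<le> b" if "(c, d) \<in> P" for c d
          using that k by (fastforce simp: P_def \<D>3_def \<D>2_def)
        show "d \<le> c' \<or> d' \<le> c" if "(c, d) \<in> P" "(c', d') \<in> P" "(c, d) \<noteq> (c', d')" for c d c' d'
          using that sep by (auto simp: P_def)
      qed
      have sub: "{c<..<d} \<subseteq> G" if cdP: "(c, d) \<in> P" for c d
      proof -
        obtain x K where "(x, K) \<in> \<D>" "x \<in> N" "Inf K = c" "Sup K = d"
          using cdP by (auto simp: P_def \<D>3_def \<D>2_def)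
        then have "{c..d} \<subseteq> G" using k[of x K] by (auto simp: \<gamma>_def)
        then show ?thesis by auto
      qed
      have "total_length P < \<delta>"
        using packing_sum_lengths_le_measure[OF pack GL sub] Gd by linarith
      then have P: "variation_over u P < e / 2" using \<delta>(2) pack by blast
      have "\<bar>\<Sum>(x, K)\<in>\<D>2. measure lborel K *\<^sub>R f x - r K\<bar> \<le> (\<Sum>(x, K)\<in>\<D>2. \<bar>r K\<bar>)"
        by (rule order_trans[OF sum_abs sum_mono]) (auto simp: \<D>2_def f_def)
      also have "\<dots> = (\<Sum>(x, K)\<in>\<D>3. \<bar>r K\<bar>)"
      proof (rule sum.mono_neutral_right[OF fin12(2)])
        show "\<forall>i\<in>\<D>2 - \<D>3. (case i of (x, K) \<Rightarrow> \<bar>r K\<bar>) = 0"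
          using k by (fastforce simp: \<D>3_def \<D>2_def r_def)
      qed (auto simp: \<D>3_def)
      also have "\<dots> = variation_over u P"
        unfolding P_def by (subst sum.reindex[OF inj]) (simp add: r_def split_beta)
      finally have "\<bar>\<Sum>(x, K)\<in>\<D>2. measure lborel K *\<^sub>R f x - r K\<bar> < e / 2" using P by simp
      with part1 show "norm ((\<Sum>(x, K)\<in>\<D>. measure lborel K *\<^sub>R f x) - (u b - u a)) < e"
        unfolding eq by simp
    qed
  qed
  then show ?thesis
    by (rule has_integral_spike[OF N, rotated]) (auto simp: f_def)
qed

section \<open>Grid slopes and integrability of the derivative\<close>

text \<open>The equidistant grid of mesh \<open>1/(n+1)\<close> starts at \<open>-1\<close>. It reaches 0 at \<open>k = n + 1\<close>; later nodes are
  used for functions on \<open>[-1,T]\<close>.\<close>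

definition node :: "nat \<Rightarrow> nat \<Rightarrow> real" where
  "node n k = - 1 + real k / real (Suc n)"

lemma mesh_tendsto_0: "(\<lambda>n. 1 / real (Suc n)) \<longlonglongrightarrow> 0"
  using LIMSEQ_inverse_real_of_nat by (simp add: inverse_eq_divide)

lemma eventually_mesh_less: "0 < \<delta> \<Longrightarrow> \<forall>\<^sub>F n in sequentially. 1 / real (Suc n) < \<delta>"
  by (rule order_tendstoD(2)[OF mesh_tendsto_0])

lemma node_0 [simp]: "node n 0 = - 1"
  by (simp add: node_def)

lemma node_last [simp]: "node n (Suc n) = 0"
  by (simp add: node_def)

lemma node_Suc: "node n (Suc k) = node n k + 1 / real (Suc n)"
  by (simp add: node_def add_divide_distrib)

lemma node_mono: "j \<le> k \<Longrightarrow> node n j \<le> node n k"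
  by (simp add: node_def divide_right_mono)

lemma node_less_Suc: "node n k < node n (Suc k)"
  unfolding node_Suc by simp

lemma node_bounds: "k \<le> Suc n \<Longrightarrow> - 1 \<le> node n k \<and> node n k \<le> 0"
  using node_mono[of 0 k n] node_mono[of k "Suc n" n] by simp

lemma node_cell:
  assumes "- 1 \<le> x"
  obtains k where "node n k \<le> x" "x < node n (Suc k)"
proof -
  define k where "k = nat \<lfloor>(x + 1) * real (Suc n)\<rfloor>"
  have "0 \<le> (x + 1) * real (Suc n)" using assms by simp
  then have "real k \<le> (x + 1) * real (Suc n)" "(x + 1) * real (Suc n) < real k + 1"
    unfolding k_def by linarith+
  then have "node n k \<le> x" "x < node n (Suc k)"
    by (auto simp: node_def field_simps)
  then show ?thesis by (rule that)
qed

lemma node_cell_unique: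
  assumes "node n k \<le> x" "x < node n (Suc k)" "node n j \<le> x" "x < node n (Suc j)"
  shows "j = k"
proof (rule ccontr)
  assume "j \<noteq> k"
  then have "Suc j \<le> k \<or> Suc k \<le> j" by auto
  then show False using node_mono[of "Suc j" k n] node_mono[of "Suc k" j n] assms by auto
qed

definition grid_variation :: "(real \<Rightarrow> real) \<Rightarrow> nat \<Rightarrow> real" where
  "grid_variation u n = (\<Sum>k<Suc n. \<bar>u (node n (Suc k)) - u (node n k)\<bar>)"

text \<open>The derivative of the piecewise linear interpolant of \<open>u\<close> on \<open>[-1,0)\<close>, continued by 0.\<close>

definition grid_slope :: "(real \<Rightarrow> real) \<Rightarrow> nat \<Rightarrow> real \<Rightarrow> real" where
  "grid_slope u n x =
     (\<Sum>k<Suc n. real (Suc n) * (u (node n (Suc k)) - u (node n k)) * indicator {node n k..<node n (Suc k)} x)"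

lemma grid_slope_cell:
  assumes "node n k \<le> x" "x < node n (Suc k)" "k < Suc n"
  shows "grid_slope u n x = real (Suc n) * (u (node n (Suc k)) - u (node n k))"
proof -
  have "grid_slope u n x = (\<Sum>j<Suc n. if j = k then real (Suc n) * (u (node n (Suc k)) - u (node n k)) else 0)"
    unfolding grid_slope_def
    by (rule sum.cong) (use assms in \<open>auto simp: indicator_def dest: node_cell_unique\<close>)
  then show ?thesis using assms by (simp add: sum.delta del: sum.lessThan_Suc)
qed

lemma grid_slope_outside:
  assumes "x < - 1 \<or> 0 \<le> x"
  shows "grid_slope u n x = 0"
  unfolding grid_slope_def
proof (rule sum.neutral, rule ballI)
  fix k assume "k \<in> {..<Suc n}"
  then have "- 1 \<le> node n k" "node n (Suc k) \<le> 0" using node_bounds[of k n] node_bounds[of "Suc k" n] by auto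
  then have "x \<notin> {node n k..<node n (Suc k)}" using assms by auto
  then show "real (Suc n) * (u (node n (Suc k)) - u (node n k)) * indicator {node n k..<node n (Suc k)} x = 0"
    by simp
qed

lemma grid_slope_measurable [measurable]: "grid_slope u n \<in> borel_measurable borel"
  unfolding grid_slope_def[abs_def] by measurable

lemma grid_slope_measurable_lebesgue [measurable]: "grid_slope u n \<in> borel_measurable lebesgue"
  by (rule measurable_completion) simp

lemma grid_cell:
  assumes "x \<in> {- 1..<0}"
  obtains k where "node n k \<le> x" "x < node n (Suc k)" "k < Suc n"
proof -
  obtain k where k: "node n k \<le> x" "x < node n (Suc k)" using node_cell[of x n] assms by auto
  have "k < Suc n"
  proof (rule ccontr)
    assume "\<not> ?thesis"
    then have "node n (Suc n) \<le> node n k" by (intro node_mono) simp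
    then show False using k assms by auto
  qed
  then show ?thesis using k that by blast
qed

lemma nn_integral_grid_slope:
  "(\<integral>\<^sup>+x. ennreal \<bar>grid_slope u n x\<bar> \<partial>lebesgue) = ennreal (grid_variation u n)"
proof -
  let ?c = "\<lambda>k. real (Suc n) * \<bar>u (node n (Suc k)) - u (node n k)\<bar>"
  have "ennreal \<bar>grid_slope u n x\<bar> = (\<Sum>k<Suc n. ennreal (?c k) * indicator {node n k..<node n (Suc k)} x)" for x
  proof (cases "x \<in> {- 1..<0}")
    case True
    then obtain j where j: "node n j \<le> x" "x < node n (Suc j)" "j < Suc n" using grid_cell by blast
    have "(\<Sum>k<Suc n. ennreal (?c k) * indicator {node n k..<node n (Suc k)} x) =
        (\<Sum>k<Suc n. if k = j then ennreal (?c j) else 0)"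
      by (rule sum.cong) (use j in \<open>auto simp: indicator_def dest: node_cell_unique\<close>)
    then show ?thesis
      using j by (simp add: grid_slope_cell[OF j] abs_mult sum.delta del: sum.lessThan_Suc)
  next
    case False
    have "(\<Sum>k<Suc n. ennreal (?c k) * indicator {node n k..<node n (Suc k)} x) = 0"
    proof (rule sum.neutral, rule ballI)
      fix k assume "k \<in> {..<Suc n}"
      then have "- 1 \<le> node n k" "node n (Suc k) \<le> 0"
        using node_bounds[of k n] node_bounds[of "Suc k" n] by auto
      then have "x \<notin> {node n k..<node n (Suc k)}" using False by auto
      then show "ennreal (?c k) * indicator {node n k..<node n (Suc k)} x = 0" by simp
    qed
    then show ?thesis using False grid_slope_outside[of x u n] by auto
  qed
  moreover have m: "(\<lambda>x. ennreal c * indicator {a..<b} x) \<in> borel_measurable lebesgue" for a b c :: real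
    by (rule measurable_completion) measurable
  ultimately have "(\<integral>\<^sup>+x. ennreal \<bar>grid_slope u n x\<bar> \<partial>lebesgue) =
      (\<Sum>k<Suc n. \<integral>\<^sup>+x. ennreal (?c k) * indicator {node n k..<node n (Suc k)} x \<partial>lebesgue)"
    by (simp only:) (rule nn_integral_sum, rule m)
  also have "\<dots> = (\<Sum>k<Suc n. ennreal \<bar>u (node n (Suc k)) - u (node n k)\<bar>)"
  proof (rule sum.cong[OF refl])
    fix k
    have "(\<integral>\<^sup>+x. ennreal (?c k) * indicator {node n k..<node n (Suc k)} x \<partial>lebesgue) =
        ennreal (?c k) * ennreal (1 / real (Suc n))"
      using node_less_Suc[of n k] by (subst nn_integral_cmult_indicator) (auto simp: node_Suc)
    also have "\<dots> = ennreal \<bar>u (node n (Suc k)) - u (node n k)\<bar>"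
      by (simp flip: ennreal_mult del: of_nat_Suc)
    finally show "(\<integral>\<^sup>+x. ennreal (?c k) * indicator {node n k..<node n (Suc k)} x \<partial>lebesgue) =
        ennreal \<bar>u (node n (Suc k)) - u (node n k)\<bar>" .
  qed
  also have "\<dots> = ennreal (grid_variation u n)"
    unfolding grid_variation_def by (rule sum_ennreal) auto
  finally show ?thesis .
qed

text \<open>The straddle lemma applies, since the cell containing \<open>x\<close> shrinks to \<open>x\<close>.\<close>

lemma grid_slope_tendsto_deriv:
  assumes x: "x \<in> {- 1<..<0}" and "u differentiable at x"
  shows "(\<lambda>n. grid_slope u n x) \<longlonglongrightarrow> deriv u x"
  unfolding tendsto_iff
proof (intro allI impI)
  fix \<epsilon> :: real assume "\<epsilon> > 0"
  have "DERIV u x :> deriv u x" using assms by (simp add: DERIV_deriv_iff_real_differentiable)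
  then obtain \<delta> where \<delta>: "\<delta> > 0"
    "\<And>c d. c \<le> x \<Longrightarrow> x \<le> d \<Longrightarrow> x - c < \<delta> \<Longrightarrow> d - x < \<delta> \<Longrightarrow> \<bar>u d - u c - deriv u x * (d - c)\<bar> \<le> \<epsilon> / 2 * (d - c)"
    by (rule DERIV_straddle[where \<epsilon> = "\<epsilon> / 2"]) (use \<open>\<epsilon> > 0\<close> in auto)
  have "\<forall>\<^sub>F n in sequentially. 1 / real (Suc n) < \<delta>"
    by (rule eventually_mesh_less[OF \<delta>(1)])
  then show "\<forall>\<^sub>F n in sequentially. dist (grid_slope u n x) (deriv u x) < \<epsilon>"
  proof eventually_elim
    case (elim n)
    obtain k where k: "node n k \<le> x" "x < node n (Suc k)" "k < Suc n" using grid_cell[of x n] x by auto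
    let ?d = "u (node n (Suc k)) - u (node n k)"
    have "\<bar>?d - deriv u x * (node n (Suc k) - node n k)\<bar> \<le> \<epsilon> / 2 * (node n (Suc k) - node n k)"
      by (rule \<delta>(2)) (use k elim in \<open>auto simp: node_Suc\<close>)
    then have "\<bar>?d - deriv u x * (1 / real (Suc n))\<bar> \<le> \<epsilon> / 2 * (1 / real (Suc n))"
      by (simp add: node_Suc)
    then have "real (Suc n) * \<bar>?d - deriv u x * (1 / real (Suc n))\<bar> \<le> real (Suc n) * (\<epsilon> / 2 * (1 / real (Suc n)))"
      by (rule mult_left_mono) simp
    moreover have "real (Suc n) * \<bar>?d - deriv u x * (1 / real (Suc n))\<bar> =
        \<bar>real (Suc n) * (?d - deriv u x * (1 / real (Suc n)))\<bar>" by (simp add: abs_mult)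
    moreover have "real (Suc n) * (?d - deriv u x * (1 / real (Suc n))) = real (Suc n) * ?d - deriv u x"
      by (simp add: field_simps)
    moreover have "real (Suc n) * (\<epsilon> / 2 * (1 / real (Suc n))) = \<epsilon> / 2" by (simp add: field_simps)
    ultimately have "\<bar>real (Suc n) * ?d - deriv u x\<bar> \<le> \<epsilon> / 2" by metis
    then show ?case using \<open>\<epsilon> > 0\<close> by (simp add: grid_slope_cell[OF k] dist_real_def)
  qed
qed

text \<open>Sums of increments along increasing points are bounded by telescoping a function \<open>P\<close> whose increments
  dominate them; \<open>P\<close> will be the variation function or the integral of \<open>|u'|\<close>.\<close>

lemma monotone_sum_telescope:
  fixes x :: "nat \<Rightarrow> real"
  assumes "\<And>k. k < m \<Longrightarrow> \<bar>u (x (Suc k)) - u (x k)\<bar> \<le> P (x (Suc k)) - P (x k)"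
  shows "(\<Sum>k<m. \<bar>u (x (Suc k)) - u (x k)\<bar>) \<le> P (x m) - (P (x 0) :: real)"
proof -
  have "(\<Sum>k<m. \<bar>u (x (Suc k)) - u (x k)\<bar>) \<le> (\<Sum>k<m. P (x (Suc k)) - P (x k))"
    by (rule sum_mono) (use assms in auto)
  also have "\<dots> = P (x m) - P (x 0)"
    by (rule sum_lessThan_telescope)
  finally show ?thesis .
qed

context
  fixes u :: "real \<Rightarrow> real"
  assumes u: "abs_cont_on (- 1) 0 u"
begin

lemma AE_unit_interval_differentiable:
  "AE x in lebesgue. x \<in> {- 1..0} \<longrightarrow> x \<in> {- 1<..<0} \<and> u differentiable at x"
proof -
  have "negligible ({x \<in> {- 1<..<0}. \<not> u differentiable at x} \<union> {- 1, 0})"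
    using abs_cont_on_differentiable_ae[OF u] by (intro negligible_Un) auto
  then show ?thesis
    unfolding negligible_iff_null_sets by (rule AE_I') auto
qed

lemma AE_grid_slope_tendsto:
  "AE x in lebesgue. (\<lambda>n. grid_slope u n x) \<longlonglongrightarrow> indicator {- 1..0} x * deriv u x"
  using AE_unit_interval_differentiable
proof eventually_elim
  case (elim x)
  show ?case
  proof (cases "x \<in> {- 1..0}")
    case True
    then show ?thesis using elim grid_slope_tendsto_deriv[of x u] by auto
  next
    case False
    then show ?thesis by (auto simp: grid_slope_outside)
  qed
qed

text \<open>Fatou's lemma for the slopes over the grids, whose integrals are bounded by the total
  variation.\<close>

lemma set_integrable_deriv: "set_integrable lebesgue {- 1..0} (deriv u)"
proof -
  obtain v where v: "\<And>c d. - 1 \<le> c \<Longrightarrow> c \<le> d \<Longrightarrow> d \<le> 0 \<Longrightarrow> \<bar>u d - u c\<bar> \<le> v d - v c"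
    and "\<And>\<epsilon>. \<epsilon> > 0 \<Longrightarrow> \<exists>D. packing (- 1) 0 D \<and> v 0 - v (- 1) - \<epsilon> < variation_over u D"
    using variation_function[OF abs_cont_on_imp_bounded_variation[OF u]] by auto
  have bound: "grid_variation u n \<le> v 0 - v (- 1)" for n
    unfolding grid_variation_def
    using monotone_sum_telescope[of "Suc n" u "node n" v] v node_bounds[of _ n] node_less_Suc[of n]
    by (simp add: less_imp_le del: sum.lessThan_Suc)
  have m: "(\<lambda>x. indicator {- 1..0} x * deriv u x) \<in> borel_measurable lebesgue"
    using integrable_imp_measurable[of "deriv u" "{- 1..0}"] abs_cont_on_has_integral_deriv[OF u]
    by (auto simp: integrable_on_def borel_measurable_restrict_space_iff)
  have "(\<integral>\<^sup>+x. ennreal \<bar>indicator {- 1..0} x * deriv u x\<bar> \<partial>lebesgue) =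
      (\<integral>\<^sup>+x. liminf (\<lambda>n. ennreal \<bar>grid_slope u n x\<bar>) \<partial>lebesgue)"
  proof (rule nn_integral_cong_AE)
    show "AE x in lebesgue. ennreal \<bar>indicator {- 1..0} x * deriv u x\<bar> = liminf (\<lambda>n. ennreal \<bar>grid_slope u n x\<bar>)"
      using AE_grid_slope_tendsto
    proof eventually_elim
      case (elim x)
      have "(\<lambda>n. ennreal \<bar>grid_slope u n x\<bar>) \<longlonglongrightarrow> ennreal \<bar>indicator {- 1..0} x * deriv u x\<bar>"
        by (intro tendsto_ennrealI tendsto_rabs elim)
      then show ?case by (rule lim_imp_Liminf[OF trivial_limit_sequentially, symmetric])
    qed
  qed
  also have "\<dots> \<le> liminf (\<lambda>n. \<integral>\<^sup>+x. ennreal \<bar>grid_slope u n x\<bar> \<partial>lebesgue)"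
    by (rule nn_integral_liminf) auto
  also have "\<dots> \<le> ennreal (v 0 - v (- 1))"
    unfolding nn_integral_grid_slope by (intro Liminf_le always_eventually allI ennreal_leI bound trivial_limit_sequentially)
  finally have "(\<integral>\<^sup>+x. ennreal \<bar>indicator {- 1..0} x * deriv u x\<bar> \<partial>lebesgue) < \<infinity>"
    by (simp add: le_less_trans)
  then show ?thesis
    unfolding set_integrable_def using m by (intro integrableI_bounded) auto
qed

lemma set_integrable_deriv_subinterval:
  "- 1 \<le> c \<Longrightarrow> d \<le> 0 \<Longrightarrow> set_integrable lebesgue {c..d} (deriv u)"
  by (rule set_integrable_subset[OF set_integrable_deriv]) auto

lemma set_integrable_abs_deriv: "set_integrable lebesgue {- 1..0} (\<lambda>x. \<bar>deriv u x\<bar>)"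
  using set_integrable_abs[OF set_integrable_deriv] by simp

text \<open>The integral of \<open>|u'|\<close> up to \<open>x\<close>: a nondecreasing function that controls all sums of increments of \<open>u\<close>.\<close>

definition variation_upto :: "real \<Rightarrow> real" where
  "variation_upto x = (LINT s:{- 1..x}|lebesgue. \<bar>deriv u s\<bar>)"

lemma variation_upto_m1: "variation_upto (- 1) = 0"
proof -
  have "AE x in lebesgue. indicator {- 1..- 1} x *\<^sub>R \<bar>deriv u x\<bar> = 0"
    by (rule AE_I'[of "{- 1}"]) (auto simp: null_sets_def indicator_def split: if_splits)
  then show ?thesis
    unfolding variation_upto_def set_lebesgue_integral_def by (rule integral_eq_zero_AE)
qed

lemma abs_increment_le_variation_upto:
  assumes cd: "- 1 \<le> c" "c \<le> d" "d \<le> 0"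
  shows "\<bar>u d - u c\<bar> \<le> variation_upto d - variation_upto c"
proof -
  have i: "set_integrable lebesgue {c..d} (deriv u)" using cd by (intro set_integrable_deriv_subinterval)
  have i1: "set_integrable lebesgue {c..d} (\<lambda>x. \<bar>deriv u x\<bar>)" using set_integrable_abs[OF i] by simp
  have i2: "set_integrable lebesgue {c<..d} (\<lambda>x. \<bar>deriv u x\<bar>)"
    by (rule set_integrable_subset[OF i1]) auto
  have "(deriv u has_integral (u d - u c)) {c..d}"
    using abs_cont_on_has_integral_deriv[OF abs_cont_on_subinterval[OF u]] cd by auto
  then have "u d - u c = (LINT s:{c..d}|lebesgue. deriv u s)"
    using set_lebesgue_integral_eq_integral(2)[OF i] integral_unique by metis
  also have "\<bar>\<dots>\<bar> \<le> (LINT s:{c..d}|lebesgue. \<bar>deriv u s\<bar>)"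
    using set_integral_norm_bound[OF i] by simp
  also have "\<dots> = (LINT s:{c<..d}|lebesgue. \<bar>deriv u s\<bar>)"
  proof (rule set_integral_cong_set)
    show "AE x in lebesgue. (x \<in> {c<..d}) = (x \<in> {c..d})"
      by (rule AE_I'[of "{c}"]) (auto simp: null_sets_def)
  qed (use i1 i2 in \<open>auto simp: set_borel_measurable_def set_integrable_def\<close>)
  also have "\<dots> = variation_upto d - variation_upto c"
  proof -
    have "{- 1..d} = {- 1..c} \<union> {c<..d}" using cd by auto
    then have "variation_upto d =
        (LINT s:{- 1..c}|lebesgue. \<bar>deriv u s\<bar>) + (LINT s:{c<..d}|lebesgue. \<bar>deriv u s\<bar>)"
      unfolding variation_upto_def
      by (simp only:) (intro set_integral_Un set_integrable_subset[OF set_integrable_abs_deriv]; use cd in auto)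
    then show ?thesis by (simp add: variation_upto_def)
  qed
  finally show ?thesis .
qed

lemma grid_variation_le: "grid_variation u n \<le> (LINT s:{- 1..0}|lebesgue. \<bar>deriv u s\<bar>)"
proof -
  have "grid_variation u n \<le> variation_upto (node n (Suc n)) - variation_upto (node n 0)"
    unfolding grid_variation_def
  proof (rule monotone_sum_telescope)
    fix k assume "k < Suc n"
    then show "\<bar>u (node n (Suc k)) - u (node n k)\<bar> \<le> variation_upto (node n (Suc k)) - variation_upto (node n k)"
      using node_bounds[of k n] node_bounds[of "Suc k" n] node_less_Suc[of n k]
      by (intro abs_increment_le_variation_upto) auto
  qed
  also have "\<dots> = (LINT s:{- 1..0}|lebesgue. \<bar>deriv u s\<bar>)"
    by (simp only: node_0 node_last variation_upto_m1) (simp add: variation_upto_def)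
  finally show ?thesis .
qed

lemma integrable_indicator_deriv: "integrable lebesgue (\<lambda>x. indicator {- 1..0} x * deriv u x)"
  using set_integrable_deriv by (simp add: set_integrable_def)

lemma nn_integral_abs_deriv:
  "(\<integral>\<^sup>+x. ennreal \<bar>indicator {- 1..0} x * deriv u x\<bar> \<partial>lebesgue) =
     ennreal (LINT s:{- 1..0}|lebesgue. \<bar>deriv u s\<bar>)"
  unfolding set_lebesgue_integral_def
  by (subst nn_integral_eq_integral)
    (use integrable_abs[OF integrable_indicator_deriv] in \<open>auto simp: abs_mult\<close>)

abbreviation slope_error :: "nat \<Rightarrow> real \<Rightarrow> real" where
  "slope_error n x \<equiv> \<bar>grid_slope u n x - indicator {- 1..0} x * deriv u x\<bar>"

text \<open>Scheffe's lemma applies since the integrals of the moduli of the slopes never exceed that of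
  the limit.\<close>

lemma nn_integral_grid_slope_diff_tendsto:
  "(\<lambda>n. \<integral>\<^sup>+x. ennreal (slope_error n x) \<partial>lebesgue) \<longlonglongrightarrow> 0"
proof -
  have "(\<lambda>n. \<integral>\<^sup>+x. norm (grid_slope u n x - indicator {- 1..0} x * deriv u x) \<partial>lebesgue) \<longlonglongrightarrow> 0"
  proof (rule Scheffe_lemma2[OF _ integrable_indicator_deriv AE_grid_slope_tendsto])
    show "(\<integral>\<^sup>+x. norm (grid_slope u n x) \<partial>lebesgue) \<le>
        (\<integral>\<^sup>+x. norm (indicator {- 1..0} x * deriv u x) \<partial>lebesgue)" for n
      using nn_integral_grid_slope[of u n] nn_integral_abs_deriv ennreal_leI[OF grid_variation_le[of n]]
      by simp
  qed auto
  then show ?thesis by simp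
qed

lemma integrable_grid_slope: "integrable lebesgue (grid_slope u n)"
  by (rule integrableI_bounded) (use nn_integral_grid_slope[of u n] in auto)

lemma integrable_slope_error: "integrable lebesgue (slope_error n)"
  by (intro integrable_abs Bochner_Integration.integrable_diff integrable_grid_slope integrable_indicator_deriv)

lemma integral_grid_slope_diff_tendsto:
  "(\<lambda>n. \<integral>x. slope_error n x \<partial>lebesgue) \<longlonglongrightarrow> 0"
proof -
  have "(\<integral>\<^sup>+x. ennreal (slope_error n x) \<partial>lebesgue) =
      ennreal (\<integral>x. slope_error n x \<partial>lebesgue)" for n
    by (rule nn_integral_eq_integral[OF integrable_slope_error]) simp
  then have "(\<lambda>n. ennreal (\<integral>x. slope_error n x \<partial>lebesgue)) \<longlonglongrightarrow> ennreal 0"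
    using nn_integral_grid_slope_diff_tendsto by simp
  then show ?thesis by (subst (asm) tendsto_ennreal_iff) auto
qed

lemma integral_abs_grid_slope: "(\<integral>x. \<bar>grid_slope u n x\<bar> \<partial>lebesgue) = grid_variation u n"
proof -
  have "0 \<le> grid_variation u n" by (simp add: grid_variation_def sum_nonneg del: sum.lessThan_Suc)
  then show ?thesis
    by (intro integral_eq_nn_integral[THEN trans]) (auto simp: nn_integral_grid_slope)
qed

text \<open>The grid variation is the integral of the modulus of the slopes, which converge in the mean.\<close>

lemma grid_variation_tendsto:
  "grid_variation u \<longlonglongrightarrow> (LINT s:{- 1..0}|lebesgue. \<bar>deriv u s\<bar>)"
proof -
  let ?I = "LINT s:{- 1..0}|lebesgue. \<bar>deriv u s\<bar>"
  let ?d = "\<lambda>n. \<integral>x. slope_error n x \<partial>lebesgue"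
  have I: "?I = (\<integral>x. \<bar>indicator {- 1..0} x * deriv u x\<bar> \<partial>lebesgue)"
    by (simp add: set_lebesgue_integral_def abs_mult)
  have "?I \<le> grid_variation u n + ?d n" for n
  proof -
    have "?I \<le> (\<integral>x. \<bar>grid_slope u n x\<bar> + slope_error n x \<partial>lebesgue)"
      unfolding I
      by (rule integral_mono) (auto intro!: integrable_abs integrable_slope_error Bochner_Integration.integrable_add
        integrable_grid_slope integrable_indicator_deriv)
    also have "\<dots> = grid_variation u n + ?d n"
      unfolding integral_abs_grid_slope[symmetric]
      by (rule Bochner_Integration.integral_add) (intro integrable_abs integrable_slope_error integrable_grid_slope)+
    finally show ?thesis .
  qed
  then have "?I - ?d n \<le> grid_variation u n" for n by (simp add: diff_le_eq)
  moreover have "(\<lambda>n. ?I - ?d n) \<longlonglongrightarrow> ?I"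
    using tendsto_diff[OF tendsto_const[of ?I] integral_grid_slope_diff_tendsto] by simp
  ultimately show ?thesis
    using tendsto_sandwich[OF always_eventually always_eventually _ tendsto_const[of ?I],
        of "\<lambda>n. ?I - ?d n" "grid_variation u"] grid_variation_le by blast
qed

end

section \<open>The norm of \<open>AC([-1,0])\<close>\<close>

lemma ac_apply_abs_cont: "abs_cont_on (- 1) 0 (ac_apply u)"
  using ac_apply[of u] by simp

lemma ac_apply_outside: "s \<notin> {- 1..0} \<Longrightarrow> ac_apply u s = 0"
  using ac_apply[of u] by blast

lemma ac_eqI: "(\<And>s. s \<in> {- 1..0} \<Longrightarrow> ac_apply u s = ac_apply v s) \<Longrightarrow> u = v"
  by (metis ac_apply_outside ac_apply_inject ext)

lemma ac_apply_Abs_ac_restrict: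
  assumes "abs_cont_on (- 1) 0 f"
  shows "ac_apply (Abs_ac (\<lambda>s. if s \<in> {- 1..0} then f s else 0)) = (\<lambda>s. if s \<in> {- 1..0} then f s else 0)"
proof (rule Abs_ac_inverse, intro CollectI conjI)
  show "abs_cont_on (- 1) 0 (\<lambda>s. if s \<in> {- 1..0} then f s else 0)"
    by (rule abs_cont_on_cong[OF assms]) auto
qed auto

lemma ac_apply_sum: "ac_apply (\<Sum>i\<in>I. f i) s = (\<Sum>i\<in>I. ac_apply (f i) s)"
  by (induction I rule: infinite_finite_induct) (simp_all add: zero_ac.rep_eq plus_ac.rep_eq)

text \<open>These finite sums stay below \<open>ac_norm u\<close> and converge to it. The seminorm axioms hold for them
  and pass to the limit.\<close>

definition grid_norm :: "(real \<Rightarrow> real) \<Rightarrow> nat \<Rightarrow> real" where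
  "grid_norm u n = \<bar>u (- 1)\<bar> + grid_variation u n"

lemma grid_norm_tendsto: "grid_norm (ac_apply u) \<longlonglongrightarrow> ac_norm u"
  unfolding grid_norm_def[abs_def] ac_norm_def
  by (intro tendsto_add tendsto_const grid_variation_tendsto ac_apply_abs_cont)

lemma grid_norm_le: "grid_norm (ac_apply u) n \<le> ac_norm u"
  unfolding grid_norm_def ac_norm_def using grid_variation_le[OF ac_apply_abs_cont] by simp

lemma ac_norm_leI: "(\<And>n. grid_norm (ac_apply u) n \<le> B) \<Longrightarrow> ac_norm u \<le> B"
  by (rule LIMSEQ_le_const2[OF grid_norm_tendsto]) auto

lemma grid_norm_nonneg: "0 \<le> grid_norm u n"
  by (simp add: grid_norm_def grid_variation_def sum_nonneg del: sum.lessThan_Suc)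

lemma ac_norm_nonneg: "0 \<le> ac_norm u"
  using order_trans[OF grid_norm_nonneg grid_norm_le] .

lemma ac_norm_scaleR: "ac_norm (r *\<^sub>R u) = \<bar>r\<bar> * ac_norm u"
proof (rule LIMSEQ_unique[OF grid_norm_tendsto])
  have "grid_norm (ac_apply (r *\<^sub>R u)) n = \<bar>r\<bar> * grid_norm (ac_apply u) n" for n
    by (simp add: grid_norm_def grid_variation_def scaleR_ac.rep_eq distrib_left sum_distrib_left
        abs_mult[symmetric] right_diff_distrib del: sum.lessThan_Suc)
  then show "grid_norm (ac_apply (r *\<^sub>R u)) \<longlonglongrightarrow> \<bar>r\<bar> * ac_norm u"
    using tendsto_mult_left[OF grid_norm_tendsto[of u], of "\<bar>r\<bar>"] by presburger
qed

lemma ac_norm_triangle: "ac_norm (u + v) \<le> ac_norm u + ac_norm v"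
proof (rule ac_norm_leI)
  fix n
  have "grid_variation (ac_apply (u + v)) n \<le> grid_variation (ac_apply u) n + grid_variation (ac_apply v) n"
    unfolding grid_variation_def sum.distrib[symmetric] plus_ac.rep_eq by (rule sum_mono) linarith
  then have "grid_norm (ac_apply (u + v)) n \<le> grid_norm (ac_apply u) n + grid_norm (ac_apply v) n"
    unfolding grid_norm_def plus_ac.rep_eq by linarith
  then show "grid_norm (ac_apply (u + v)) n \<le> ac_norm u + ac_norm v"
    using grid_norm_le[of u n] grid_norm_le[of v n] by linarith
qed

lemma ac_norm_minus_commute: "ac_norm (u - v) = ac_norm (v - u)"
  using ac_norm_scaleR[of "- 1" "u - v"] by simp

lemma ac_norm_eq_variation_upto:
  "\<bar>ac_apply u (- 1)\<bar> + (variation_upto (ac_apply u) 0 - variation_upto (ac_apply u) (- 1)) = ac_norm u"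
  using variation_upto_m1[OF ac_apply_abs_cont[of u]]
  by (simp add: ac_norm_def variation_upto_def[OF ac_apply_abs_cont])

lemma variation_upto_mono:
  assumes "- 1 \<le> c" "c \<le> d" "d \<le> 0"
  shows "variation_upto (ac_apply u) c \<le> variation_upto (ac_apply u) d"
  using abs_increment_le_variation_upto[OF ac_apply_abs_cont[of u] assms] by linarith

lemma abs_ac_apply_le: "\<bar>ac_apply u s\<bar> \<le> ac_norm u"
proof (cases "s \<in> {- 1..0}")
  case True
  then have "\<bar>ac_apply u s - ac_apply u (- 1)\<bar> \<le>
      variation_upto (ac_apply u) s - variation_upto (ac_apply u) (- 1)"
    by (intro abs_increment_le_variation_upto[OF ac_apply_abs_cont]) auto
  moreover have "variation_upto (ac_apply u) s \<le> variation_upto (ac_apply u) 0"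
    using True by (intro variation_upto_mono) auto
  ultimately show ?thesis using ac_norm_eq_variation_upto[of u] by linarith
qed (simp add: ac_apply_outside ac_norm_nonneg)

lemma packing_increments_le_ac_norm:
  assumes D: "packing (- 1) 0 D"
  shows "variation_over (ac_apply u) D \<le> ac_norm u"
proof -
  have "variation_over (ac_apply u) D \<le>
      (\<Sum>(c, d)\<in>D. variation_upto (ac_apply u) d - variation_upto (ac_apply u) c)"
    by (rule sum_mono) (auto dest!: packing_bounds[OF D]
        intro!: abs_increment_le_variation_upto[OF ac_apply_abs_cont])
  also have "\<dots> \<le> variation_upto (ac_apply u) 0 - variation_upto (ac_apply u) (- 1)"
    by (rule packing_sum_increments_le[OF D]) (auto intro: variation_upto_mono)
  also have "\<dots> \<le> ac_norm u" using ac_norm_eq_variation_upto[of u] by linarith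
  finally show ?thesis .
qed

lemma ac_norm_eq_0_iff: "ac_norm u = 0 \<longleftrightarrow> u = 0"
proof
  assume "ac_norm u = 0"
  then have "ac_apply u s = 0" for s using abs_ac_apply_le[of u s] by simp
  then show "u = 0" by (intro ac_eqI) (simp add: zero_ac.rep_eq)
next
  assume "u = 0"
  then show "ac_norm u = 0" using ac_norm_scaleR[of 0 u] by simp
qed

lemma Metric_space_ac: "Metric_space UNIV (\<lambda>u v. ac_norm (u - v))"
proof
  show "ac_norm (x - z) \<le> ac_norm (x - y) + ac_norm (y - z)" for x y z
    using ac_norm_triangle[of "x - y" "y - z"] by simp
qed (auto simp: ac_norm_nonneg ac_norm_minus_commute ac_norm_eq_0_iff)

text \<open>Both absolute continuity and the norm are governed by finite sums of increments, which pass to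
  pointwise limits.\<close>

lemma ac_norm_complete: "Metric_space.mcomplete UNIV (\<lambda>u v. ac_norm (u - v))"
proof -
  interpret Metric_space UNIV "\<lambda>u v. ac_norm (u - v)" by (rule Metric_space_ac)
  show ?thesis
    unfolding mcomplete_def
  proof (intro allI impI)
    fix \<sigma> assume "MCauchy \<sigma>"
    then have C: "\<exists>N. \<forall>n m. N \<le> n \<longrightarrow> N \<le> m \<longrightarrow> ac_norm (\<sigma> n - \<sigma> m) < \<epsilon>" if "\<epsilon> > 0" for \<epsilon>
      using that unfolding MCauchy_def by blast
    have "Cauchy (\<lambda>n. ac_apply (\<sigma> n) s)" for s
      unfolding Cauchy_def
    proof (intro allI impI)
      fix \<epsilon> :: real assume "\<epsilon> > 0"
      from C[OF this] obtain N where N: "\<And>n m. N \<le> n \<Longrightarrow> N \<le> m \<Longrightarrow> ac_norm (\<sigma> n - \<sigma> m) < \<epsilon>" by blast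
      have "dist (ac_apply (\<sigma> m) s) (ac_apply (\<sigma> n) s) < \<epsilon>" if "N \<le> m" "N \<le> n" for m n
        using abs_ac_apply_le[of "\<sigma> m - \<sigma> n" s] N[OF that] by (simp add: dist_real_def minus_ac.rep_eq)
      then show "\<exists>N. \<forall>m\<ge>N. \<forall>n\<ge>N. dist (ac_apply (\<sigma> m) s) (ac_apply (\<sigma> n) s) < \<epsilon>" by blast
    qed
    then have "\<exists>l. (\<lambda>n. ac_apply (\<sigma> n) s) \<longlonglongrightarrow> l" for s
      by (simp add: Cauchy_convergent_iff convergent_def)
    then obtain w where w: "\<And>s. (\<lambda>n. ac_apply (\<sigma> n) s) \<longlonglongrightarrow> w s" by metis
    have w0: "w s = 0" if "s \<notin> {- 1..0}" for s
      using LIMSEQ_unique[OF w[of s]] ac_apply_outside[OF that] by simp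
    have "abs_cont_on (- 1) 0 w"
      unfolding abs_cont_on_iff_packing
    proof (intro allI impI)
      fix \<epsilon> :: real assume "\<epsilon> > 0"
      then obtain N where N: "\<And>n m. N \<le> n \<Longrightarrow> N \<le> m \<Longrightarrow> ac_norm (\<sigma> n - \<sigma> m) < \<epsilon> / 2"
        using C[of "\<epsilon> / 2"] by auto
      obtain \<delta> where \<delta>: "\<delta> > 0" "\<And>D. packing (- 1) 0 D \<Longrightarrow> total_length D < \<delta> \<Longrightarrow>
          variation_over (ac_apply (\<sigma> N)) D < \<epsilon> / 2"
        using abs_cont_onD[OF ac_apply_abs_cont[of "\<sigma> N"], of "\<epsilon> / 2"] \<open>\<epsilon> > 0\<close> by auto
      show "\<exists>\<delta>>0. \<forall>D. packing (- 1) 0 D \<longrightarrow> total_length D < \<delta> \<longrightarrow> variation_over w D < \<epsilon>"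
      proof (intro exI[of _ \<delta>] conjI allI impI)
        fix D assume D: "packing (- 1) 0 D" "total_length D < \<delta>"
        let ?r = "\<lambda>m (c, d). ac_apply (\<sigma> m - \<sigma> N) d - ac_apply (\<sigma> m - \<sigma> N) c"
        let ?R = "\<lambda>(c, d). (w d - ac_apply (\<sigma> N) d) - (w c - ac_apply (\<sigma> N) c)"
        have "(\<lambda>m. \<Sum>i\<in>D. \<bar>?r m i\<bar>) \<longlonglongrightarrow> (\<Sum>i\<in>D. \<bar>?R i\<bar>)"
          unfolding split_beta minus_ac.rep_eq by (intro tendsto_intros w)
        moreover have "(\<Sum>i\<in>D. \<bar>?r m i\<bar>) \<le> \<epsilon> / 2" if "m \<ge> N" for m
          using packing_increments_le_ac_norm[OF D(1), of "\<sigma> m - \<sigma> N"] N[OF that order_refl]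
          by (simp add: split_beta)
        ultimately have "(\<Sum>i\<in>D. \<bar>?R i\<bar>) \<le> \<epsilon> / 2"
          by (intro LIMSEQ_le_const2[where X = "\<lambda>m. \<Sum>i\<in>D. \<bar>?r m i\<bar>"]) blast+
        moreover have "variation_over w D \<le>
            (\<Sum>i\<in>D. \<bar>?R i\<bar>) + variation_over (ac_apply (\<sigma> N)) D"
          unfolding sum.distrib[symmetric] by (rule sum_mono) (auto simp: split_beta)
        ultimately show "variation_over w D < \<epsilon>" using \<delta>(2)[OF D] by linarith
      qed (rule \<delta>(1))
    qed
    then have x: "ac_apply (Abs_ac w) = w"
      using w0 by (intro Abs_ac_inverse) simp
    have "\<exists>N. \<forall>n\<ge>N. ac_norm (\<sigma> n - Abs_ac w) < \<epsilon>" if \<epsilon>: "\<epsilon> > 0" for \<epsilon>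
    proof -
      obtain N where N: "\<And>n m. N \<le> n \<Longrightarrow> N \<le> m \<Longrightarrow> ac_norm (\<sigma> n - \<sigma> m) < \<epsilon> / 2"
        using C[of "\<epsilon> / 2"] \<epsilon> by auto
      have "ac_norm (\<sigma> n - Abs_ac w) \<le> \<epsilon> / 2" if n: "n \<ge> N" for n
      proof (rule ac_norm_leI)
        fix k
        have "(\<lambda>m. grid_norm (ac_apply (\<sigma> n - \<sigma> m)) k) \<longlonglongrightarrow> grid_norm (ac_apply (\<sigma> n - Abs_ac w)) k"
          unfolding grid_norm_def grid_variation_def minus_ac.rep_eq x by (intro tendsto_intros w)
        moreover have "grid_norm (ac_apply (\<sigma> n - \<sigma> m)) k \<le> \<epsilon> / 2" if "m \<ge> N" for m
          using grid_norm_le[of "\<sigma> n - \<sigma> m" k] N[OF n that] by linarith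
        ultimately show "grid_norm (ac_apply (\<sigma> n - Abs_ac w)) k \<le> \<epsilon> / 2"
          by (intro LIMSEQ_le_const2[where X = "\<lambda>m. grid_norm (ac_apply (\<sigma> n - \<sigma> m)) k"]) blast+
      qed
      moreover have "\<epsilon> / 2 < \<epsilon>" using \<epsilon> by simp
      ultimately show ?thesis using le_less_trans by blast
    qed
    then show "\<exists>x. limitin mtopology \<sigma> x sequentially"
      unfolding limit_metric_sequentially by (intro exI[of _ "Abs_ac w"]) auto
  qed
qed

lemma banach_norm_ac_norm: "banach_norm ac_norm"
  unfolding banach_norm_def
  by (intro conjI allI ac_norm_nonneg ac_norm_eq_0_iff ac_norm_scaleR ac_norm_triangle ac_norm_complete)

section \<open>Piecewise linear interpolation and separability\<close>

text \<open>The tent of height 1 over \<open>node n k\<close> that vanishes at the other nodes.\<close>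

definition hat :: "nat \<Rightarrow> nat \<Rightarrow> real \<Rightarrow> real" where
  "hat n k x = max 0 (1 - real (Suc n) * \<bar>x - node n k\<bar>)"

lemma hat_lipschitz: "\<bar>hat n k y - hat n k x\<bar> \<le> real (Suc n) * \<bar>y - x\<bar>"
proof -
  have "\<bar>hat n k y - hat n k x\<bar> \<le> \<bar>real (Suc n) * \<bar>x - node n k\<bar> - real (Suc n) * \<bar>y - node n k\<bar>\<bar>"
    unfolding hat_def by linarith
  also have "\<dots> = real (Suc n) * \<bar>\<bar>x - node n k\<bar> - \<bar>y - node n k\<bar>\<bar>"
    by (simp add: abs_mult flip: right_diff_distrib)
  also have "\<dots> \<le> real (Suc n) * \<bar>y - x\<bar>"
    by (intro mult_left_mono) linarith+
  finally show ?thesis .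
qed

lemma abs_cont_on_hat: "abs_cont_on a b (hat n k)"
  by (rule abs_cont_on_lipschitz[where L = "real (Suc n)"]) (use hat_lipschitz[of n k] in \<open>metis abs_of_nonneg diff_ge_0_iff_ge\<close>)

lemma continuous_on_hat: "continuous_on S (hat n k)"
  unfolding hat_def[abs_def] by (intro continuous_intros)

definition interpolant :: "nat \<Rightarrow> nat \<Rightarrow> (real \<Rightarrow> real) \<Rightarrow> real \<Rightarrow> real" where
  "interpolant n m y x = (\<Sum>k\<le>m. y (node n k) * hat n k x)"

lemma node_diff: "real (Suc n) * (node n j - node n k) = real j - real k"
proof -
  have "node n j - node n k = (real j - real k) / real (Suc n)"
    by (simp add: node_def diff_divide_distrib)
  then show ?thesis by simp
qed

text \<open>On the cell of \<open>x\<close> only the hats at its two end points differ from 0.\<close>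

lemma interpolant_cell:
  assumes x: "node n j \<le> x" "x \<le> node n (Suc j)" and j: "j < m"
  shows "interpolant n m y x = y (node n j) + real (Suc n) * (x - node n j) * (y (node n (Suc j)) - y (node n j))"
proof -
  define l where "l = real (Suc n) * (x - node n j)"
  have "real (Suc n) * (node n (Suc j) - node n j) = 1"
    using node_diff[of n "Suc j" j] by simp
  then have l: "0 \<le> l" "l \<le> 1"
    using x mult_left_mono[of "x - node n j" "node n (Suc j) - node n j" "real (Suc n)"]
    by (auto simp: l_def)
  have xk: "real (Suc n) * \<bar>x - node n k\<bar> = \<bar>l + real j - real k\<bar>" for k
  proof -
    have "real (Suc n) * \<bar>x - node n k\<bar> = \<bar>real (Suc n) * (x - node n j) + real (Suc n) * (node n j - node n k)\<bar>"
      by (simp add: abs_mult flip: distrib_left)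
    then show ?thesis by (simp add: node_diff l_def del: of_nat_Suc)
  qed
  have "hat n k x = (if k = j then 1 - l else if k = Suc j then l else 0)" for k
  proof -
    consider "k < j" | "k = j" | "k = Suc j" | "k > Suc j" by linarith
    then show ?thesis
    proof cases
      case 2
      then show ?thesis unfolding hat_def xk using l by auto
    next
      case 3
      then show ?thesis unfolding hat_def xk using l by auto
    next
      case 1
      then have "real k + 1 \<le> real j" by linarith
      then show ?thesis unfolding hat_def xk using 1 l by auto
    next
      case 4
      then have "real j + 2 \<le> real k" by linarith
      then show ?thesis unfolding hat_def xk using 4 l by auto
    qed
  qed
  then have "interpolant n m y x = (\<Sum>k\<le>m. (if k = j then y (node n j) * (1 - l) else 0) +
      (if k = Suc j then y (node n (Suc j)) * l else 0))"
    unfolding interpolant_def by (intro sum.cong) auto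
  also have "\<dots> = y (node n j) * (1 - l) + y (node n (Suc j)) * l"
    using j by (simp add: sum.distrib sum.delta)
  finally show ?thesis unfolding l_def[symmetric] by (simp add: algebra_simps)
qed

definition hat_ac :: "nat \<Rightarrow> nat \<Rightarrow> ac" where
  "hat_ac n k = Abs_ac (\<lambda>s. if s \<in> {- 1..0} then hat n k s else 0)"

lemma ac_apply_hat_ac: "s \<in> {- 1..0} \<Longrightarrow> ac_apply (hat_ac n k) s = hat n k s"
  unfolding hat_ac_def ac_apply_Abs_ac_restrict[OF abs_cont_on_hat] by simp

definition interpolant_ac :: "nat \<Rightarrow> (nat \<Rightarrow> real) \<Rightarrow> ac" where
  "interpolant_ac n q = (\<Sum>k\<le>Suc n. q k *\<^sub>R hat_ac n k)"

lemma ac_apply_interpolant_ac: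
  assumes "s \<in> {- 1..0}"
  shows "ac_apply (interpolant_ac n (\<lambda>k. y (node n k))) s = interpolant n (Suc n) y s"
  unfolding interpolant_ac_def interpolant_def ac_apply_sum scaleR_ac.rep_eq
  by (simp only: ac_apply_hat_ac[OF assms])

text \<open>Almost everywhere the derivative of the interpolant is the slope over the grid, so the convergence
  of the slopes in the mean is the convergence of the interpolants in norm.\<close>

lemma interpolant_ac_tendsto:
  "(\<lambda>n. ac_norm (u - interpolant_ac n (\<lambda>k. ac_apply u (node n k)))) \<longlonglongrightarrow> 0"
proof -
  let ?f = "ac_apply u"
  let ?p = "\<lambda>n. interpolant_ac n (\<lambda>k. ?f (node n k))"
  have "ac_norm (u - ?p n) = (\<integral>x. \<bar>grid_slope ?f n x - indicator {- 1..0} x * deriv ?f x\<bar> \<partial>lebesgue)" for n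
  proof -
    have "ac_apply (u - ?p n) (- 1) = 0"
      using interpolant_cell[of n 0 "- 1" "Suc n" ?f] node_bounds[of 1 n]
      by (simp add: minus_ac.rep_eq ac_apply_interpolant_ac)
    moreover have "AE x in lebesgue. \<bar>indicator {- 1..0} x * deriv (ac_apply (u - ?p n)) x\<bar> =
        \<bar>grid_slope ?f n x - indicator {- 1..0} x * deriv ?f x\<bar>"
    proof -
      have "negligible (node n ` {..Suc n})" by (intro negligible_finite) simp
      then have "AE x in lebesgue. x \<notin> node n ` {..Suc n}"
        unfolding negligible_iff_null_sets by (rule AE_not_in)
      then show ?thesis
        using AE_unit_interval_differentiable[OF ac_apply_abs_cont[of u]]
      proof eventually_elim
        case (elim x)
        show ?case
        proof (cases "x \<in> {- 1..0}")
          case True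
          then have x: "x \<in> {- 1<..<0}" and diff: "?f differentiable at x" using elim by auto
          obtain k where k: "node n k \<le> x" "x < node n (Suc k)" "k < Suc n" using grid_cell[of x n] x by auto
          then have kx: "x \<in> {node n k<..<node n (Suc k)}" using elim(1) by (force simp: less_le)
          let ?s = "real (Suc n) * (?f (node n (Suc k)) - ?f (node n k))"
          have "DERIV (\<lambda>t. ?f t - (?f (node n k) + (t - node n k) * ?s)) x :> deriv ?f x - ?s"
            using diff by (auto intro!: derivative_eq_intros simp: DERIV_deriv_iff_real_differentiable)
          then have "DERIV (ac_apply (u - ?p n)) x :> deriv ?f x - ?s"
          proof (rule has_field_derivative_transform_within_open[OF _ _ kx])
            fix t assume t: "t \<in> {node n k<..<node n (Suc k)}"
            have "t \<in> {- 1..0}" using t node_bounds[of k n] node_bounds[of "Suc k" n] k(3) by auto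
            then show "?f t - (?f (node n k) + (t - node n k) * ?s) = ac_apply (u - ?p n) t"
              using t k(3) interpolant_cell[of n k t "Suc n" ?f]
              by (simp add: minus_ac.rep_eq ac_apply_interpolant_ac mult.assoc mult.left_commute del: of_nat_Suc)
          qed simp
          then have "deriv (ac_apply (u - ?p n)) x = deriv ?f x - ?s" by (rule DERIV_imp_deriv)
          then show ?thesis using True by (simp add: grid_slope_cell[OF k] abs_minus_commute)
        next
          case False
          then show ?thesis by (auto simp: grid_slope_outside)
        qed
      qed
    qed
    then have "(\<integral>x. \<bar>indicator {- 1..0} x * deriv (ac_apply (u - ?p n)) x\<bar> \<partial>lebesgue) =
        (\<integral>x. \<bar>grid_slope ?f n x - indicator {- 1..0} x * deriv ?f x\<bar> \<partial>lebesgue)"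
      by (intro integral_cong_AE)
        (auto intro!: borel_measurable_integrable integrable_abs Bochner_Integration.integrable_diff
          integrable_grid_slope integrable_indicator_deriv ac_apply_abs_cont)
    ultimately show ?thesis
      unfolding ac_norm_def set_lebesgue_integral_def by (simp add: abs_mult)
  qed
  then show ?thesis
    using integral_grid_slope_diff_tendsto[OF ac_apply_abs_cont[of u]] by simp
qed

lemma ac_norm_sum_le: "ac_norm (\<Sum>i\<in>I. f i) \<le> (\<Sum>i\<in>I. ac_norm (f i))"
proof (induction I rule: infinite_finite_induct)
  case (insert i I)
  then show ?case using ac_norm_triangle[of "f i" "\<Sum>i\<in>I. f i"] by simp
qed (use ac_norm_eq_0_iff[of 0] in auto)

definition rational_interpolants :: "ac set" where
  "rational_interpolants = (\<Union>n. interpolant_ac n ` ({..Suc n} \<rightarrow>\<^sub>E \<rat>))"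

lemma countable_rational_interpolants: "countable rational_interpolants"
  unfolding rational_interpolants_def
  by (intro countable_UN countable_image countable_PiE countable_rat) auto

text \<open>Interpolants approximate in norm, and for a fixed grid they depend continuously on their finitely many
  nodal values.\<close>

lemma rational_interpolants_dense:
  assumes "\<epsilon> > 0"
  obtains v where "v \<in> rational_interpolants" "ac_norm (u - v) < \<epsilon>"
proof -
  have "\<forall>\<^sub>F n in sequentially. ac_norm (u - interpolant_ac n (\<lambda>k. ac_apply u (node n k))) < \<epsilon> / 2"
    using order_tendstoD(2)[OF interpolant_ac_tendsto, of "\<epsilon> / 2"] assms by simp
  then obtain n where n: "ac_norm (u - interpolant_ac n (\<lambda>k. ac_apply u (node n k))) < \<epsilon> / 2"
    by (auto dest: eventually_happens)
  let ?y = "\<lambda>k. ac_apply u (node n k)"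
  define S where "S = (\<Sum>k\<le>Suc n. ac_norm (hat_ac n k))"
  have S: "0 \<le> S" by (simp add: S_def sum_nonneg ac_norm_nonneg del: sum.atMost_Suc)
  define \<eta> where "\<eta> = \<epsilon> / (2 * (S + 1))"
  have \<eta>: "\<eta> > 0" "\<eta> * S < \<epsilon> / 2" using assms S by (auto simp: \<eta>_def field_simps)
  have "\<exists>r\<in>\<rat>. \<bar>?y k - r\<bar> < \<eta>" for k
    using Rats_dense_in_real[of "?y k" "?y k + \<eta>"] \<eta>(1) by force
  then obtain r where r: "\<And>k. r k \<in> \<rat>" "\<And>k. \<bar>?y k - r k\<bar> < \<eta>" by metis
  define q where "q = restrict r {..Suc n}"
  have "interpolant_ac n ?y - interpolant_ac n q = (\<Sum>k\<le>Suc n. (?y k - r k) *\<^sub>R hat_ac n k)"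
    unfolding interpolant_ac_def sum_subtractf[symmetric]
    by (intro sum.cong) (auto simp: q_def scaleR_left_diff_distrib)
  then have "ac_norm (interpolant_ac n ?y - interpolant_ac n q) \<le> (\<Sum>k\<le>Suc n. \<bar>?y k - r k\<bar> * ac_norm (hat_ac n k))"
    using ac_norm_sum_le[of "\<lambda>k. (?y k - r k) *\<^sub>R hat_ac n k" "{..Suc n}"] by (simp add: ac_norm_scaleR del: sum.atMost_Suc)
  also have "\<dots> \<le> (\<Sum>k\<le>Suc n. \<eta> * ac_norm (hat_ac n k))"
    using r(2) by (intro sum_mono mult_right_mono ac_norm_nonneg) (auto intro: less_imp_le)
  also have "\<dots> < \<epsilon> / 2" using \<eta>(2) by (simp add: S_def sum_distrib_left del: sum.atMost_Suc)
  finally have "ac_norm (interpolant_ac n ?y - interpolant_ac n q) < \<epsilon> / 2" .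
  then have "ac_norm (u - interpolant_ac n q) < \<epsilon>"
    using n ac_norm_triangle[of "u - interpolant_ac n ?y" "interpolant_ac n ?y - interpolant_ac n q"] by simp
  moreover have "q \<in> {..Suc n} \<rightarrow>\<^sub>E \<rat>"
    unfolding q_def restrict_PiE_iff using r(1) by blast
  then have "interpolant_ac n q \<in> rational_interpolants"
    unfolding rational_interpolants_def by blast
  ultimately show ?thesis by (rule that[rotated])
qed

section \<open>Measurability with respect to the norm\<close>

lemma space_norm_borel [simp]: "space (norm_borel N) = UNIV"
  by (simp add: norm_borel_def)

text \<open>Point evaluations are continuous because they are bounded by the norm.\<close>

lemma ac_apply_measurable: "(\<lambda>u. ac_apply u s) \<in> borel_measurable (norm_borel ac_norm)"
proof (rule borel_measurableI)
  interpret Metric_space UNIV "\<lambda>u v. ac_norm (u - v)" by (rule Metric_space_ac)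
  fix S :: "real set" assume S: "open S"
  let ?V = "(\<lambda>u. ac_apply u s) -` S"
  have "openin mtopology ?V"
    unfolding openin_mtopology
  proof (intro conjI allI impI subset_UNIV)
    fix u assume "u \<in> ?V"
    then obtain r where r: "r > 0" "ball (ac_apply u s) r \<subseteq> S" using S open_contains_ball by blast
    have "mball u r \<subseteq> ?V"
    proof
      fix v assume "v \<in> mball u r"
      then have "ac_norm (u - v) < r" by (simp add: mball_def)
      then have "\<bar>ac_apply u s - ac_apply v s\<bar> < r"
        using abs_ac_apply_le[of "u - v" s] by (simp add: minus_ac.rep_eq)
      then show "v \<in> ?V" using r(2) by (auto simp: dist_real_def)
    qed
    then show "\<exists>r>0. mball u r \<subseteq> ?V" using r(1) by blast
  qed
  then show "?V \<inter> space (norm_borel ac_norm) \<in> sets (norm_borel ac_norm)"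
    by (simp add: norm_borel_def sets_measure_of)
qed

text \<open>By separability open sets are countable unions of balls, and the norm is a limit of expressions in
  finitely many values.\<close>

lemma measurable_norm_borelI:
  assumes ev: "\<And>s. (\<lambda>x. ac_apply (f x) s) \<in> borel_measurable M"
  shows "f \<in> M \<rightarrow>\<^sub>M norm_borel ac_norm"
  unfolding norm_borel_def
proof (rule measurable_measure_of)
  interpret Metric_space UNIV "\<lambda>u v. ac_norm (u - v)" by (rule Metric_space_ac)
  have norm_meas: "(\<lambda>x. ac_norm (f x - v)) \<in> borel_measurable M" for v
  proof (rule borel_measurable_LIMSEQ_real)
    show "(\<lambda>n. grid_norm (ac_apply (f x - v)) n) \<longlonglongrightarrow> ac_norm (f x - v)" for x
      by (rule grid_norm_tendsto)
    show "(\<lambda>x. grid_norm (ac_apply (f x - v)) n) \<in> borel_measurable M" for n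
      unfolding grid_norm_def grid_variation_def minus_ac.rep_eq using ev by measurable
  qed
  fix V assume "V \<in> {V. openin mtopology V}"
  then have V: "\<And>u. u \<in> V \<Longrightarrow> \<exists>r>0. mball u r \<subseteq> V" by (auto simp: openin_mtopology)
  define I where "I = {(v, r). v \<in> rational_interpolants \<and> r \<in> \<rat> \<and> {u. ac_norm (u - v) < r} \<subseteq> V}"
  have I: "countable I"
    by (rule countable_subset[of _ "rational_interpolants \<times> \<rat>"])
      (auto simp: I_def intro: countable_SIGMA countable_rational_interpolants countable_rat)
  have V_eq: "V = (\<Union>i\<in>I. {u. ac_norm (u - fst i) < snd i})"
  proof (intro equalityI subsetI)
    fix u assume "u \<in> V"
    then obtain \<rho> where \<rho>: "\<rho> > 0" "mball u \<rho> \<subseteq> V" using V by blast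
    obtain v where v: "v \<in> rational_interpolants" "ac_norm (u - v) < \<rho> / 2"
      using rational_interpolants_dense[of "\<rho> / 2" u] \<rho>(1) by auto
    obtain r where r: "r \<in> \<rat>" "ac_norm (u - v) < r" "r < \<rho> / 2" using Rats_dense_in_real[OF v(2)] by blast
    have "{u'. ac_norm (u' - v) < r} \<subseteq> V"
    proof
      fix u' assume "u' \<in> {u'. ac_norm (u' - v) < r}"
      then have "ac_norm (u - u') < \<rho>"
        using ac_norm_triangle[of "u - v" "v - u'"] ac_norm_minus_commute[of v u'] r by simp
      then show "u' \<in> V" using \<rho>(2) by (auto simp: mball_def)
    qed
    then show "u \<in> (\<Union>i\<in>I. {u. ac_norm (u - fst i) < snd i})"
      using v r by (intro UN_I[of "(v, r)"]) (auto simp: I_def)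
  qed (auto simp: I_def)
  have "f -` V \<inter> space M = (\<Union>i\<in>I. {x \<in> space M. ac_norm (f x - fst i) < snd i})"
    unfolding V_eq by auto
  also have "\<dots> \<in> sets M"
    by (intro sets.countable_UN''[OF I] borel_measurable_less norm_meas borel_measurable_const)
  finally show "f -` V \<inter> space M \<in> sets M" .
qed auto

section \<open>Integrals with respect to signed measures on the delay interval\<close>

lemma space_positive_part [simp]: "space (positive_part M \<nu>) = space M"
  by (simp add: positive_part_def space_measure_of_conv)

lemma sets_positive_part [simp]: "sets (positive_part M \<nu>) = sets M"
  by (simp add: positive_part_def sets_measure_of_conv sets.space_closed sets.sigma_sets_eq)

text \<open>If the supremum in the definition is a measure, its total mass is bounded by the values of \<open>\<nu>\<close>;
  otherwise \<open>measure_of\<close> yields the null measure. The bound holds in both cases.\<close>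

lemma emeasure_positive_part_le:
  assumes "\<And>B. B \<in> sets M \<Longrightarrow> \<nu> B \<le> K"
  shows "emeasure (positive_part M \<nu>) A \<le> ennreal K"
proof -
  have "(SUP B\<in>{B \<in> sets M. B \<subseteq> A}. ennreal (\<nu> B)) \<le> ennreal K"
    by (rule SUP_least) (use assms in \<open>auto intro: ennreal_leI\<close>)
  then show ?thesis
    unfolding positive_part_def by (simp add: emeasure_measure_of_conv)
qed

text \<open>The partition into \<open>B\<close> and its complement already detects \<open>|\<nu> B|\<close>.\<close>

lemma delay_measure_abs_le:
  assumes \<nu>: "\<nu> \<in> delay_measures K" and K: "0 \<le> K" and B: "B \<in> sets delay_space"
  shows "\<bar>\<nu> B\<bar> \<le> K"
proof -
  let ?S = "space delay_space"
  have null: "\<nu> {} = 0" using \<nu> by (simp add: delay_measures_def signed_measures_def)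
  define P where "P = {B, ?S - B} - {{}}"
  have Bs: "B \<subseteq> ?S" using sets.sets_into_space[OF B] .
  have "partition_on ?S P"
    using Bs by (auto simp: P_def partition_on_def disjoint_def)
  moreover have "finite P" "P \<subseteq> sets delay_space"
    unfolding P_def using B sets.compl_sets[OF B] by blast+
  ultimately have "ennreal (\<Sum>A\<in>P. \<bar>\<nu> A\<bar>) \<le> variation_norm delay_space \<nu>"
    unfolding variation_norm_def by (intro SUP_upper) auto
  also have "\<dots> \<le> ennreal K" using \<nu> by (simp add: delay_measures_def)
  finally have "(\<Sum>A\<in>P. \<bar>\<nu> A\<bar>) \<le> K" using K by (simp add: ennreal_le_iff)
  moreover have "\<bar>\<nu> B\<bar> \<le> (\<Sum>A\<in>P. \<bar>\<nu> A\<bar>)"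
  proof (cases "B = {}")
    case False
    then show ?thesis by (intro member_le_sum[of B P "\<lambda>A. \<bar>\<nu> A\<bar>"]) (auto simp: P_def)
  qed (simp add: null sum_nonneg)
  ultimately show ?thesis by linarith
qed

lemma continuous_on_Icc_bounded:
  fixes f :: "real \<Rightarrow> real"
  assumes "continuous_on {a..b} f"
  obtains B where "0 \<le> B" "\<forall>x\<in>{a..b}. \<bar>f x\<bar> \<le> B"
proof -
  have "bounded (f ` {a..b})"
    by (intro compact_imp_bounded compact_continuous_image assms) simp
  then obtain B where B: "\<forall>y\<in>f ` {a..b}. norm y \<le> B" unfolding bounded_iff by blast
  show ?thesis
    by (rule that[of "max 0 B"]) (use B in \<open>auto simp: le_max_iff_disj\<close>)
qed

text \<open>Each of the two parts in the Jordan decomposition has mass at most \<open>K\<close>, whence the factor \<open>2K\<close> for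
  signed integrals below.\<close>

lemma positive_part_integral:
  assumes bnd: "\<And>B. B \<in> sets delay_space \<Longrightarrow> \<nu> B \<le> K" and K: "0 \<le> K"
    and f: "continuous_on {- 1..0} f"
  shows "integrable (positive_part delay_space \<nu>) f"
    and "(\<And>s. s \<in> {- 1..0} \<Longrightarrow> \<bar>f s\<bar> \<le> B) \<Longrightarrow> \<bar>integral\<^sup>L (positive_part delay_space \<nu>) f\<bar> \<le> K * B"
proof -
  let ?P = "positive_part delay_space \<nu>"
  have le: "emeasure ?P (space ?P) \<le> ennreal K"
    by (rule emeasure_positive_part_le[OF bnd])
  interpret finite_measure ?P
    by (rule finite_measureI) (use le_less_trans[OF le ennreal_less_top] in simp)
  have mass: "measure ?P (space ?P) \<le> K"
    using le K unfolding emeasure_eq_measure by (simp add: ennreal_le_iff)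
  have sp: "space ?P = {- 1..0}" by (simp add: space_restrict_space)
  have m: "f \<in> borel_measurable ?P"
    using borel_measurable_continuous_on_restrict[OF f] measurable_cong_sets[OF sets_positive_part refl] by blast
  obtain C where "0 \<le> C" "\<forall>s\<in>{- 1..0}. \<bar>f s\<bar> \<le> C"
    using continuous_on_Icc_bounded[OF f] by blast
  then have C: "0 \<le> C" "\<And>s. - 1 \<le> s \<Longrightarrow> s \<le> 0 \<Longrightarrow> \<bar>f s\<bar> \<le> C" by auto
  show int: "integrable ?P f"
    by (rule integrable_const_bound[OF _ m, of C]) (use C sp in auto)
  show "\<bar>integral\<^sup>L ?P f\<bar> \<le> K * B" if B: "\<And>s. s \<in> {- 1..0} \<Longrightarrow> \<bar>f s\<bar> \<le> B"
  proof -
    have "0 \<le> B" using B[of 0] by simp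
    have "\<bar>integral\<^sup>L ?P f\<bar> \<le> (\<integral>s. \<bar>f s\<bar> \<partial>?P)" using integral_norm_bound[of ?P f] by simp
    also have "\<dots> \<le> (\<integral>s. B \<partial>?P)"
      by (rule integral_mono) (use int B sp in auto)
    also have "\<dots> \<le> K * B" using mass \<open>0 \<le> B\<close> by (simp add: mult_right_mono)
    finally show ?thesis .
  qed
qed

abbreviation delay_integral :: "(real set \<Rightarrow> real) \<Rightarrow> (real \<Rightarrow> real) \<Rightarrow> real" where
  "delay_integral \<equiv> signed_integral delay_space"

lemma delay_measure_parts_le:
  assumes "\<nu> \<in> delay_measures K" "0 \<le> K" "B \<in> sets delay_space"
  shows "\<nu> B \<le> K" "- \<nu> B \<le> K"
  using delay_measure_abs_le[OF assms] by auto

lemma delay_integral_lincomb: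
  assumes \<nu>: "\<nu> \<in> delay_measures K" "0 \<le> K"
    and f: "continuous_on {- 1..0} f" and g: "continuous_on {- 1..0} g"
  shows "delay_integral \<nu> (\<lambda>s. a * f s + b * g s) = a * delay_integral \<nu> f + b * delay_integral \<nu> g"
proof -
  note bnd = delay_measure_parts_le[OF \<nu>]
  have "integral\<^sup>L (positive_part delay_space \<rho>) (\<lambda>s. a * f s + b * g s) =
      a * integral\<^sup>L (positive_part delay_space \<rho>) f + b * integral\<^sup>L (positive_part delay_space \<rho>) g"
    if "\<And>B. B \<in> sets delay_space \<Longrightarrow> \<rho> B \<le> K" for \<rho>
    using positive_part_integral(1)[OF that \<nu>(2) f] positive_part_integral(1)[OF that \<nu>(2) g] by simp
  from this[OF bnd(1)] this[OF bnd(2)] show ?thesis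
    by (simp add: signed_integral_def algebra_simps)
qed

lemma delay_integral_bound:
  assumes \<nu>: "\<nu> \<in> delay_measures K" "0 \<le> K" and f: "continuous_on {- 1..0} f"
    and B: "\<And>s. s \<in> {- 1..0} \<Longrightarrow> \<bar>f s\<bar> \<le> B"
  shows "\<bar>delay_integral \<nu> f\<bar> \<le> 2 * K * B"
proof -
  note bnd = delay_measure_parts_le[OF \<nu>]
  have "\<bar>integral\<^sup>L (positive_part delay_space \<nu>) f\<bar> \<le> K * B"
    "\<bar>integral\<^sup>L (positive_part delay_space (\<lambda>A. - \<nu> A)) f\<bar> \<le> K * B"
    using positive_part_integral(2)[OF bnd(1) \<nu>(2) f B] positive_part_integral(2)[OF bnd(2) \<nu>(2) f B]
    by auto
  then show ?thesis unfolding signed_integral_def by linarith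
qed

lemma delay_integral_cong:
  assumes "\<And>s. s \<in> {- 1..0} \<Longrightarrow> f s = g s"
  shows "delay_integral \<nu> f = delay_integral \<nu> g"
proof -
  have "integral\<^sup>L (positive_part delay_space \<rho>) f = integral\<^sup>L (positive_part delay_space \<rho>) g" for \<rho>
    by (rule Bochner_Integration.integral_cong) (use assms in \<open>auto simp: space_restrict_space\<close>)
  then show ?thesis by (simp add: signed_integral_def)
qed

section \<open>The delay equation\<close>

lemma continuous_on_atLeast_iff: "continuous_on {a..} (z :: real \<Rightarrow> real) \<longleftrightarrow> (\<forall>T. continuous_on {a..T} z)"
proof
  assume R: "\<forall>T. continuous_on {a..T} z"
  show "continuous_on {a..} z"
    unfolding continuous_on_iff
  proof (intro ballI allI impI)
    fix x \<epsilon> :: real assume x: "x \<in> {a..}" "\<epsilon> > 0"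
    have "x \<in> {a..x + 1}" using x by auto
    then obtain \<delta> where \<delta>: "\<delta> > 0" "\<And>y. y \<in> {a..x + 1} \<Longrightarrow> dist y x < \<delta> \<Longrightarrow> dist (z y) (z x) < \<epsilon>"
      using R[rule_format, of "x + 1"] x unfolding continuous_on_iff by blast
    show "\<exists>\<delta>>0. \<forall>y\<in>{a..}. dist y x < \<delta> \<longrightarrow> dist (z y) (z x) < \<epsilon>"
      by (rule exI[of _ "min \<delta> 1"]) (use \<delta> in \<open>auto simp: dist_real_def\<close>)
  qed
qed (auto elim: continuous_on_subset)

lemma exp_series_sums: "(\<lambda>n. S * x ^ n / fact n) sums (S * exp (x::real))"
  using sums_mult[OF exp_converges[of x], of S] by (simp add: field_simps)

text \<open>The coefficient along the orbit of a single \<open>\<omega>\<close>.\<close>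

locale delay_coefficient =
  fixes K :: real and \<nu> :: "real \<Rightarrow> real set \<Rightarrow> real"
  assumes K: "0 < K"
    and coefficient: "0 \<le> \<tau> \<Longrightarrow> \<nu> \<tau> \<in> delay_measures K"
    and coefficient_measurable: "0 < T \<Longrightarrow> continuous_on {- 1..0} f \<Longrightarrow>
      (\<lambda>\<tau>. delay_integral (\<nu> \<tau>) f) \<in> borel_measurable (lebesgue_on {0..T})"
begin

text \<open>The factor by which integration against a coefficient enlarges sup norms.\<close>

definition C :: real where "C = 2 * K"

lemma C_pos: "0 < C" using K by (simp add: C_def)

definition delay_term :: "(real \<Rightarrow> real) \<Rightarrow> real \<Rightarrow> real" where
  "delay_term y \<tau> = delay_integral (\<nu> \<tau>) (\<lambda>r. y (\<tau> + r))"

lemma continuous_on_delayed: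
  fixes y :: "real \<Rightarrow> real"
  assumes "continuous_on {- 1..T} y" "0 \<le> \<tau>" "\<tau> \<le> T"
  shows "continuous_on {- 1..0} (\<lambda>r. y (\<tau> + r))"
proof (rule continuous_on_compose2[OF assms(1)])
  show "continuous_on {- 1..0} (\<lambda>r. \<tau> + r)" by (rule continuous_on_add[OF continuous_on_const continuous_on_id])
  show "(\<lambda>r. \<tau> + r) ` {- 1..0} \<subseteq> {- 1..T}" using assms(2,3) by auto
qed

lemma delay_term_lincomb:
  assumes "continuous_on {- 1..T} y" "continuous_on {- 1..T} z" "0 \<le> \<tau>" "\<tau> \<le> T"
  shows "delay_term (\<lambda>x. a * y x + b * z x) \<tau> = a * delay_term y \<tau> + b * delay_term z \<tau>"
  unfolding delay_term_def
  by (rule delay_integral_lincomb[OF coefficient]) (use assms K continuous_on_delayed in auto)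

lemma delay_term_bound:
  assumes "continuous_on {- 1..T} y" "0 \<le> \<tau>" "\<tau> \<le> T" "\<And>x. - 1 \<le> x \<Longrightarrow> x \<le> \<tau> \<Longrightarrow> \<bar>y x\<bar> \<le> B"
  shows "\<bar>delay_term y \<tau>\<bar> \<le> C * B"
  unfolding delay_term_def C_def
  by (rule delay_integral_bound[OF coefficient]) (use assms K continuous_on_delayed in auto)

text \<open>The delayed function is frozen on short time intervals, where the hypothesis on the coefficient
  gives measurability; uniform continuity removes the freezing.\<close>

lemma delay_term_measurable:
  assumes T: "0 < T" and y: "continuous_on {- 1..T} y"
  shows "delay_term y \<in> borel_measurable (lebesgue_on {0..T})"
proof (rule borel_measurable_LIMSEQ_real)
  \<comment> \<open>\<open>g n \<tau>\<close> rounds \<open>\<tau>\<close> down to a multiple of \<open>1/(n+1)\<close>. In \<open>F\<close> the value 0 is a default for integers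
    \<open>i\<close> that do not arise from times in \<open>[0,T]\<close>.\<close>
  define g where "g n \<tau> = real_of_int \<lfloor>\<tau> * real (Suc n)\<rfloor> / real (Suc n)" for n \<tau>
  define F where "F n i \<tau> = (if real_of_int i / real (Suc n) \<in> {0..T}
    then delay_integral (\<nu> \<tau>) (\<lambda>r. y (real_of_int i / real (Suc n) + r)) else 0)" for n i \<tau>
  show "(\<lambda>\<tau>. F n \<lfloor>\<tau> * real (Suc n)\<rfloor> \<tau>) \<in> borel_measurable (lebesgue_on {0..T})" for n
  proof (rule measurable_compose_countable)
    show "F n i \<in> borel_measurable (lebesgue_on {0..T})" for i
    proof (cases "real_of_int i / real (Suc n) \<in> {0..T}")
      case True
      have "F n i = (\<lambda>\<tau>. delay_integral (\<nu> \<tau>) (\<lambda>r. y (real_of_int i / real (Suc n) + r)))"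
        by (rule ext) (simp only: F_def True if_True)
      moreover have "continuous_on {- 1..0} (\<lambda>r. y (real_of_int i / real (Suc n) + r))"
        by (rule continuous_on_delayed[OF y]) (use True in \<open>simp_all only: atLeastAtMost_iff\<close>)
      ultimately show ?thesis using coefficient_measurable[OF T] by metis
    next
      case False
      have "F n i = (\<lambda>\<tau>. 0)" by (rule ext) (simp only: F_def False if_False)
      then show ?thesis by simp
    qed
    have "(\<lambda>\<tau>::real. \<lfloor>\<tau> * real (Suc n)\<rfloor>) \<in> measurable borel (count_space UNIV)" by measurable
    then have "(\<lambda>\<tau>::real. \<lfloor>\<tau> * real (Suc n)\<rfloor>) \<in> measurable lebesgue (count_space UNIV)"
      by (intro measurable_completion) simp
    then show "(\<lambda>\<tau>::real. \<lfloor>\<tau> * real (Suc n)\<rfloor>) \<in> measurable (lebesgue_on {0..T}) (count_space UNIV)"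
      by (rule measurable_restrict_space1)
  qed
  fix \<tau> assume "\<tau> \<in> space (lebesgue_on {0..T})"
  then have \<tau>: "0 \<le> \<tau>" "\<tau> \<le> T" by (auto simp: space_restrict_space)
  have g: "0 \<le> g n \<tau>" "g n \<tau> \<le> \<tau>" "\<tau> - g n \<tau> < 1 / real (Suc n)" for n
  proof -
    have *: "real_of_int \<lfloor>\<tau> * real (Suc n)\<rfloor> \<le> \<tau> * real (Suc n)"
      "\<tau> * real (Suc n) < real_of_int \<lfloor>\<tau> * real (Suc n)\<rfloor> + 1"
      by linarith+
    show "0 \<le> g n \<tau>" using \<tau> by (simp add: g_def)
    show "g n \<tau> \<le> \<tau>"
      unfolding g_def using *(1) by (simp only: pos_divide_le_eq of_nat_0_less_iff zero_less_Suc)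
    have "\<tau> - g n \<tau> = (\<tau> * real (Suc n) - real_of_int \<lfloor>\<tau> * real (Suc n)\<rfloor>) / real (Suc n)"
      by (simp add: g_def diff_divide_distrib del: of_nat_Suc)
    also have "\<dots> < 1 / real (Suc n)"
      using *(2) by (intro divide_strict_right_mono) linarith+
    finally show "\<tau> - g n \<tau> < 1 / real (Suc n)" .
  qed
  have F: "F n \<lfloor>\<tau> * real (Suc n)\<rfloor> \<tau> = delay_integral (\<nu> \<tau>) (\<lambda>r. y (g n \<tau> + r))" for n
    using g[of n] \<tau> unfolding F_def g_def[symmetric] by auto
  show "(\<lambda>n. F n \<lfloor>\<tau> * real (Suc n)\<rfloor> \<tau>) \<longlonglongrightarrow> delay_term y \<tau>"
    unfolding F tendsto_iff
  proof (intro allI impI)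
    fix \<epsilon> :: real assume \<epsilon>: "\<epsilon> > 0"
    have "uniformly_continuous_on {- 1..T} y" using y by (intro compact_uniformly_continuous) auto
    then obtain \<delta> where \<delta>: "\<delta> > 0" "\<And>x x'. x \<in> {- 1..T} \<Longrightarrow> x' \<in> {- 1..T} \<Longrightarrow> dist x' x < \<delta> \<Longrightarrow>
        dist (y x') (y x) < \<epsilon> / (2 * C)"
      unfolding uniformly_continuous_on_def using \<epsilon> C_pos
      by (metis divide_pos_pos mult_pos_pos zero_less_numeral)
    have "\<forall>\<^sub>F n in sequentially. 1 / real (Suc n) < \<delta>"
      by (rule eventually_mesh_less[OF \<delta>(1)])
    then show "\<forall>\<^sub>F n in sequentially. dist (delay_integral (\<nu> \<tau>) (\<lambda>r. y (g n \<tau> + r))) (delay_term y \<tau>) < \<epsilon>"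
    proof eventually_elim
      case (elim n)
      have c: "continuous_on {- 1..0} (\<lambda>r. y (g n \<tau> + r))" "continuous_on {- 1..0} (\<lambda>r. y (\<tau> + r))"
        using g[of n] \<tau> by (auto intro!: continuous_on_delayed[OF y])
      have "delay_integral (\<nu> \<tau>) (\<lambda>r. y (g n \<tau> + r)) - delay_term y \<tau> =
          delay_integral (\<nu> \<tau>) (\<lambda>r. 1 * y (g n \<tau> + r) + (- 1) * y (\<tau> + r))"
        unfolding delay_term_def using delay_integral_lincomb[OF coefficient[OF \<tau>(1)] _ c, of 1 "- 1"] K by simp
      also have "\<bar>\<dots>\<bar> \<le> 2 * K * (\<epsilon> / (2 * C))"
      proof (rule delay_integral_bound[OF coefficient[OF \<tau>(1)]])
        show "continuous_on {- 1..0} (\<lambda>r. 1 * y (g n \<tau> + r) + - 1 * y (\<tau> + r))"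
          using c by (intro continuous_intros)
        fix s :: real assume "s \<in> {- 1..0}"
        then have "dist (y (g n \<tau> + s)) (y (\<tau> + s)) < \<epsilon> / (2 * C)"
          using g[of n] \<tau> elim by (intro \<delta>(2)) (auto simp: dist_real_def)
        then show "\<bar>1 * y (g n \<tau> + s) + - 1 * y (\<tau> + s)\<bar> \<le> \<epsilon> / (2 * C)" by (simp add: dist_real_def)
      qed (use K in simp)
      also have "\<dots> < \<epsilon>" using K \<epsilon> by (simp add: C_def)
      finally show ?case by (simp add: dist_real_def)
    qed
  qed
qed

lemma path_functional_delay_term: "path_functional y t \<nu> = (LINT \<tau>:{0..t}|lebesgue. delay_term y \<tau>)"
  by (simp add: path_functional_def delay_term_def)

lemma delay_term_integrable:
  assumes y: "continuous_on {- 1..T} y"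
  shows "set_integrable lebesgue {0..T} (delay_term y)"
proof (cases "0 < T")
  case True
  obtain B where "0 \<le> B" "\<forall>x\<in>{- 1..T}. \<bar>y x\<bar> \<le> B"
    using continuous_on_Icc_bounded[OF y] by blast
  then have B: "0 \<le> B" "\<And>x. - 1 \<le> x \<Longrightarrow> x \<le> T \<Longrightarrow> \<bar>y x\<bar> \<le> B" by auto
  show ?thesis
    by (rule measurable_bounded_by_integrable_imp_absolutely_integrable[OF delay_term_measurable[OF True y],
          where g = "\<lambda>_. C * B"])
      (use B in \<open>auto intro!: delay_term_bound[OF y] integrable_const_ivl\<close>)
next
  case False
  have "{0..T} \<subseteq> {0}" using False by auto
  then show ?thesis
    by (intro absolutely_integrable_negligible negligible_subset[OF negligible_sing])
qed

lemma delay_term_set_integrable: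
  assumes y: "continuous_on {- 1..T} y" and "0 \<le> s" "t \<le> T"
  shows "set_integrable lebesgue {s..t} (delay_term y)"
  by (rule set_integrable_subset[OF delay_term_integrable[OF y]]) (use assms in auto)

lemma path_functional_has_integral:
  assumes y: "continuous_on {- 1..T} y" and t: "t \<le> T"
  shows "(delay_term y has_integral path_functional y t \<nu>) {0..t}"
  unfolding path_functional_delay_term
  by (rule has_integral_set_lebesgue[OF delay_term_set_integrable[OF y order_refl t]])

lemma path_functional_0 [simp]: "path_functional y 0 \<nu> = 0"
proof -
  have "AE x in lebesgue. indicator {0..0} x *\<^sub>R delay_term y x = 0"
    by (rule AE_I'[of "{0}"]) (auto simp: null_sets_def indicator_def split: if_splits)
  then show ?thesis
    unfolding path_functional_delay_term set_lebesgue_integral_def by (rule integral_eq_zero_AE)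
qed

lemma path_functional_lincomb:
  assumes y: "continuous_on {- 1..T} y" and z: "continuous_on {- 1..T} z" and t: "t \<le> T"
  shows "path_functional (\<lambda>x. a * y x + b * z x) t \<nu> = a * path_functional y t \<nu> + b * path_functional z t \<nu>"
proof -
  have c: "continuous_on {- 1..T} (\<lambda>x. a * y x + b * z x)" using y z by (intro continuous_intros)
  have "((\<lambda>\<tau>. a * delay_term y \<tau> + b * delay_term z \<tau>) has_integral
      a * path_functional y t \<nu> + b * path_functional z t \<nu>) {0..t}"
    using path_functional_has_integral[OF y t] path_functional_has_integral[OF z t]
    by (intro has_integral_add has_integral_mult_right)
  then have "(delay_term (\<lambda>x. a * y x + b * z x) has_integral
      a * path_functional y t \<nu> + b * path_functional z t \<nu>) {0..t}"
    by (rule has_integral_eq[rotated]) (use t in \<open>auto simp: delay_term_lincomb[OF y z]\<close>)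
  then show ?thesis using path_functional_has_integral[OF c t] has_integral_unique by blast
qed

lemma path_functional_sum:
  fixes f :: "nat \<Rightarrow> real \<Rightarrow> real"
  assumes f: "\<And>k. continuous_on {- 1..T} (f k)" and t: "t \<le> T"
  shows "path_functional (\<lambda>x. \<Sum>k<N. a k * f k x) t \<nu> = (\<Sum>k<N. a k * path_functional (f k) t \<nu>)"
proof (induction N)
  case 0
  show ?case using path_functional_lincomb[OF f f t, of 0 0 0 0] by simp
next
  case (Suc N)
  have "continuous_on {- 1..T} (\<lambda>x. \<Sum>k<N. a k * f k x)" by (intro continuous_intros f)
  then show ?case
    using path_functional_lincomb[OF _ f t, of _ 1 "a N" N] Suc by simp
qed

lemma path_functional_cong:
  assumes "\<And>x. - 1 \<le> x \<Longrightarrow> x \<le> t \<Longrightarrow> y x = z x"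
  shows "path_functional y t \<nu> = path_functional z t \<nu>"
proof -
  have "delay_term y \<tau> = delay_term z \<tau>" if "\<tau> \<in> {0..t}" for \<tau>
    unfolding delay_term_def by (rule delay_integral_cong) (use assms that in auto)
  then show ?thesis unfolding path_functional_delay_term
    by (intro set_lebesgue_integral_cong) auto
qed

lemma path_functional_increment_has_integral:
  assumes y: "continuous_on {- 1..T} y" and st: "0 \<le> s" "s \<le> t" "t \<le> T"
  shows "(delay_term y has_integral path_functional y t \<nu> - path_functional y s \<nu>) {s..t}"
proof -
  have i: "delay_term y integrable_on {0..t}"
    using path_functional_has_integral[OF y st(3)] by (auto simp: integrable_on_def)
  have "integral {0..s} (delay_term y) + integral {s..t} (delay_term y) = integral {0..t} (delay_term y)"
    by (rule Henstock_Kurzweil_Integration.integral_combine[OF st(1,2) i])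
  then have "path_functional y t \<nu> - path_functional y s \<nu> = integral {s..t} (delay_term y)"
    using integral_unique[OF path_functional_has_integral[OF y st(3)]]
      integral_unique[OF path_functional_has_integral[OF y, of s]] st by simp
  then show ?thesis
    using set_lebesgue_integral_eq_integral(1)[OF delay_term_set_integrable[OF y st(1,3)]]
    by (simp add: integrable_integral)
qed

lemma path_functional_lipschitz:
  assumes y: "continuous_on {- 1..T} y" and B: "\<And>x. - 1 \<le> x \<Longrightarrow> x \<le> T \<Longrightarrow> \<bar>y x\<bar> \<le> B"
    and st: "0 \<le> s" "s \<le> t" "t \<le> T"
  shows "\<bar>path_functional y t \<nu> - path_functional y s \<nu>\<bar> \<le> C * B * (t - s)"
proof -
  have "\<bar>delay_term y \<tau>\<bar> \<le> C * B" if "\<tau> \<in> {s..t}" for \<tau>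
    by (rule delay_term_bound[OF y]) (use that st B in auto)
  moreover have "0 \<le> C * B" using B[of 0] st C_pos by simp
  ultimately show ?thesis
    using has_integral_bound_real[OF _ finite.emptyI path_functional_increment_has_integral[OF y st], of "C * B"] st
    by simp
qed

lemma path_functional_bound:
  assumes y: "continuous_on {- 1..T} y" and B: "\<And>x. - 1 \<le> x \<Longrightarrow> x \<le> T \<Longrightarrow> \<bar>y x\<bar> \<le> B"
    and t: "0 \<le> t" "t \<le> T"
  shows "\<bar>path_functional y t \<nu>\<bar> \<le> C * B * t"
  using path_functional_lipschitz[OF y B order_refl t] by simp

lemma path_functional_uniform_limit:
  assumes f: "\<And>n :: nat. continuous_on {- 1..t} (f n)" and y: "continuous_on {- 1..t} y"
    and lim: "uniform_limit {- 1..t} f y sequentially" and t: "0 \<le> t"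
  shows "(\<lambda>n. path_functional (f n) t \<nu>) \<longlonglongrightarrow> path_functional y t \<nu>"
  unfolding tendsto_iff
proof (intro allI impI)
  fix \<epsilon> :: real assume \<epsilon>: "\<epsilon> > 0"
  define \<eta> where "\<eta> = \<epsilon> / (C * (t + 1))"
  have pos: "0 < C * (t + 1)" using t C_pos by simp
  then have "\<eta> > 0" using \<epsilon> by (simp add: \<eta>_def)
  then have "C * \<eta> * t < C * \<eta> * t + C * \<eta>" using C_pos by simp
  also have "\<dots> = \<eta> * (C * (t + 1))" by (simp add: algebra_simps)
  also have "\<dots> = \<epsilon>"
    unfolding \<eta>_def by (rule nonzero_eq_divide_eq[THEN iffD1, OF less_imp_neq[OF pos, THEN not_sym] refl])
  finally have \<eta>: "C * \<eta> * t < \<epsilon>" .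
  have "\<forall>\<^sub>F n in sequentially. \<forall>x\<in>{- 1..t}. dist (f n x) (y x) < \<eta>"
    using lim \<open>\<eta> > 0\<close> by (auto simp: uniform_limit_iff)
  then show "\<forall>\<^sub>F n in sequentially. dist (path_functional (f n) t \<nu>) (path_functional y t \<nu>) < \<epsilon>"
  proof eventually_elim
    case (elim n)
    have "path_functional (f n) t \<nu> - path_functional y t \<nu> =
        path_functional (\<lambda>x. 1 * f n x + (- 1) * y x) t \<nu>"
      by (subst path_functional_lincomb[OF f y order_refl]) simp
    also have "\<bar>\<dots>\<bar> \<le> C * \<eta> * t"
    proof (rule path_functional_bound[OF _ _ t order_refl])
      show "continuous_on {- 1..t} (\<lambda>x. 1 * f n x + - 1 * y x)"
        by (intro continuous_intros f y)
      show "\<bar>1 * f n x + - 1 * y x\<bar> \<le> \<eta>" if "- 1 \<le> x" "x \<le> t" for x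
        using elim that by (force simp: dist_real_def)
    qed
    finally show ?case using \<eta> by (simp add: dist_real_def)
  qed
qed

text \<open>Each application of the integral operator trades the bound \<open>(C t)^n / n!\<close> for the next term of
  the exponential series.\<close>

lemma path_functional_exp_bound:
  assumes y: "continuous_on {- 1..T} y" and S: "0 \<le> S"
    and B: "\<And>x. - 1 \<le> x \<Longrightarrow> x \<le> T \<Longrightarrow> \<bar>y x\<bar> \<le> S * (C * max x 0) ^ n / fact n"
    and t: "0 \<le> t" "t \<le> T"
  shows "\<bar>path_functional y t \<nu>\<bar> \<le> S * (C * t) ^ Suc n / fact (Suc n)"
proof -
  define F where "F \<tau> = S * (C * \<tau>) ^ Suc n / fact (Suc n)" for \<tau>
  have "((\<lambda>\<tau>. C * (S * (C * \<tau>) ^ n / fact n)) has_integral F t - F 0) {0..t}"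
  proof (rule fundamental_theorem_of_calculus[OF t(1)])
    fix \<tau>
    have "(F has_real_derivative S * (real (Suc n) * (C * \<tau>) ^ n * C) / fact (Suc n)) (at \<tau> within {0..t})"
      unfolding F_def by (rule derivative_eq_intros refl | simp)+
    moreover have "S * (real (Suc n) * (C * \<tau>) ^ n * C) / fact (Suc n) = C * (S * (C * \<tau>) ^ n / fact n)"
      by (simp add: field_simps del: of_nat_Suc)
    ultimately have "(F has_real_derivative C * (S * (C * \<tau>) ^ n / fact n)) (at \<tau> within {0..t})"
      by (rule DERIV_cong)
    then show "(F has_vector_derivative C * (S * (C * \<tau>) ^ n / fact n)) (at \<tau> within {0..t})"
      by (simp only: has_real_derivative_iff_has_vector_derivative)
  qed
  moreover have "\<bar>delay_term y \<tau>\<bar> \<le> C * (S * (C * \<tau>) ^ n / fact n)" if \<tau>: "\<tau> \<in> {0..t}" for \<tau>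
  proof (rule delay_term_bound[OF y])
    fix x assume x: "- 1 \<le> x" "x \<le> \<tau>"
    have "S * (C * max x 0) ^ n / fact n \<le> S * (C * \<tau>) ^ n / fact n"
      using x \<tau> S C_pos by (intro divide_right_mono mult_left_mono power_mono) auto
    then show "\<bar>y x\<bar> \<le> S * (C * \<tau>) ^ n / fact n" using B[of x] x \<tau> t by auto
  qed (use \<tau> t in auto)
  ultimately have "norm (path_functional y t \<nu>) \<le> F t - F 0"
    using integral_norm_bound_integral[of "delay_term y" "{0..t}"] path_functional_has_integral[OF y t(2)]
    by (metis (no_types, lifting) has_integral_iff real_norm_def)
  then show ?thesis by (simp add: F_def)
qed

lemma path_functional_continuous:
  assumes y: "continuous_on {- 1..T} y"
  shows "continuous_on {- 1..T} (\<lambda>t. path_functional y (max t 0) \<nu>)"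
proof -
  obtain B where "0 \<le> B" "\<forall>x\<in>{- 1..T}. \<bar>y x\<bar> \<le> B"
    using continuous_on_Icc_bounded[OF y] by blast
  then have B: "0 \<le> B" "\<And>x. - 1 \<le> x \<Longrightarrow> x \<le> T \<Longrightarrow> \<bar>y x\<bar> \<le> B" by auto
  have lip: "\<bar>path_functional y (max t 0) \<nu> - path_functional y (max s 0) \<nu>\<bar> \<le> C * B * (t - s)"
    if "s \<le> t" "t \<le> T" for s t
  proof (cases "T < 0")
    case True
    then show ?thesis using that B(1) C_pos by simp
  next
    case False
    have "\<bar>path_functional y (max t 0) \<nu> - path_functional y (max s 0) \<nu>\<bar> \<le> C * B * (max t 0 - max s 0)"
      using that False by (intro path_functional_lipschitz[OF y B(2)]) auto
    also have "\<dots> \<le> C * B * (t - s)"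
      using that B(1) C_pos by (intro mult_left_mono) auto
    finally show ?thesis .
  qed
  have "(C * B)-lipschitz_on {- 1..T} (\<lambda>t. path_functional y (max t 0) \<nu>)"
  proof (rule lipschitz_onI)
    fix s t assume "s \<in> {- 1..T}" "t \<in> {- 1..T}"
    then show "dist (path_functional y (max s 0) \<nu>) (path_functional y (max t 0) \<nu>) \<le> C * B * dist s t"
      using lip[of s t] lip[of t s] by (cases "s \<le> t") (auto simp: dist_real_def abs_minus_commute)
  qed (use B(1) C_pos in simp)
  then show ?thesis by (rule lipschitz_on_continuous_on)
qed

text \<open>The terms of the Neumann series: the initial function, continued by its value at 0, and its images
  under the powers of the integral operator, which vanish for negative times.\<close>

primrec picard :: "(real \<Rightarrow> real) \<Rightarrow> nat \<Rightarrow> real \<Rightarrow> real" where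
  "picard u 0 = (\<lambda>t. u (min t 0))"
| "picard u (Suc n) = (\<lambda>t. path_functional (picard u n) (max t 0) \<nu>)"

lemma picard_continuous:
  assumes "continuous_on {- 1..0} u"
  shows "continuous_on {- 1..T} (picard u n)"
proof (induction n)
  case 0
  show ?case
    unfolding picard.simps by (rule continuous_on_compose2[OF assms]) (auto intro!: continuous_intros)
qed (simp add: path_functional_continuous)

lemma picard_bound:
  assumes u: "continuous_on {- 1..0} u" and S: "\<And>x. - 1 \<le> x \<Longrightarrow> x \<le> 0 \<Longrightarrow> \<bar>u x\<bar> \<le> S" and "- 1 \<le> t"
  shows "\<bar>picard u n t\<bar> \<le> S * (C * max t 0) ^ n / fact n"
  using assms(3)
proof (induction n arbitrary: t)
  case 0
  then show ?case using S by simp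
next
  case (Suc n)
  have "0 \<le> S" using S[of 0] by simp
  then show ?case
    unfolding picard.simps
    by (rule path_functional_exp_bound[OF picard_continuous[OF u] _ Suc.IH, where T = "max t 0"]) auto
qed

definition solution :: "(real \<Rightarrow> real) \<Rightarrow> real \<Rightarrow> real" where
  "solution u t = (\<Sum>n. picard u n t)"

context
  fixes u :: "real \<Rightarrow> real" and S :: real
  assumes u: "continuous_on {- 1..0} u" and S: "\<And>x. - 1 \<le> x \<Longrightarrow> x \<le> 0 \<Longrightarrow> \<bar>u x\<bar> \<le> S"
begin

lemma bound_nonneg: "0 \<le> S" using S[of 0] by simp

lemma uniform_limit_solution:
  "uniform_limit {- 1..T} (\<lambda>N x. \<Sum>n<N. picard u n x) (solution u) sequentially"
  unfolding solution_def[abs_def]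
proof (rule Weierstrass_m_test)
  show "summable (\<lambda>n. S * (C * max T 0) ^ n / fact n)" by (rule sums_summable[OF exp_series_sums])
  show "norm (picard u n x) \<le> S * (C * max T 0) ^ n / fact n" if "x \<in> {- 1..T}" for n x
  proof -
    have "S * (C * max x 0) ^ n / fact n \<le> S * (C * max T 0) ^ n / fact n"
      using that bound_nonneg C_pos by (intro divide_right_mono mult_left_mono power_mono) auto
    then show ?thesis using picard_bound[OF u S, of x n] that by auto
  qed
qed

lemma solution_continuous: "continuous_on {- 1..T} (solution u)"
  by (rule uniform_limit_theorem[OF _ uniform_limit_solution])
    (auto intro!: always_eventually continuous_on_sum picard_continuous[OF u])

lemma solution_bound:
  assumes "- 1 \<le> t"
  shows "\<bar>solution u t\<bar> \<le> S * exp (C * max t 0)"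
proof -
  have s: "summable (\<lambda>n. \<bar>picard u n t\<bar>)"
    by (rule summable_comparison_test'[where N = 0, OF sums_summable[OF exp_series_sums[of S "C * max t 0"]]])
      (use picard_bound[OF u S assms] in simp)
  have "\<bar>solution u t\<bar> \<le> (\<Sum>n. \<bar>picard u n t\<bar>)"
    unfolding solution_def by (rule summable_rabs[OF s])
  also have "\<dots> \<le> (\<Sum>n. S * (C * max t 0) ^ n / fact n)"
    by (rule suminf_le[OF picard_bound[OF u S assms] s sums_summable[OF exp_series_sums]])
  also have "\<dots> = S * exp (C * max t 0)" using exp_series_sums sums_unique by metis
  finally show ?thesis .
qed

lemma picard_sum_continuous: "continuous_on {- 1..T} (\<lambda>x. \<Sum>n<N. picard u n x)"
  by (intro continuous_on_sum picard_continuous[OF u])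

lemma path_functional_picard_sums:
  assumes t: "0 \<le> t"
  shows "(\<lambda>n. path_functional (picard u n) t \<nu>) sums path_functional (solution u) t \<nu>"
  unfolding sums_def
  using path_functional_uniform_limit[OF picard_sum_continuous solution_continuous uniform_limit_solution t]
    path_functional_sum[OF picard_continuous[OF u] order_refl, of "\<lambda>_. 1"] by simp

lemma solution_initial: "- 1 \<le> t \<Longrightarrow> t \<le> 0 \<Longrightarrow> solution u t = u t"
proof -
  assume t: "- 1 \<le> t" "t \<le> 0"
  have "picard u (Suc n) t = 0" for n using t by (simp add: max_absorb2)
  then have "(\<lambda>n. picard u n t) sums (\<Sum>n<1. picard u n t)"
    by (intro sums_finite) (auto simp del: picard.simps(2) dest!: gr0_implies_Suc)
  then show ?thesis using t sums_unique by (fastforce simp: solution_def)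
qed

lemma solution_integral_equation:
  assumes t: "0 \<le> t"
  shows "solution u t = u 0 + path_functional (solution u) t \<nu>"
proof -
  have "(\<lambda>n. picard u (Suc n) t) sums path_functional (solution u) t \<nu>"
    using path_functional_picard_sums[OF t] t by (simp add: max_absorb1)
  then have "(\<lambda>n. picard u n t) sums (path_functional (solution u) t \<nu> + picard u 0 t)"
    by (rule sums_Suc)
  then show ?thesis using t sums_unique by (fastforce simp: solution_def min_absorb2)
qed

end

lemma delay_solution_iff:
  "delay_solution \<nu> u z \<longleftrightarrow> (\<forall>T. continuous_on {- 1..T} z) \<and> (\<forall>s\<in>{- 1..0}. z s = u s) \<and>
     (\<forall>t\<ge>0. z t = u 0 + path_functional z t \<nu>)"
  by (simp add: delay_solution_def path_functional_def continuous_on_atLeast_iff)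

text \<open>The difference of two solutions is a fixed point of the integral operator, so it obeys the bounds
  \<open>S (C t)\<^sup>n/n!\<close> for every \<open>n\<close>.\<close>

lemma delay_solution_unique:
  assumes z1: "delay_solution \<nu> u z1" and z2: "delay_solution \<nu> u z2" and t: "- 1 \<le> t"
  shows "z1 t = z2 t"
proof -
  define w where "w x = 1 * z1 x + (- 1) * z2 x" for x
  define T where "T = max t 0"
  have c: "continuous_on {- 1..T} z1" "continuous_on {- 1..T} z2"
    using z1 z2 by (auto simp: delay_solution_iff)
  then have w: "continuous_on {- 1..T} w" unfolding w_def[abs_def] by (intro continuous_intros)
  obtain S where "0 \<le> S" "\<forall>x\<in>{- 1..T}. \<bar>w x\<bar> \<le> S"
    using continuous_on_Icc_bounded[OF w] by blast
  then have S: "0 \<le> S" "\<And>x. - 1 \<le> x \<Longrightarrow> x \<le> T \<Longrightarrow> \<bar>w x\<bar> \<le> S" by auto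
  have w0: "w x = 0" if "- 1 \<le> x" "x \<le> 0" for x
    using z1 z2 that by (simp add: delay_solution_iff w_def)
  have wint: "w x = path_functional w x \<nu>" if x: "0 \<le> x" "x \<le> T" for x
  proof -
    have "path_functional w x \<nu> = 1 * path_functional z1 x \<nu> + (- 1) * path_functional z2 x \<nu>"
      unfolding w_def[abs_def] by (rule path_functional_lincomb[OF c x(2)])
    moreover have "z1 x = u 0 + path_functional z1 x \<nu>" "z2 x = u 0 + path_functional z2 x \<nu>"
      using z1 z2 x by (auto simp: delay_solution_iff)
    ultimately show ?thesis by (simp add: w_def)
  qed
  have bound: "\<bar>w x\<bar> \<le> S * (C * max x 0) ^ n / fact n" if "- 1 \<le> x" "x \<le> T" for n x
    using that
  proof (induction n arbitrary: x)
    case 0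
    then show ?case using S by simp
  next
    case (Suc n)
    show ?case
    proof (cases "x \<le> 0")
      case True
      then show ?thesis using w0 Suc.prems by simp
    next
      case False
      then show ?thesis
        using path_functional_exp_bound[OF w S(1) Suc.IH, of x] wint[of x] Suc.prems by simp
    qed
  qed
  have "(\<lambda>n. S * (C * max t 0) ^ n / fact n) \<longlonglongrightarrow> 0"
    by (rule summable_LIMSEQ_zero[OF sums_summable[OF exp_series_sums]])
  then have "\<bar>w t\<bar> \<le> 0"
    by (rule LIMSEQ_le_const) (use bound[of t] t in \<open>auto simp: T_def\<close>)
  then show ?thesis by (simp add: w_def)
qed

lemma delay_solution_solution:
  assumes u: "continuous_on {- 1..0} u"
  shows "delay_solution \<nu> u (solution u)"
proof -
  obtain S where "0 \<le> S" "\<forall>x\<in>{- 1..0}. \<bar>u x\<bar> \<le> S"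
    using continuous_on_Icc_bounded[OF u] by blast
  then have S: "\<And>x. - 1 \<le> x \<Longrightarrow> x \<le> 0 \<Longrightarrow> \<bar>u x\<bar> \<le> S" by auto
  show ?thesis
    unfolding delay_solution_iff
    using solution_continuous[OF u S] solution_initial[OF u S] solution_integral_equation[OF u S] by simp
qed

lemma the_delay_solution_eq:
  assumes z: "delay_solution \<nu> u z" and t: "- 1 \<le> t"
  shows "the_delay_solution \<nu> u t = z t"
proof -
  have cong: "path_functional (restrict z {- 1..}) t \<nu> = path_functional z t \<nu>" for t
    by (rule path_functional_cong) auto
  have "delay_solution \<nu> u (restrict z {- 1..})"
    using z unfolding delay_solution_iff cong by (auto cong: continuous_on_cong_simp)
  then have "the_delay_solution \<nu> u = restrict z {- 1..}"
    unfolding the_delay_solution_def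
    by (intro the_equality) (auto intro!: extensionalityI[of _ "{- 1..}"] dest: delay_solution_unique[OF z])
  then show ?thesis using t by simp
qed

lemma the_delay_solution_solution:
  assumes "continuous_on {- 1..0} u" "- 1 \<le> t"
  shows "the_delay_solution \<nu> u t = solution u t"
  by (rule the_delay_solution_eq[OF delay_solution_solution[OF assms(1)] assms(2)])

lemma delay_solution_lincomb:
  assumes y: "delay_solution \<nu> u y" and z: "delay_solution \<nu> v z"
  shows "delay_solution \<nu> (\<lambda>x. a * u x + b * v x) (\<lambda>x. a * y x + b * z x)"
  unfolding delay_solution_iff
proof (intro conjI allI ballI impI)
  note y' = y[unfolded delay_solution_iff] and z' = z[unfolded delay_solution_iff]
  show "continuous_on {- 1..T} (\<lambda>x. a * y x + b * z x)" for T
    using y' z' by (intro continuous_intros) auto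
  show "a * y s + b * z s = a * u s + b * v s" if "s \<in> {- 1..0}" for s
    using y' z' that by simp
  show "a * y t + b * z t = a * u 0 + b * v 0 + path_functional (\<lambda>x. a * y x + b * z x) t \<nu>" if t: "0 \<le> t" for t
  proof -
    have "path_functional (\<lambda>x. a * y x + b * z x) t \<nu> = a * path_functional y t \<nu> + b * path_functional z t \<nu>"
      using y' z' by (intro path_functional_lincomb[OF _ _ order_refl]) auto
    moreover have "y t = u 0 + path_functional y t \<nu>" "z t = v 0 + path_functional z t \<nu>"
      using y' z' t by auto
    ultimately show ?thesis by (simp add: algebra_simps)
  qed
qed

text \<open>The integral from \<open>s\<close> to \<open>s + t\<close> is translated to start at 0.\<close>

lemma delay_solution_shift:
  assumes shifted: "delay_coefficient K (\<lambda>\<tau>. \<nu> (\<tau> + s))" and s: "0 \<le> s" and z: "delay_solution \<nu> u z"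
  shows "delay_solution (\<lambda>\<tau>. \<nu> (\<tau> + s)) (\<lambda>r. z (s + r)) (\<lambda>x. z (s + x))"
proof -
  interpret sh: delay_coefficient K "\<lambda>\<tau>. \<nu> (\<tau> + s)" by (rule shifted)
  have zc: "continuous_on {- 1..T} z" for T using z by (simp add: delay_solution_iff)
  have c: "continuous_on {- 1..T} (\<lambda>x. z (s + x))" for T
    by (rule continuous_on_compose2[OF zc[of "s + T"]]) (use s in \<open>auto intro!: continuous_intros\<close>)
  have "z (s + t) = z (s + 0) + path_functional (\<lambda>x. z (s + x)) t (\<lambda>\<tau>. \<nu> (\<tau> + s))" if t: "0 \<le> t" for t
  proof -
    have eq: "sh.delay_term (\<lambda>x. z (s + x)) \<tau> = delay_term z (\<tau> + s)" for \<tau>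
      unfolding sh.delay_term_def delay_term_def by (rule delay_integral_cong) (simp add: ac_simps)
    have "((\<lambda>x. delay_term z (x + s)) has_integral path_functional z (s + t) \<nu> - path_functional z s \<nu>) {s - s..s + t - s}"
      by (rule has_integral_shift_real_ivl[OF path_functional_increment_has_integral[OF zc[of "s + t"] s]])
        (use t in auto)
    moreover have "((\<lambda>x. delay_term z (x + s)) has_integral path_functional (\<lambda>x. z (s + x)) t (\<lambda>\<tau>. \<nu> (\<tau> + s))) {0..t}"
      using sh.path_functional_has_integral[OF c order_refl, of t] unfolding eq .
    ultimately have "path_functional (\<lambda>x. z (s + x)) t (\<lambda>\<tau>. \<nu> (\<tau> + s)) = path_functional z (s + t) \<nu> - path_functional z s \<nu>"
      by (simp add: has_integral_unique)
    moreover have "z (s + t) = u 0 + path_functional z (s + t) \<nu>" "z s = u 0 + path_functional z s \<nu>"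
      using z s t by (auto simp: delay_solution_iff)
    ultimately show ?thesis by simp
  qed
  then show ?thesis unfolding sh.delay_solution_iff using c by blast
qed

lemma ac_apply_continuous: "continuous_on {- 1..0} (ac_apply u)"
  by (rule abs_cont_on_continuous[OF ac_apply_abs_cont])

lemmas ac_solution = solution_continuous[OF ac_apply_continuous abs_ac_apply_le]
  solution_bound[OF ac_apply_continuous abs_ac_apply_le]
  solution_initial[OF ac_apply_continuous abs_ac_apply_le]
  solution_integral_equation[OF ac_apply_continuous abs_ac_apply_le]

text \<open>The Lipschitz constant on \<open>[0,t]\<close> of solutions whose initial function has norm 1: \<open>C\<close> times the bound
  \<open>exp (C t)\<close> for the solution.\<close>

definition lipschitz_factor :: "real \<Rightarrow> real" where
  "lipschitz_factor t = C * exp (C * t)"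

lemma solution_lipschitz:
  assumes "0 \<le> x" "x \<le> y" "y \<le> T"
  shows "\<bar>solution (ac_apply u) y - solution (ac_apply u) x\<bar> \<le> lipschitz_factor T * ac_norm u * (y - x)"
proof -
  have "\<bar>solution (ac_apply u) r\<bar> \<le> ac_norm u * exp (C * T)" if "- 1 \<le> r" "r \<le> T" for r
  proof -
    have "ac_norm u * exp (C * max r 0) \<le> ac_norm u * exp (C * T)"
      using that assms C_pos by (intro mult_left_mono ac_norm_nonneg) auto
    then show ?thesis using ac_solution(2)[of r u] that by linarith
  qed
  from path_functional_lipschitz[OF ac_solution(1) this assms] show ?thesis
    using ac_solution(4)[of x u] ac_solution(4)[of y u] assms
    by (simp add: lipschitz_factor_def mult_ac)
qed

text \<open>A solution is its initial function stopped at time 0, plus a Lipschitz function that vanishes for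
  negative times.\<close>

lemma solution_split:
  assumes "- 1 \<le> x"
  shows "solution (ac_apply u) x =
    ac_apply u (min x 0) + (solution (ac_apply u) (max x 0) - solution (ac_apply u) 0)"
  using ac_solution(3)[of x u] ac_solution(3)[of 0 u] assms by (cases "x \<le> 0") (auto simp: min_def max_def)

lemma solution_segment_abs_cont:
  assumes t: "0 \<le> t"
  shows "abs_cont_on (- 1) 0 (\<lambda>s. solution (ac_apply u) (t + s))"
proof -
  let ?z = "solution (ac_apply u)"
  have "abs_cont_on (- 1) 0 (\<lambda>s. ac_apply u (min (t + s) 0))"
    by (rule abs_cont_on_compose[OF ac_apply_abs_cont]) (use t in auto)
  moreover have "abs_cont_on (- 1) 0 (\<lambda>s. ?z (max (t + s) 0) - ?z 0)"
  proof (rule abs_cont_on_lipschitz[where L = "lipschitz_factor t * ac_norm u"])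
    fix x y :: real assume xy: "- 1 \<le> x" "x \<le> y" "y \<le> 0"
    have "\<bar>?z (max (t + y) 0) - ?z (max (t + x) 0)\<bar> \<le> lipschitz_factor t * ac_norm u * (max (t + y) 0 - max (t + x) 0)"
      using xy t by (intro solution_lipschitz) auto
    also have "\<dots> \<le> lipschitz_factor t * ac_norm u * (y - x)"
      using xy C_pos by (intro mult_left_mono mult_nonneg_nonneg ac_norm_nonneg) (auto simp: lipschitz_factor_def)
    finally show "\<bar>?z (max (t + y) 0) - ?z 0 - (?z (max (t + x) 0) - ?z 0)\<bar> \<le> lipschitz_factor t * ac_norm u * (y - x)"
      by simp
  qed
  ultimately have ac: "abs_cont_on (- 1) 0 (\<lambda>s. 1 * ac_apply u (min (t + s) 0) + 1 * (?z (max (t + s) 0) - ?z 0))"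
    by (rule abs_cont_on_lincomb)
  show ?thesis
  proof (rule abs_cont_on_cong[OF ac])
    fix x :: real assume "- 1 \<le> x" "x \<le> 0"
    then show "1 * ac_apply u (min (t + x) 0) + 1 * (?z (max (t + x) 0) - ?z 0) = ?z (t + x)"
      using solution_split[of "t + x" u] t by simp
  qed
qed

definition segment :: "real \<Rightarrow> ac \<Rightarrow> ac" where
  "segment t u = Abs_ac (\<lambda>s. if s \<in> {- 1..0} then solution (ac_apply u) (t + s) else 0)"

lemma ac_apply_segment:
  assumes "0 \<le> t"
  shows "ac_apply (segment t u) s = (if s \<in> {- 1..0} then solution (ac_apply u) (t + s) else 0)"
  unfolding segment_def ac_apply_Abs_ac_restrict[OF solution_segment_abs_cont[OF assms]] ..

text \<open>The initial function contributes to the variation at most its own norm, and the Lipschitz part at most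
  its Lipschitz constant.\<close>

lemma segment_bounded:
  assumes t: "0 \<le> t"
  shows "ac_norm (segment t u) \<le> (exp (C * t) + 1 + lipschitz_factor t) * ac_norm u"
proof (rule ac_norm_leI)
  fix n
  let ?z = "solution (ac_apply u)" and ?N = "ac_norm u"
  let ?L = "lipschitz_factor t * ?N"
  let ?p = "\<lambda>k. min (t + node n k) 0" and ?q = "\<lambda>k. max (t + node n k) 0"
  have L: "0 \<le> ?L" using C_pos ac_norm_nonneg by (simp add: lipschitz_factor_def)
  have nb: "- 1 \<le> node n k" "node n k \<le> 0" if "k \<le> Suc n" for k using node_bounds[OF that] by auto
  have val: "ac_apply (segment t u) (node n k) = ac_apply u (?p k) + (?z (?q k) - ?z 0)" if "k \<le> Suc n" for k
    using nb[OF that] t solution_split[of "t + node n k" u] by (simp add: ac_apply_segment)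
  have "grid_variation (ac_apply (segment t u)) n \<le>
      (\<Sum>k<Suc n. \<bar>ac_apply u (?p (Suc k)) - ac_apply u (?p k)\<bar> + ?L * (1 / real (Suc n)))"
    unfolding grid_variation_def
  proof (rule sum_mono)
    fix k assume "k \<in> {..<Suc n}"
    then have k: "k \<le> Suc n" "Suc k \<le> Suc n" by auto
    have "\<bar>?z (?q (Suc k)) - ?z (?q k)\<bar> \<le> ?L * (?q (Suc k) - ?q k)"
      using nb[OF k(1)] nb[OF k(2)] t node_less_Suc[of n k] by (intro solution_lipschitz) auto
    also have "?q (Suc k) - ?q k \<le> node n (Suc k) - node n k"
      using node_less_Suc[of n k] by (auto simp: max_def)
    also have "node n (Suc k) - node n k = 1 / real (Suc n)" by (simp add: node_Suc del: of_nat_Suc)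
    finally have "\<bar>?z (?q (Suc k)) - ?z (?q k)\<bar> \<le> ?L * (1 / real (Suc n))" using L by (simp add: mult_left_mono)
    then show "\<bar>ac_apply (segment t u) (node n (Suc k)) - ac_apply (segment t u) (node n k)\<bar> \<le>
        \<bar>ac_apply u (?p (Suc k)) - ac_apply u (?p k)\<bar> + ?L * (1 / real (Suc n))"
      unfolding val[OF k(1)] val[OF k(2)] by linarith
  qed
  also have "\<dots> = (\<Sum>k<Suc n. \<bar>ac_apply u (?p (Suc k)) - ac_apply u (?p k)\<bar>) + ?L"
    by (simp add: sum.distrib del: sum.lessThan_Suc of_nat_Suc)
  also have "(\<Sum>k<Suc n. \<bar>ac_apply u (?p (Suc k)) - ac_apply u (?p k)\<bar>) \<le>
      variation_upto (ac_apply u) (?p (Suc n)) - variation_upto (ac_apply u) (?p 0)"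
  proof (rule monotone_sum_telescope)
    fix k assume "k < Suc n"
    then show "\<bar>ac_apply u (?p (Suc k)) - ac_apply u (?p k)\<bar> \<le>
        variation_upto (ac_apply u) (?p (Suc k)) - variation_upto (ac_apply u) (?p k)"
      using nb[of k] nb[of "Suc k"] t node_less_Suc[of n k]
      by (intro abs_increment_le_variation_upto[OF ac_apply_abs_cont]) auto
  qed
  also have "\<dots> \<le> variation_upto (ac_apply u) 0 - variation_upto (ac_apply u) (- 1)"
    using t by (intro diff_mono variation_upto_mono) auto
  also have "\<dots> \<le> ?N" using ac_norm_eq_variation_upto[of u] by linarith
  finally have "grid_variation (ac_apply (segment t u)) n \<le> ?N + ?L" by simp
  moreover have "\<bar>ac_apply (segment t u) (- 1)\<bar> \<le> ?N * exp (C * t)"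
  proof -
    have "\<bar>?z (t - 1)\<bar> \<le> ?N * exp (C * max (t - 1) 0)" using ac_solution(2)[of "t - 1" u] t by simp
    also have "\<dots> \<le> ?N * exp (C * t)"
      using t C_pos by (intro mult_left_mono ac_norm_nonneg) auto
    finally show ?thesis by (simp add: ac_apply_segment[OF t])
  qed
  ultimately show "grid_norm (ac_apply (segment t u)) n \<le> (exp (C * t) + 1 + lipschitz_factor t) * ?N"
    by (simp add: grid_norm_def algebra_simps)
qed

lemma segment_linear:
  assumes t: "0 \<le> t"
  shows "Real_Vector_Spaces.linear (segment t)"
proof -
  have *: "ac_apply (segment t w) s = a * ac_apply (segment t u) s + b * ac_apply (segment t v) s"
    if w: "ac_apply w = (\<lambda>x. a * ac_apply u x + b * ac_apply v x)" for a b u v w s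
  proof -
    have "delay_solution \<nu> (ac_apply w) (\<lambda>x. a * solution (ac_apply u) x + b * solution (ac_apply v) x)"
      unfolding w by (intro delay_solution_lincomb delay_solution_solution ac_apply_continuous)
    then have "solution (ac_apply w) x = a * solution (ac_apply u) x + b * solution (ac_apply v) x" if "- 1 \<le> x" for x
      by (rule delay_solution_unique[OF delay_solution_solution[OF ac_apply_continuous] _ that])
    then show ?thesis using t by (simp add: ac_apply_segment)
  qed
  show ?thesis
  proof
    show "segment t (u + v) = segment t u + segment t v" for u v
      by (rule ac_eqI) (use *[of "u + v" 1 u 1 v] in \<open>simp add: plus_ac.rep_eq\<close>)
    show "segment t (r *\<^sub>R u) = r *\<^sub>R segment t u" for r u
      by (rule ac_eqI) (use *[of "r *\<^sub>R u" r u 0 u] in \<open>simp add: scaleR_ac.rep_eq\<close>)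
  qed
qed

lemma segment_0: "segment 0 u = u"
  by (rule ac_eqI) (simp add: ac_apply_segment ac_solution(3))

text \<open>The shifted solution solves the shifted equation with the segment at time \<open>s\<close> as initial function.\<close>

lemma segment_shift:
  assumes shifted: "delay_coefficient K (\<lambda>\<tau>. \<nu> (\<tau> + s))" and s: "0 \<le> s" and t: "0 \<le> t"
  shows "delay_coefficient.segment (\<lambda>\<tau>. \<nu> (\<tau> + s)) t (segment s u) = segment (s + t) u"
proof -
  interpret sh: delay_coefficient K "\<lambda>\<tau>. \<nu> (\<tau> + s)" by (rule shifted)
  let ?z = "solution (ac_apply u)"
  have "delay_solution (\<lambda>\<tau>. \<nu> (\<tau> + s)) (\<lambda>r. ?z (s + r)) (\<lambda>x. ?z (s + x))"
    by (rule delay_solution_shift[OF shifted s delay_solution_solution[OF ac_apply_continuous]])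
  then have "delay_solution (\<lambda>\<tau>. \<nu> (\<tau> + s)) (ac_apply (segment s u)) (\<lambda>x. ?z (s + x))"
    unfolding sh.delay_solution_iff by (simp add: ac_apply_segment[OF s])
  then have "sh.solution (ac_apply (segment s u)) x = ?z (s + x)" if "- 1 \<le> x" for x
    using sh.delay_solution_unique[OF sh.delay_solution_solution[OF ac_apply_continuous]] that by blast
  then show ?thesis
    using s t by (intro ac_eqI) (simp add: sh.ac_apply_segment ac_apply_segment add.assoc)
qed

lemma solution_operator_eq_segment:
  assumes "0 \<le> t" "\<nu> = (\<lambda>\<tau>. \<mu> (\<theta> \<tau> \<omega>))"
  shows "solution_operator \<theta> \<mu> \<omega> t u = segment t u"
  unfolding solution_operator_def segment_def assms(2)[symmetric]
  by (rule arg_cong[where f = Abs_ac])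
    (use assms(1) in \<open>auto simp: the_delay_solution_solution[OF ac_apply_continuous]\<close>)

end

section \<open>Measurable dependence on parameters\<close>

text \<open>In a cell the interpolant is a convex combination of two values close to \<open>y x\<close>. The grid has to
  extend beyond \<open>t\<close>, whence the integer \<open>R\<close>.\<close>

lemma interpolant_uniform_limit:
  assumes y: "continuous_on {- 1..real R} y" and t: "t < real R"
  shows "uniform_limit {- 1..t} (\<lambda>n. interpolant n (Suc n * Suc R) y) y sequentially"
  unfolding uniform_limit_iff
proof (intro allI impI)
  fix \<epsilon> :: real assume \<epsilon>: "\<epsilon> > 0"
  have "uniformly_continuous_on {- 1..real R} y" using y by (intro compact_uniformly_continuous) auto
  then obtain \<delta> where \<delta>: "\<delta> > 0" "\<And>x x'. x \<in> {- 1..real R} \<Longrightarrow> x' \<in> {- 1..real R} \<Longrightarrow> dist x' x < \<delta> \<Longrightarrow>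
      dist (y x') (y x) < \<epsilon> / 2"
    unfolding uniformly_continuous_on_def using \<epsilon> by (metis half_gt_zero)
  have "\<forall>\<^sub>F n in sequentially. 1 / real (Suc n) < \<delta>"
    by (rule eventually_mesh_less[OF \<delta>(1)])
  then show "\<forall>\<^sub>F n in sequentially. \<forall>x\<in>{- 1..t}. dist (interpolant n (Suc n * Suc R) y x) (y x) < \<epsilon>"
  proof (eventually_elim, intro ballI)
    fix n x assume n: "1 / real (Suc n) < \<delta>" and "x \<in> {- 1..t}"
    then have x: "- 1 \<le> x" "x \<le> t" by auto
    let ?m = "Suc n * Suc R"
    have last: "node n ?m = real R" by (simp add: node_def field_simps)
    obtain j where j: "node n j \<le> x" "x < node n (Suc j)" using node_cell[OF x(1)] by blast
    have jm: "j < ?m"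
    proof (rule ccontr)
      assume "\<not> ?thesis"
      then show False using node_mono[of ?m j n] last j x t by simp
    qed
    have "- 1 \<le> node n j" "node n (Suc j) \<le> real R"
      using node_mono[of 0 j n] node_mono[of "Suc j" ?m n] last jm by auto
    then have d: "\<bar>y (node n j) - y x\<bar> \<le> \<epsilon> / 2" "\<bar>y (node n (Suc j)) - y x\<bar> \<le> \<epsilon> / 2"
      using \<delta>(2)[of x "node n j"] \<delta>(2)[of x "node n (Suc j)"] j x t n node_Suc[of n j]
      by (auto simp: dist_real_def)
    define l where "l = real (Suc n) * (x - node n j)"
    have "real (Suc n) * (x - node n j) \<le> real (Suc n) * (1 / real (Suc n))"
      using j node_Suc[of n j] by (intro mult_left_mono) auto
    then have l: "0 \<le> l" "l \<le> 1" using j by (auto simp: l_def)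
    have "interpolant n ?m y x - y x = (1 - l) * (y (node n j) - y x) + l * (y (node n (Suc j)) - y x)"
      unfolding interpolant_cell[OF j(1) less_imp_le[OF j(2)] jm] l_def[symmetric] by (simp add: algebra_simps)
    also have "\<bar>\<dots>\<bar> \<le> (1 - l) * \<bar>y (node n j) - y x\<bar> + l * \<bar>y (node n (Suc j)) - y x\<bar>"
      using l by (intro order_trans[OF abs_triangle_ineq]) (simp add: abs_mult)
    also have "\<dots> \<le> (1 - l) * (\<epsilon> / 2) + l * (\<epsilon> / 2)"
      using d l by (intro add_mono mult_left_mono) auto
    also have "\<dots> = \<epsilon> / 2" by (simp flip: distrib_right)
    finally show "dist (interpolant n ?m y x) (y x) < \<epsilon>" using \<epsilon> by (simp add: dist_real_def)
  qed
qed

text \<open>The interpolant of \<open>y p\<close> depends on \<open>p\<close> only through its coefficients in front of fixed hat functions,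
  so the integral operator applied to it is a finite sum of products of measurable functions.\<close>

lemma path_functional_measurable_parametric:
  assumes coef: "\<And>p. p \<in> space N \<Longrightarrow> delay_coefficient K (\<nu> p)"
    and hats: "\<And>n k. (\<lambda>p. path_functional (hat n k) t (\<nu> p)) \<in> borel_measurable N"
    and y: "\<And>p T. p \<in> space N \<Longrightarrow> continuous_on {- 1..T} (y p)"
    and meas: "\<And>x. - 1 \<le> x \<Longrightarrow> (\<lambda>p. y p x) \<in> borel_measurable N"
    and t: "0 \<le> t"
  shows "(\<lambda>p. path_functional (y p) t (\<nu> p)) \<in> borel_measurable N"
proof -
  define R where "R = nat \<lceil>t\<rceil> + 1"
  have R: "t < real R" unfolding R_def by linarith
  let ?m = "\<lambda>n. Suc n * Suc R"
  let ?P = "\<lambda>n p. \<Sum>k<Suc (?m n). y p (node n k) * path_functional (hat n k) t (\<nu> p)"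
  show ?thesis
  proof (rule borel_measurable_LIMSEQ_real)
    show "?P n \<in> borel_measurable N" for n
      using node_mono[of 0 _ n] by (intro borel_measurable_sum borel_measurable_times hats meas) simp
    fix p assume p: "p \<in> space N"
    interpret delay_coefficient K "\<nu> p" by (rule coef[OF p])
    have ic: "continuous_on {- 1..t} (interpolant n m (y p))" for n m
      unfolding interpolant_def[abs_def] by (intro continuous_intros continuous_on_hat)
    have P: "?P n p = path_functional (interpolant n (?m n) (y p)) t (\<nu> p)" for n
      unfolding interpolant_def[abs_def] lessThan_Suc_atMost[symmetric]
      by (rule path_functional_sum[OF continuous_on_hat order_refl, symmetric])
    show "(\<lambda>n. ?P n p) \<longlonglongrightarrow> path_functional (y p) t (\<nu> p)"
      unfolding P
      by (rule path_functional_uniform_limit[OF ic y[OF p] interpolant_uniform_limit[OF y[OF p] R] t])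
  qed
qed

text \<open>All terms of the Picard series are measurable, by induction.\<close>

lemma solution_measurable_parametric:
  assumes coef: "\<And>p. p \<in> space N \<Longrightarrow> delay_coefficient K (\<nu> p)"
    and hats: "\<And>n k t. 0 \<le> t \<Longrightarrow> (\<lambda>p. path_functional (hat n k) t (\<nu> p)) \<in> borel_measurable N"
    and u: "\<And>p. p \<in> space N \<Longrightarrow> continuous_on {- 1..0} (u p)"
    and meas: "\<And>x. (\<lambda>p. u p x) \<in> borel_measurable N"
    and x: "- 1 \<le> x"
  shows "(\<lambda>p. delay_coefficient.solution (\<nu> p) (u p) x) \<in> borel_measurable N"
proof -
  have "(\<lambda>p. delay_coefficient.picard (\<nu> p) (u p) n x) \<in> borel_measurable N" for n
    using x
  proof (induction n arbitrary: x)
    case 0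
    have "(\<lambda>p. u p (min x 0)) \<in> borel_measurable N" by (rule meas)
    then show ?case
      by (rule measurable_cong[THEN iffD1, rotated]) (simp add: delay_coefficient.picard.simps[OF coef])
  next
    case (Suc n)
    have "(\<lambda>p. path_functional (delay_coefficient.picard (\<nu> p) (u p) n) (max x 0) (\<nu> p)) \<in> borel_measurable N"
      by (rule path_functional_measurable_parametric[OF coef hats])
        (use Suc.IH in \<open>auto intro: delay_coefficient.picard_continuous[OF coef u]\<close>)
    then show ?case
      by (rule measurable_cong[THEN iffD1, rotated]) (simp add: delay_coefficient.picard.simps[OF coef])
  qed
  then have "(\<lambda>p. \<Sum>n. delay_coefficient.picard (\<nu> p) (u p) n x) \<in> borel_measurable N"
    by (rule borel_measurable_suminf)
  then show ?thesis
    by (rule measurable_cong[THEN iffD1, rotated]) (simp add: delay_coefficient.solution_def[OF coef])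
qed

text \<open>Evaluation at a variable time is the limit of evaluations at times rounded up to a grid, which take
  countably many values.\<close>

lemma measurable_continuous_evaluation:
  fixes Z :: "'p \<Rightarrow> real \<Rightarrow> real"
  assumes cont: "\<And>p T. p \<in> space N \<Longrightarrow> continuous_on {- 1..T} (Z p)"
    and meas: "\<And>x. - 1 \<le> x \<Longrightarrow> (\<lambda>p. Z p x) \<in> borel_measurable N"
    and h: "h \<in> Q \<rightarrow>\<^sub>M N" and g: "g \<in> borel_measurable Q" "\<And>q. q \<in> space Q \<Longrightarrow> - 1 \<le> g q"
  shows "(\<lambda>q. Z (h q) (g q)) \<in> borel_measurable Q"
proof (rule borel_measurable_LIMSEQ_real)
  define r where "r n i = max (- 1) (real_of_int i / real (Suc n))" for n i
  show "(\<lambda>q. Z (h q) (r n \<lceil>g q * real (Suc n)\<rceil>)) \<in> borel_measurable Q" for n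
  proof (rule measurable_compose_countable)
    show "(\<lambda>q. Z (h q) (r n i)) \<in> borel_measurable Q" for i
      by (rule measurable_compose[OF h meas]) (simp add: r_def)
    show "(\<lambda>q. \<lceil>g q * real (Suc n)\<rceil>) \<in> measurable Q (count_space UNIV)"
      using g(1) by measurable
  qed
  fix q assume q: "q \<in> space Q"
  have hq: "h q \<in> space N" using measurable_space[OF h q] .
  have r: "g q \<le> r n \<lceil>g q * real (Suc n)\<rceil>" "r n \<lceil>g q * real (Suc n)\<rceil> \<le> g q + 1 / real (Suc n)" for n
  proof -
    have *: "g q * real (Suc n) \<le> real_of_int \<lceil>g q * real (Suc n)\<rceil>"
      "real_of_int \<lceil>g q * real (Suc n)\<rceil> \<le> g q * real (Suc n) + 1" by linarith+
    have "g q = g q * real (Suc n) / real (Suc n)" by simp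
    also have "\<dots> \<le> real_of_int \<lceil>g q * real (Suc n)\<rceil> / real (Suc n)"
      using *(1) by (intro divide_right_mono) auto
    finally show "g q \<le> r n \<lceil>g q * real (Suc n)\<rceil>" by (simp add: r_def)
    have "real_of_int \<lceil>g q * real (Suc n)\<rceil> / real (Suc n) \<le> (g q * real (Suc n) + 1) / real (Suc n)"
      using *(2) by (intro divide_right_mono) auto
    also have "\<dots> = g q + 1 / real (Suc n)" by (simp add: add_divide_distrib)
    finally show "r n \<lceil>g q * real (Suc n)\<rceil> \<le> g q + 1 / real (Suc n)"
      using g(2)[OF q] by (simp add: r_def add_increasing2)
  qed
  have "(\<lambda>n. g q + 1 / real (Suc n)) \<longlonglongrightarrow> g q + 0"
    by (intro tendsto_intros mesh_tendsto_0)
  then have lim: "(\<lambda>n. r n \<lceil>g q * real (Suc n)\<rceil>) \<longlonglongrightarrow> g q"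
    using tendsto_sandwich[OF always_eventually always_eventually tendsto_const[of "g q"],
        of "\<lambda>n. r n \<lceil>g q * real (Suc n)\<rceil>" "\<lambda>n. g q + 1 / real (Suc n)"] r by simp
  have "r n \<lceil>g q * real (Suc n)\<rceil> \<in> {- 1..g q + 1}" for n
    using r[of n] g(2)[OF q] by (auto simp: r_def intro: order_trans)
  then show "(\<lambda>n. Z (h q) (r n \<lceil>g q * real (Suc n)\<rceil>)) \<longlonglongrightarrow> Z (h q) (g q)"
    using continuous_on_tendsto_compose[OF cont[OF hq, of "g q + 1"] lim] g(2)[OF q] by auto
qed

text \<open>The \<open>\<sigma>\<close>-algebra on paths is generated by these functionals.\<close>

lemma path_functional_measurable_path_algebra:
  assumes "abs_cont_on (- 1) T y" "t \<in> {0..T}"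
  shows "path_functional y t \<in> borel_measurable (path_algebra K T)"
proof (rule measurableI)
  fix B :: "real set" assume "B \<in> sets borel"
  then show "path_functional y t -` B \<inter> space (path_algebra K T) \<in> sets (path_algebra K T)"
    unfolding path_algebra_def
    by (subst space_measure_of sets_measure_of, use assms in blast)+ (use assms in \<open>intro sigma_sets.Basic, blast\<close>)
qed simp


theorem theorem7p3:
  fixes M :: "'w measure" and \<theta> :: "real \<Rightarrow> 'w \<Rightarrow> 'w"
    and K :: real and \<mu> :: "'w \<Rightarrow> real set \<Rightarrow> real"
  assumes "metric_dynamical_system M \<theta>"
    and "K > 0"
    and "\<And>\<omega>. \<omega> \<in> space M \<Longrightarrow> \<mu> \<omega> \<in> delay_measures K"
    and "\<And>T \<omega>. T > 0 \<Longrightarrow> \<omega> \<in> space M \<Longrightarrow>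
           (\<lambda>t\<in>{0..T}. \<mu> (\<theta> t \<omega>)) \<in> coefficient_paths K T"
    and "\<And>T. T > 0 \<Longrightarrow>
           (\<lambda>\<omega>. \<lambda>t\<in>{0..T}. \<mu> (\<theta> t \<omega>)) \<in> M \<rightarrow>\<^sub>M path_algebra K T"
  shows "measurable_linear_skew_product_semiflow M \<theta> ac_norm (solution_operator \<theta> \<mu>)"
proof -
  interpret metric_dynamical_system M \<theta> by (rule assms(1))
  let ?path = "\<lambda>\<omega> \<tau>. \<mu> (\<theta> \<tau> \<omega>)"
  have flow_space: "\<theta> t \<omega> \<in> space M" if "\<omega> \<in> space M" for t \<omega>
    using measurable_space[OF flow_measurable, of "(t, \<omega>)"] that by (simp add: space_pair_measure)
  have coef: "delay_coefficient K (?path \<omega>)" if \<omega>: "\<omega> \<in> space M" for \<omega>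
  proof
    fix T :: real and f :: "real \<Rightarrow> real" assume T: "0 < T" and f: "continuous_on {- 1..0} f"
    have "(\<lambda>t. delay_integral ((\<lambda>t\<in>{0..T}. \<mu> (\<theta> t \<omega>)) t) f) \<in> borel_measurable (lebesgue_on {0..T})"
      using assms(4)[OF T \<omega>] f unfolding coefficient_paths_def by blast
    then show "(\<lambda>\<tau>. delay_integral (\<mu> (\<theta> \<tau> \<omega>)) f) \<in> borel_measurable (lebesgue_on {0..T})"
      by (rule measurable_cong[THEN iffD1, rotated]) (simp add: space_restrict_space)
  qed (use assms(2,3) flow_space[OF \<omega>] in auto)
  have op: "solution_operator \<theta> \<mu> \<omega> t = delay_coefficient.segment (?path \<omega>) t"
    if "\<omega> \<in> space M" "0 \<le> t" for \<omega> t
    by (rule ext, rule delay_coefficient.solution_operator_eq_segment[OF coef[OF that(1)] that(2)]) (rule refl)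
  \<comment> \<open>Hat functions are absolutely continuous, so the hypothesis on the coefficient paths applies to them;
    it needs a time interval of positive length, even for \<open>t = 0\<close>, whence \<open>[0,t+1]\<close>.\<close>
  have hats: "(\<lambda>\<omega>. path_functional (hat n k) t (?path \<omega>)) \<in> borel_measurable M" if t: "0 \<le> t" for n k t
  proof -
    have "(\<lambda>\<omega>. path_functional (hat n k) t (\<lambda>t\<in>{0..t + 1}. \<mu> (\<theta> t \<omega>))) \<in> borel_measurable M"
      by (rule measurable_compose[OF assms(5) path_functional_measurable_path_algebra[OF abs_cont_on_hat]]) (use t in auto)
    moreover have "path_functional (hat n k) t (\<lambda>t\<in>{0..t + 1}. \<mu> (\<theta> t \<omega>)) = path_functional (hat n k) t (?path \<omega>)" for \<omega>
      unfolding path_functional_def by (rule set_lebesgue_integral_cong) auto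
    ultimately show ?thesis by simp
  qed
  show ?thesis
  proof (rule measurable_linear_skew_product_semiflow.intro[OF assms(1)],
      rule measurable_linear_skew_product_semiflow_axioms.intro)
    show "banach_norm ac_norm" by (rule banach_norm_ac_norm)
    fix \<omega> assume \<omega>: "\<omega> \<in> space M"
    interpret delay_coefficient K "?path \<omega>" by (rule coef[OF \<omega>])
    show "solution_operator \<theta> \<mu> \<omega> 0 = id"
      unfolding op[OF \<omega> order_refl] by (rule ext) (simp add: segment_0)
    fix t :: real assume t: "0 \<le> t"
    show "Real_Vector_Spaces.linear (solution_operator \<theta> \<mu> \<omega> t)"
      unfolding op[OF \<omega> t] by (rule segment_linear[OF t])
    show "\<exists>C. \<forall>u. ac_norm (solution_operator \<theta> \<mu> \<omega> t u) \<le> C * ac_norm u"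
      unfolding op[OF \<omega> t] using segment_bounded[OF t] by blast
    fix s :: real assume s: "0 \<le> s"
    have shifted: "?path (\<theta> s \<omega>) = (\<lambda>\<tau>. \<mu> (\<theta> (\<tau> + s) \<omega>))"
      using flow_add[OF \<omega>] by simp
    show "solution_operator \<theta> \<mu> (\<theta> s \<omega>) t \<circ> solution_operator \<theta> \<mu> \<omega> s = solution_operator \<theta> \<mu> \<omega> (t + s)"
    proof
      fix u
      show "(solution_operator \<theta> \<mu> (\<theta> s \<omega>) t \<circ> solution_operator \<theta> \<mu> \<omega> s) u = solution_operator \<theta> \<mu> \<omega> (t + s) u"
        using segment_shift[OF _ s t, of u] coef[OF flow_space[OF \<omega>, of s]] s t
        by (simp add: op[OF \<omega>] op[OF flow_space[OF \<omega>]] shifted add.commute)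
    qed
  next
    let ?Q = "restrict_space borel {0::real..} \<Otimes>\<^sub>M M \<Otimes>\<^sub>M norm_borel ac_norm"
    let ?N = "M \<Otimes>\<^sub>M norm_borel ac_norm"
    let ?Z = "\<lambda>p. delay_coefficient.solution (?path (fst p)) (ac_apply (snd p))"
    have coefN: "delay_coefficient K (?path (fst p))" if "p \<in> space ?N" for p
      using that coef by (auto simp: space_pair_measure)
    have Zmeas: "(\<lambda>p. ?Z p x) \<in> borel_measurable ?N" if "- 1 \<le> x" for x
    proof (rule solution_measurable_parametric[OF coefN _ _ _ that])
      show "(\<lambda>p. path_functional (hat n k) t (?path (fst p))) \<in> borel_measurable ?N" if "0 \<le> t" for n k t
        using hats[OF that] by measurable
      show "(\<lambda>p. ac_apply (snd p) y) \<in> borel_measurable ?N" for y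
        by (rule measurable_compose[OF measurable_snd ac_apply_measurable])
    qed (auto intro: abs_cont_on_continuous[OF ac_apply_abs_cont])
    show "(\<lambda>(t, \<omega>, u). solution_operator \<theta> \<mu> \<omega> t u) \<in> ?Q \<rightarrow>\<^sub>M norm_borel ac_norm"
    proof (rule measurable_norm_borelI)
      fix s
      have Q: "0 \<le> fst q" "snd q \<in> space ?N" if "q \<in> space ?Q" for q
        using that by (auto simp: space_pair_measure space_restrict_space)
      have val: "ac_apply (case q of (t, \<omega>, u) \<Rightarrow> solution_operator \<theta> \<mu> \<omega> t u) s =
          (if s \<in> {- 1..0} then ?Z (snd q) (fst q + s) else 0)" if q: "q \<in> space ?Q" for q
      proof -
        obtain t \<omega> u where "q = (t, \<omega>, u)" by (cases q)
        then show ?thesis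
          using Q[OF q] op[of \<omega> t] delay_coefficient.ac_apply_segment[OF coef[of \<omega>], of t u s]
          by (simp add: space_pair_measure)
      qed
      have "(\<lambda>q. if s \<in> {- 1..0} then ?Z (snd q) (fst q + s) else 0) \<in> borel_measurable ?Q"
      proof (cases "s \<in> {- 1..0}")
        case True
        have "(\<lambda>q. ?Z (snd q) (fst q + s)) \<in> borel_measurable ?Q"
        proof (rule measurable_continuous_evaluation[OF _ Zmeas measurable_snd])
          show "continuous_on {- 1..T} (?Z p)" if "p \<in> space ?N" for p T
            by (rule delay_coefficient.ac_solution(1)[OF coefN[OF that]])
          have "fst \<in> borel_measurable ?Q"
            by (rule measurable_compose[OF measurable_fst]) (rule measurable_restrict_space1, simp)
          then show "(\<lambda>q. fst q + s) \<in> borel_measurable ?Q" by measurable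
          show "- 1 \<le> fst q + s" if "q \<in> space ?Q" for q using Q(1)[OF that] True by simp
        qed
        then show ?thesis unfolding if_P[OF True] .
      next
        case False
        show ?thesis unfolding if_not_P[OF False] by (rule borel_measurable_const)
      qed
      then show "(\<lambda>x. ac_apply (case x of (t, \<omega>, u) \<Rightarrow> solution_operator \<theta> \<mu> \<omega> t u) s) \<in> borel_measurable ?Q"
        by (rule measurable_cong[THEN iffD1, rotated]) (simp only: val)
    qed
  qed
qed

end
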